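(* Let $\mathcal{H}=\mathbb{R}^n$ and suppose that the standing assumptions listed in the context hold. Let $\{u_k\},\{z_k\},\{x_k\}$ be generated by the non-stationary Forward--Douglas--Rachford iteration: $z_0\in\mathbb{R}^n$, $x_0=\mathrm{P}_V(z_0)$ and, for $k\ge 0$, $$u_{k+1}=\mathrm{prox}_{\gamma_k R}\big(2x_k-z_k-\gamma_k\nabla G(x_k)\big),\quad z_{k+1}=z_k+\lambda_k(u_{k+1}-x_k),\quad x_{k+1}=\mathrm{P}_V(z_{k+1}),$$ so that $z_k\to z^\star\in\mathrm{fix}(\mathscr{F}_\gamma)$ and $u_k,x_k\to x^\star=\mathrm{P}_V(z^\star)\in\operatorname{Argmin}(\Phi_V)$. Assume that $R$ is partly smooth at $x^\star$ relative to $\mathcal{M}^R_{x^\star}$ and that $\frac{x^\star-z^\star}{\gamma}-\nabla G(x^\star)\in\mathrm{ri}(\partial R(x^\star))$. If moreover $\lambda_k\to\lambda\in\,]0,\frac{4\beta_V-\gamma}{2\beta_V}[$ and $F$ is $C^2$ in a neighbourhood of $x^\star$, then for all $k$ large enough $$z_{k+1}-z^\star=\mathcal{M}_{\gamma,\lambda}(z_k-z^\star)+\psi_k+\chi_k,$$ where $\psi_k=o(\|z_k-z^\star\|)$ and $\chi_k=O(\lambda_k|\gamma_k-\gamma|)$. Both $\psi_k$ and $\chi_k$ vanish when $R$ is locally polyhedral around $x^\star$, $F$ is quadratic, and $(\gamma_k,\lambda_k)$ are chosen constant in $]0,2\beta_V[\,\times\,]0,\frac{4\beta_V-\gamma}{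2\beta_V}[$.
   Context: Standing assumptions ($\mathcal{H}=\mathbb{R}^n$). $R:\mathbb{R}^n\to\,]-\infty,+\infty]$ is proper convex lower semicontinuous. $F:\mathbb{R}^n\to\mathbb{R}$ is convex, continuously differentiable, with $\nabla F$ being $(1/\beta)$-Lipschitz, $\beta>0$. $V$ is a vector subspace with orthogonal projector $\mathrm{P}_V$. $G:=F\circ\mathrm{P}_V$, so $\nabla G=\mathrm{P}_V\circ\nabla F\circ\mathrm{P}_V$; $\beta_V\ge\beta$ is a constant such that $\nabla G$ is $(1/\beta_V)$-Lipschitz. $\Phi_V:=G+R+\iota_V$ ($\iota_V$ the indicator function of $V$), and $\operatorname{Argmin}(\Phi_V)\ne\emptyset$. Parameters: $0<\underline{\gamma}\le\gamma_k\le\overline{\gamma}<2\beta_V$, $\gamma_k\to\gamma\in[\underline\gamma,\overline\gamma]$; $\lambda_k\in\,]0,\frac{4\beta_V-\gamma_k}{2\beta_V}[$; $\sum_k\lambda_k\big(\frac{4\beta_V-\gamma_k}{2\beta_V}-\lambda_k\big)=+\infty$; $\sum_k\lambda_k|\gamma_k-\gamma|<+\infty$. Notation: $\mathrm{prox}_{\gamma R}(x)=\operatorname{argmin}_u\gamma R(u)+\frac12\|u-x\|^2$; $\mathcal{R}_{\gamma R}=2\,\mathrm{prox}_{\gamma R}-\mathrm{Id}$; $\mathcal{R}_V=2\mathrm{P}_V-\mathrm{Id}$; $\mathscr{F}_\gamma=\frac12(\mathrm{Id}+\mathcal{R}_{\gamma R}\circ\mathcal{R}_V)\circ(\mathrm{Id}-\gamma\nabla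 G)$, with fixed point set $\mathrm{fix}(\mathscr{F}_\gamma)$; $\mathrm{ri}$ is the relative interior. For a nonempty convex set $C$, $\mathrm{par}(C)$ is the linear subspace parallel to its affine hull, and $T^R_x:=\mathrm{par}(\partial R(x))^\perp$, with orthogonal projector $\mathrm{P}_{T^R_x}$. Partial smoothness: $R$ is partly smooth at $x$ (with $\partial R(x)\ne\emptyset$) relative to a set $\mathcal{M}\ni x$ if (1) $\mathcal{M}$ is a $C^2$-smooth embedded submanifold of $\mathbb{R}^n$ around $x$ and $R|_{\mathcal{M}}$ is $C^2$ around $x$; (2) the tangent space of $\mathcal{M}$ at $x$ equals $T^R_x$; (3) the set-valued map $\partial R$ is continuous at $x$ relative to $\mathcal{M}$. "Locally polyhedral around $x^\star$" means that $R$ coincides with a polyhedral convex function in a neighbourhood of $x^\star$. Riemannian Hessian: for $J$ of class $C^2$ on $\mathcal{M}$ near $x$, $\nabla^2_{\mathcal{M}}J(x)$ is the symmetric linear map of the tangent space $\mathcal{T}_{\mathcal{M}}(x)$ with $\langle\nabla^2_{\mathcal{M}}J(x)h,h\rangle=\frac{d^2}{dt^2}J(\mathrm{P}_{\mathcal{M}}(x+th))|_{t=0}$ for $h\in\mathcal{T}_{\mathcal{M}}(x)$, where $\mathrm{P}_{\mathcal{M}}$ is the projection onto $\mathcal{M}$. Matrices: $\overline{R}(u):=\gamma R(u)-\langle u,\,x^\star-z^\star-\gamma\nabla G(x^\star)\rangle$; $H_{\overline R}:=\mathrm{P}_{T^R_{x^\star}}\nabla^2_{\mathcal{M}^R_{x^\star}}\overline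 R(x^\star)\mathrm{P}_{T^R_{x^\star}}$; $W_{\overline R}:=(\mathrm{Id}+H_{\overline R})^{-1}$; $M_{\overline R}:=\mathrm{P}_{T^R_{x^\star}}W_{\overline R}\mathrm{P}_{T^R_{x^\star}}$; $H_G:=\mathrm{P}_V\nabla^2F(x^\star)\mathrm{P}_V$; $\mathcal{M}_\gamma:=\mathrm{Id}+2M_{\overline R}\mathrm{P}_V-M_{\overline R}-\mathrm{P}_V-\gamma M_{\overline R}H_G$; $\mathcal{M}_{\gamma,\lambda}:=(1-\lambda)\mathrm{Id}+\lambda\mathcal{M}_\gamma$. *)

theory Defs
  imports "HOL-Analysis.Analysis" "HOL-Library.Landau_Symbols"
begin

section \<open>Convex analysis for extended-real-valued functions\<close>

definition proper_fun :: "('a \<Rightarrow> ereal) \<Rightarrow> bool" where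
  "proper_fun f \<longleftrightarrow> (\<forall>x. f x \<noteq> -\<infinity>) \<and> (\<exists>x. f x \<noteq> \<infinity>)"

definition convex_fun :: "('a::real_vector \<Rightarrow> ereal) \<Rightarrow> bool" where
  "convex_fun f \<longleftrightarrow> (\<forall>x y t. 0 < t \<and> t < 1 \<longrightarrow>
     f ((1 - t) *\<^sub>R x + t *\<^sub>R y) \<le> ereal (1 - t) * f x + ereal t * f y)"

definition lsc_fun :: "('a::topological_space \<Rightarrow> ereal) \<Rightarrow> bool" where
  "lsc_fun f \<longleftrightarrow> (\<forall>x. f x \<le> Liminf (at x) f)"

definition indicator_fun :: "'a set \<Rightarrow> 'a \<Rightarrow> ereal" where
  "indicator_fun C x = (if x \<in> C then 0 else \<infinity>)"

text \<open>A function that is identically \<open>\<infinity>\<close> has no minimizers.\<close>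

definition Argmin :: "('a \<Rightarrow> ereal) \<Rightarrow> 'a set" where
  "Argmin f = {x. f x < \<infinity> \<and> (\<forall>y. f x \<le> f y)}"

definition subdiff :: "('a::real_inner \<Rightarrow> ereal) \<Rightarrow> 'a \<Rightarrow> 'a set" where
  "subdiff f x = {v. \<forall>y. f x + ereal (v \<bullet> (y - x)) \<le> f y}"

definition prox :: "('a::real_inner \<Rightarrow> ereal) \<Rightarrow> 'a \<Rightarrow> 'a" where
  "prox f x = (THE p. p \<in> Argmin (\<lambda>u. f u + ereal ((norm (u - x))\<^sup>2 / 2)))"

text \<open>A polyhedral convex function is one whose epigraph is a polyhedron; values in
  \<open>]-\<infinity>,\<infinity>]\<close>.\<close>

definition polyhedral_fun :: "('a::euclidean_space \<Rightarrow> ereal) \<Rightarrow> bool" where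
  "polyhedral_fun f \<longleftrightarrow> (\<forall>x. f x \<noteq> -\<infinity>) \<and> polyhedron {(x, t::real). f x \<le> ereal t}"

definition locally_polyhedral :: "('a::euclidean_space \<Rightarrow> ereal) \<Rightarrow> 'a \<Rightarrow> bool" where
  "locally_polyhedral f x \<longleftrightarrow> (\<exists>p. polyhedral_fun p \<and> (\<forall>\<^sub>F y in nhds x. f y = p y))"

definition quadratic_fun :: "(real^'n \<Rightarrow> real) \<Rightarrow> bool" where
  "quadratic_fun f \<longleftrightarrow>
     (\<exists>(A::real^'n^'n) b c. \<forall>x. f x = (x \<bullet> (A *v x)) / 2 + b \<bullet> x + c)"

section \<open>Projectors, gradients and Hessians\<close>

definition orth_proj :: "'a::euclidean_space set \<Rightarrow> 'a \<Rightarrow> 'a" where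
  "orth_proj V x = (THE p. p \<in> V \<and> (\<forall>v\<in>V. orthogonal (x - p) v))"

abbreviation proj_mat :: "(real^'n) set \<Rightarrow> real^'n^'n" where
  "proj_mat V \<equiv> matrix (orth_proj V)"

definition par :: "'a::real_vector set \<Rightarrow> 'a set" where
  "par C = {x - y | x y. x \<in> affine hull C \<and> y \<in> affine hull C}"

definition tangent_model :: "('a::euclidean_space \<Rightarrow> ereal) \<Rightarrow> 'a \<Rightarrow> 'a set" where
  "tangent_model f x = orthogonal_comp (par (subdiff f x))"

definition grad :: "('a::real_inner \<Rightarrow> real) \<Rightarrow> 'a \<Rightarrow> 'a" where
  "grad f x = (THE D. GDERIV f x :> D)"

definition hess_mat :: "(real^'n \<Rightarrow> real) \<Rightarrow> real^'n \<Rightarrow> real^'n^'n" where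
  "hess_mat f x = matrix (frechet_derivative (grad f) (at x))"

text \<open>Twice continuously differentiable; intended for open \<open>U\<close>.\<close>

definition C2_on :: "'a::real_normed_vector set \<Rightarrow> ('a \<Rightarrow> 'b::real_normed_vector) \<Rightarrow> bool" where
  "C2_on U f \<longleftrightarrow> (\<exists>(f' :: 'a \<Rightarrow> 'a \<Rightarrow>\<^sub>L 'b) (f'' :: 'a \<Rightarrow> 'a \<Rightarrow>\<^sub>L ('a \<Rightarrow>\<^sub>L 'b)).
     (\<forall>x\<in>U. (f has_derivative blinfun_apply (f' x)) (at x)) \<and>
     (\<forall>x\<in>U. (f' has_derivative blinfun_apply (f'' x)) (at x)) \<and>
     continuous_on U f'')"

section \<open>Submanifolds and partial smoothness\<close>

text \<open>Near \<open>x\<close>, the set \<open>M\<close> is straightened to a piece of a linear subspace by a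
  \<open>C\<^sup>2\<close>-diffeomorphism \<open>\<phi>\<close> between open subsets of the ambient space (slice chart).\<close>

definition C2_submanifold_around :: "'a::euclidean_space set \<Rightarrow> 'a \<Rightarrow> bool" where
  "C2_submanifold_around M x \<longleftrightarrow> (\<exists>U W S (\<phi> :: 'a \<Rightarrow> 'a) (\<psi> :: 'a \<Rightarrow> 'a).
     open U \<and> x \<in> U \<and> open W \<and> subspace S \<and>
     C2_on U \<phi> \<and> C2_on W \<psi> \<and> \<phi> ` U = W \<and>
     (\<forall>y\<in>U. \<psi> (\<phi> y) = y) \<and> \<phi> ` (M \<inter> U) = S \<inter> W)"

text \<open>The restriction of \<open>f\<close> to \<open>M\<close> is \<open>C\<^sup>2\<close> around \<open>x\<close> when it has a (finite-valued)
  \<open>C\<^sup>2\<close> extension to an ambient neighbourhood.\<close>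

definition C2_restricted_around :: "'a::euclidean_space set \<Rightarrow> ('a \<Rightarrow> ereal) \<Rightarrow> 'a \<Rightarrow> bool" where
  "C2_restricted_around M f x \<longleftrightarrow> (\<exists>U (g :: 'a \<Rightarrow> real).
     open U \<and> x \<in> U \<and> C2_on U g \<and> (\<forall>y\<in>M \<inter> U. f y = ereal (g y)))"

definition tangent_space :: "'a::euclidean_space set \<Rightarrow> 'a \<Rightarrow> 'a set" where
  "tangent_space M x = {v. \<exists>\<epsilon>>0. \<exists>c :: real \<Rightarrow> 'a. C2_on {-\<epsilon><..<\<epsilon>} c \<and> c ` {-\<epsilon><..<\<epsilon>} \<subseteq> M \<and>
     c 0 = x \<and> (c has_vector_derivative v) (at 0)}"

text \<open>Continuity of a set-valued map in the sense of Painleve--Kuratowski: outer and inner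
  semicontinuity along sequences in \<open>M\<close>.\<close>

definition set_continuous_rel ::
    "('a::metric_space \<Rightarrow> 'b::metric_space set) \<Rightarrow> 'a \<Rightarrow> 'a set \<Rightarrow> bool" where
  "set_continuous_rel S x M \<longleftrightarrow>
     (\<forall>y v w. (\<forall>k::nat. y k \<in> M \<and> v k \<in> S (y k)) \<and> y \<longlonglongrightarrow> x \<and> v \<longlonglongrightarrow> w \<longrightarrow> w \<in> S x) \<and>
     (\<forall>w\<in>S x. \<forall>y. (\<forall>k::nat. y k \<in> M) \<and> y \<longlonglongrightarrow> x \<longrightarrow>
        (\<exists>v. v \<longlonglongrightarrow> w \<and> (\<forall>\<^sub>F k in sequentially. v k \<in> S (y k))))"

definition partly_smooth :: "('a::euclidean_space \<Rightarrow> ereal) \<Rightarrow> 'a \<Rightarrow> 'a set \<Rightarrow> bool" where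
  "partly_smooth f x M \<longleftrightarrow>
     x \<in> M \<and> subdiff f x \<noteq> {} \<and>
     C2_submanifold_around M x \<and> C2_restricted_around M f x \<and>
     tangent_space M x = tangent_model f x \<and>
     set_continuous_rel (subdiff f) x M"

text \<open>The symmetric linear map on the tangent space is extended by \<open>0\<close> on its orthogonal
  complement, which makes it a uniquely determined map on the whole space. The projection
  \<open>closest_point M\<close> is single-valued near \<open>x\<close> when \<open>M\<close> is a \<open>C\<^sup>2\<close>-submanifold around \<open>x\<close>.\<close>

definition riem_hess :: "'a::euclidean_space set \<Rightarrow> ('a \<Rightarrow> real) \<Rightarrow> 'a \<Rightarrow> 'a \<Rightarrow> 'a" where
  "riem_hess M J x = (THE A. linear A \<and>
     (\<forall>h\<in>tangent_space M x. A h \<in> tangent_space M x) \<and>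
     (\<forall>h\<in>orthogonal_comp (tangent_space M x). A h = 0) \<and>
     (\<forall>g\<in>tangent_space M x. \<forall>h\<in>tangent_space M x. A g \<bullet> h = g \<bullet> A h) \<and>
     (\<forall>h\<in>tangent_space M x.
        A h \<bullet> h = deriv (deriv (\<lambda>t. J (closest_point M (x + t *\<^sub>R h)))) 0))"

section \<open>The forward--Douglas--Rachford operator and its linearization\<close>

definition refl_prox :: "('a::real_inner \<Rightarrow> ereal) \<Rightarrow> 'a \<Rightarrow> 'a" where
  "refl_prox f x = 2 *\<^sub>R prox f x - x"

definition refl_proj :: "'a::euclidean_space set \<Rightarrow> 'a \<Rightarrow> 'a" where
  "refl_proj V x = 2 *\<^sub>R orth_proj V x - x"

definition FDR_op :: "('a::euclidean_space \<Rightarrow> ereal) \<Rightarrow> ('a \<Rightarrow> real) \<Rightarrow> 'a set \<Rightarrow> real \<Rightarrow> 'a \<Rightarrow> 'a" where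
  "FDR_op R G V \<gamma> =
     (\<lambda>y. (1/2) *\<^sub>R (y + refl_prox (\<lambda>u. ereal \<gamma> * R u) (refl_proj V y))) \<circ> (\<lambda>z. z - \<gamma> *\<^sub>R grad G z)"

definition fix_set :: "('a \<Rightarrow> 'a) \<Rightarrow> 'a set" where
  "fix_set T = {z. T z = z}"

text \<open>In the following, \<open>xs\<close> and \<open>zs\<close> stand for the limits \<open>x\<^sup>\<star>\<close> and \<open>z\<^sup>\<star>\<close>. The function
  \<open>Rbar\<close> is only used on \<open>M\<close> near \<open>xs\<close>, where \<open>R\<close> is finite.\<close>

definition Rbar ::
    "(real^'n \<Rightarrow> ereal) \<Rightarrow> (real^'n \<Rightarrow> real) \<Rightarrow> real \<Rightarrow> real^'n \<Rightarrow> real^'n \<Rightarrow> real^'n \<Rightarrow> real" where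
  "Rbar R G \<gamma> xs zs u = \<gamma> * real_of_ereal (R u) - u \<bullet> (xs - zs - \<gamma> *\<^sub>R grad G xs)"

definition H_Rbar ::
    "(real^'n \<Rightarrow> ereal) \<Rightarrow> (real^'n \<Rightarrow> real) \<Rightarrow> (real^'n) set \<Rightarrow> real \<Rightarrow> real^'n \<Rightarrow> real^'n \<Rightarrow> real^'n^'n" where
  "H_Rbar R G M \<gamma> xs zs =
     proj_mat (tangent_model R xs) ** matrix (riem_hess M (Rbar R G \<gamma> xs zs) xs)
       ** proj_mat (tangent_model R xs)"

definition W_Rbar ::
    "(real^'n \<Rightarrow> ereal) \<Rightarrow> (real^'n \<Rightarrow> real) \<Rightarrow> (real^'n) set \<Rightarrow> real \<Rightarrow> real^'n \<Rightarrow> real^'n \<Rightarrow> real^'n^'n" where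
  "W_Rbar R G M \<gamma> xs zs = matrix_inv (mat 1 + H_Rbar R G M \<gamma> xs zs)"

definition M_Rbar ::
    "(real^'n \<Rightarrow> ereal) \<Rightarrow> (real^'n \<Rightarrow> real) \<Rightarrow> (real^'n) set \<Rightarrow> real \<Rightarrow> real^'n \<Rightarrow> real^'n \<Rightarrow> real^'n^'n" where
  "M_Rbar R G M \<gamma> xs zs =
     proj_mat (tangent_model R xs) ** W_Rbar R G M \<gamma> xs zs ** proj_mat (tangent_model R xs)"

definition H_G :: "(real^'n \<Rightarrow> real) \<Rightarrow> (real^'n) set \<Rightarrow> real^'n \<Rightarrow> real^'n^'n" where
  "H_G F V xs = proj_mat V ** hess_mat F xs ** proj_mat V"

definition M_gamma ::
    "(real^'n \<Rightarrow> ereal) \<Rightarrow> (real^'n \<Rightarrow> real) \<Rightarrow> (real^'n) set \<Rightarrow> (real^'n) set \<Rightarrow>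
     real \<Rightarrow> real^'n \<Rightarrow> real^'n \<Rightarrow> real^'n^'n" where
  "M_gamma R F V M \<gamma> xs zs =
     (let MR = M_Rbar R (F \<circ> orth_proj V) M \<gamma> xs zs; PV = proj_mat V in
      mat 1 + 2 *\<^sub>R (MR ** PV) - MR - PV - \<gamma> *\<^sub>R (MR ** H_G F V xs))"

definition M_gamma_lambda ::
    "(real^'n \<Rightarrow> ereal) \<Rightarrow> (real^'n \<Rightarrow> real) \<Rightarrow> (real^'n) set \<Rightarrow> (real^'n) set \<Rightarrow>
     real \<Rightarrow> real \<Rightarrow> real^'n \<Rightarrow> real^'n \<Rightarrow> real^'n^'n" where
  "M_gamma_lambda R F V M \<gamma> l xs zs =
     (1 - l) *\<^sub>R mat 1 + l *\<^sub>R M_gamma R F V M \<gamma> xs zs"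

end

(* With e = u_{k+1} - x*, d = z_k - z* and subgradients v_k of R at u_{k+1}, v_k -> v_0 in ri(dR(x* )), the
   iteration reads e = N d - rho + O(|gamma_k - gamma|) + o(d), where N = 2 P_V - Id - gamma H_G and
   rho = gamma (v_k - v_0).
   A normal vector argument using monotonicity of the subdifferential puts u_{k+1} on the manifold for large k.
   In a slice chart, the function gamma R - <., gamma v_0> is C^2 and critical at x*, its derivative at u_{k+1} is
   given by rho on tangent vectors, and its second derivative at x* is the Riemannian Hessian H; hence P_T rho = H e + o(e) + o(rho) and
   e = P_T e + o(e). Together these give (Id + H) e = P_T N d + remainder, which is solved for e because H is
   positive semidefinite.
   In the polyhedral case the subgradients v_k lie in ri(dR(x* )) and attain the maximum of <., e> there, so e is
   in T and v_k - v_0 is orthogonal to T; moreover H = 0 and every remainder vanishes. *)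
theory Submission
  imports Defs
begin

section \<open>Orthogonal projections and subdifferentials\<close>

text \<open>Two obstacles shape the proof. The Riemannian Hessian differentiates
  \<open>J (closest_point M (x + t *\<^sub>R h))\<close> twice, but the nearest-point map of a C^2
  manifold is in general only C^1. Criticality rescues the second derivative: the first one is
  \<open>L' (X (l t)) (X' (l t) h)\<close>, with \<open>X\<close> the nearest point read in the
  chart, and at t = 0 the first factor annihilates \<open>S\<close>, where the second takes its
  values. So that factor need only be continuous, and no curvature of the chart enters: the Hessian
  is the second derivative of \<open>L\<close> transported by \<open>\<phi>' x\<close>. The
  expansion is also implicit: its remainder is o(e) + o(rho), while e and rho are controlled only by
  d together with the remainder itself and the error from \<open>gam k\<close>. For small tolerances
  the left-hand side absorbs this feedback. The outcome is a bound for the total error E: for every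
  \<epsilon>, eventually |E| \<le> \<epsilon> |d| + K lam |gam - \<gamma>|. Both psi and chi are
  then cut out as scalar multiples of E, so exactness in the polyhedral case reduces to E =
  0.\<close>

lemma orth_proj_eqI:
  assumes V: "subspace V" and p: "p \<in> V" and o: "\<And>v. v \<in> V \<Longrightarrow> (x - p) \<bullet> v = 0"
  shows "orth_proj V x = p"
  unfolding orth_proj_def
proof (rule the_equality)
  show "p \<in> V \<and> (\<forall>v\<in>V. orthogonal (x - p) v)"
    using p o by (simp add: orthogonal_def)
next
  fix q assume q: "q \<in> V \<and> (\<forall>v\<in>V. orthogonal (x - q) v)"
  then have qp: "q - p \<in> V" using V p subspace_diff by blast
  have "(x - p) \<bullet> (q - p) - (x - q) \<bullet> (q - p) = 0"
    using o[OF qp] q qp by (simp add: orthogonal_def)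
  then have "(q - p) \<bullet> (q - p) = 0" by (simp add: algebra_simps inner_commute)
  then show "q = p" by simp
qed

lemma
  assumes V: "subspace V"
  shows orth_proj_mem: "orth_proj V x \<in> V"
    and orth_proj_orthogonal: "v \<in> V \<Longrightarrow> (x - orth_proj V x) \<bullet> v = 0"
proof -
  obtain y z where yz: "y \<in> span V" "\<And>w. w \<in> span V \<Longrightarrow> orthogonal z w" "x = y + z"
    using orthogonal_subspace_decomp_exists[of V x] by metis
  have sp: "span V = V" using V by simp
  have "orth_proj V x = y"
    using yz sp V by (intro orth_proj_eqI) (auto simp: orthogonal_def)
  with yz sp show "orth_proj V x \<in> V" "v \<in> V \<Longrightarrow> (x - orth_proj V x) \<bullet> v = 0"
    by (auto simp: orthogonal_def)
qed

lemma orth_proj_id: "subspace V \<Longrightarrow> x \<in> V \<Longrightarrow> orth_proj V x = x"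
  by (rule orth_proj_eqI) auto

lemma linear_orth_proj:
  assumes V: "subspace V"
  shows "linear (orth_proj V)"
proof (rule linearI)
  fix x y and r :: real
  show "orth_proj V (x + y) = orth_proj V x + orth_proj V y"
  proof (rule orth_proj_eqI[OF V])
    show "orth_proj V x + orth_proj V y \<in> V"
      using V by (simp add: orth_proj_mem subspace_add)
    fix v assume "v \<in> V"
    then have "(x - orth_proj V x) \<bullet> v + (y - orth_proj V y) \<bullet> v = 0"
      using V by (simp add: orth_proj_orthogonal)
    then show "(x + y - (orth_proj V x + orth_proj V y)) \<bullet> v = 0"
      by (simp add: algebra_simps)
  qed
  show "orth_proj V (r *\<^sub>R x) = r *\<^sub>R orth_proj V x"
  proof (rule orth_proj_eqI[OF V])
    show "r *\<^sub>R orth_proj V x \<in> V"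
      using V by (simp add: orth_proj_mem subspace_scale)
    fix v assume "v \<in> V"
    then have "r * ((x - orth_proj V x) \<bullet> v) = 0"
      using V by (simp add: orth_proj_orthogonal)
    then show "(r *\<^sub>R x - r *\<^sub>R orth_proj V x) \<bullet> v = 0"
      by (simp add: algebra_simps)
  qed
qed

lemma orth_proj_inner:
  assumes V: "subspace V" and v: "v \<in> V"
  shows "orth_proj V x \<bullet> v = x \<bullet> v"
  using orth_proj_orthogonal[OF assms] by (simp add: inner_diff_left)

lemma orth_proj_sym:
  assumes V: "subspace V"
  shows "orth_proj V x \<bullet> y = x \<bullet> orth_proj V y"
  using orth_proj_inner[OF V orth_proj_mem[OF V], of x y]
    orth_proj_inner[OF V orth_proj_mem[OF V], of y x] by (simp add: inner_commute)

lemma norm_orth_proj_le: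
  assumes V: "subspace V"
  shows "norm (orth_proj V x) \<le> norm x"
proof -
  have "(norm (orth_proj V x))\<^sup>2 = x \<bullet> orth_proj V x"
    using orth_proj_inner[OF V orth_proj_mem[OF V]] by (simp add: power2_norm_eq_inner)
  also have "\<dots> \<le> norm x * norm (orth_proj V x)" by (rule norm_cauchy_schwarz)
  finally show ?thesis
    by (metis linorder_not_le mult_less_cancel_right2 mult_right_le_imp_le norm_ge_zero
        order_less_le power2_eq_square zero_less_norm_iff)
qed

lemma norm_diff_orth_proj_le:
  assumes V: "subspace V" and v: "v \<in> V"
  shows "norm (x - orth_proj V x) \<le> norm (x - v)"
proof -
  have "(x - orth_proj V x) \<bullet> (orth_proj V x - v) = 0"
    using orth_proj_orthogonal[OF V] subspace_diff[OF V orth_proj_mem[OF V] v] by blast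
  then have "(norm (x - v))\<^sup>2 = (norm (x - orth_proj V x))\<^sup>2 + (norm (orth_proj V x - v))\<^sup>2"
    using norm_add_Pythagorean[of "x - orth_proj V x" "orth_proj V x - v"]
    by (simp add: orthogonal_def)
  then show ?thesis by (smt (verit) power2_le_imp_le norm_ge_zero zero_le_power2)
qed

lemma matrix_orth_proj: "subspace V \<Longrightarrow> proj_mat V *v x = orth_proj V x"
  by (rule fun_cong[OF matrix_vector_mul(2)[OF linear_orth_proj]])

section \<open>Parallel subspaces and relative interiors\<close>

lemma subspace_par: "C \<noteq> {} \<Longrightarrow> subspace (par C)"
proof -
  assume "C \<noteq> {}"
  then obtain a where a: "a \<in> C" by blast
  then have aA: "a \<in> affine hull C" by (rule hull_inc)
  have "par C = {y - a | y. y \<in> affine hull C}"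
  proof (intro equalityI subsetI)
    fix v assume "v \<in> par C"
    then obtain x y where xy: "v = x - y" "x \<in> affine hull C" "y \<in> affine hull C"
      by (auto simp: par_def)
    have "a + 1 *\<^sub>R (x - y) \<in> affine hull C"
      by (rule mem_affine_3_minus) (use xy aA affine_affine_hull in auto)
    then show "v \<in> {y - a | y. y \<in> affine hull C}" using xy(1) by force
  qed (use aA in \<open>auto simp: par_def\<close>)
  then show ?thesis using affine_diffs_subspace_subtract[OF affine_affine_hull aA] by (simp add: Setcompr_eq_image)
qed

lemma subspace_tangent_model: "subspace (tangent_model f x)"
  by (simp add: tangent_model_def subspace_orthogonal_comp)

lemma diff_mem_par: "a \<in> C \<Longrightarrow> b \<in> C \<Longrightarrow> a - b \<in> par C"
  using hull_inc[of a C affine] hull_inc[of b C affine] by (auto simp: par_def)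

lemma rel_interior_push:
  fixes C :: "'a::real_normed_vector set"
  assumes v: "v \<in> rel_interior C" and n: "n \<in> par C"
  obtains e where "e > 0" "v + e *\<^sub>R n \<in> C"
proof -
  from v obtain d where d: "d > 0" "ball v d \<inter> affine hull C \<subseteq> C" and vC: "v \<in> C"
    by (auto simp: mem_rel_interior_ball)
  obtain x y where xy: "n = x - y" "x \<in> affine hull C" "y \<in> affine hull C"
    using n by (auto simp: par_def)
  define e where "e = d / (2 * (norm n + 1))"
  have n1: "norm n + 1 > 0" by (smt (verit) norm_ge_zero)
  have e: "e > 0" using d(1) n1 by (simp add: e_def)
  have "e * norm n < d"
  proof -
    have "e * norm n \<le> e * (norm n + 1)" using e by (simp add: mult_left_mono)
    also have "\<dots> = d / 2" using n1 by (simp add: e_def field_simps)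
    also have "\<dots> < d" using d(1) by simp
    finally show ?thesis .
  qed
  then have "v + e *\<^sub>R n \<in> ball v d" using e by (simp add: dist_norm)
  moreover have "v + e *\<^sub>R (x - y) \<in> affine hull C"
    by (rule mem_affine_3_minus) (use xy vC hull_inc affine_affine_hull in auto)
  ultimately have "v + e *\<^sub>R n \<in> C" using d(2) xy(1) by auto
  with e that show ?thesis by blast
qed

text \<open>From a relatively interior maximizer one can move a little along both \<open>n\<close>
  and \<open>- n\<close> for every direction \<open>n\<close> of the affine hull, so the linear
  functional cannot vary along any of them.\<close>

lemma orthogonal_par_if_max_rel_interior:
  fixes C :: "'a::euclidean_space set"
  assumes v: "v \<in> rel_interior C" and mx: "\<And>w. w \<in> C \<Longrightarrow> w \<bullet> y \<le> v \<bullet> y"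
  shows "y \<in> orthogonal_comp (par C)"
proof -
  have vC: "v \<in> C" using v rel_interior_subset by blast
  have le: "n \<bullet> y \<le> 0" if n: "n \<in> par C" for n
  proof -
    obtain e where e: "e > 0" "v + e *\<^sub>R n \<in> C" using rel_interior_push[OF v n] by blast
    from mx[OF e(2)] have "e * (n \<bullet> y) \<le> 0" by (simp add: inner_add_left)
    then show ?thesis using e(1) by (simp add: mult_le_0_iff)
  qed
  have sub: "subspace (par C)" using vC by (intro subspace_par) blast
  have "n \<bullet> y = 0" if n: "n \<in> par C" for n
    using le[OF n] le[OF subspace_neg[OF sub n]] by simp
  then show ?thesis by (auto simp: orthogonal_comp_def orthogonal_def)
qed

section \<open>Subgradient inequalities in real form\<close>

lemma subdiff_finite:
  assumes "proper_fun f" "v \<in> subdiff f x"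
  shows "\<bar>f x\<bar> \<noteq> \<infinity>"
proof -
  obtain y where y: "f y \<noteq> \<infinity>" using assms(1) by (auto simp: proper_fun_def)
  have "f x + ereal (v \<bullet> (y - x)) \<le> f y" using assms(2) by (auto simp: subdiff_def)
  with y have "f x \<noteq> \<infinity>" by auto
  moreover have "f x \<noteq> -\<infinity>" using assms(1) by (auto simp: proper_fun_def)
  ultimately show ?thesis by auto
qed

lemma subdiff_ineq_real:
  assumes "proper_fun f" "v \<in> subdiff f x" "\<bar>f y\<bar> \<noteq> \<infinity>"
  shows "real_of_ereal (f x) + v \<bullet> (y - x) \<le> real_of_ereal (f y)"
proof -
  have "f x + ereal (v \<bullet> (y - x)) \<le> f y" using assms(2) by (auto simp: subdiff_def)
  then show ?thesis using subdiff_finite[OF assms(1,2)] assms(3)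
    by (cases "f x"; cases "f y") auto
qed

lemma subdiff_monotone:
  assumes "proper_fun f" "v \<in> subdiff f x" "w \<in> subdiff f y"
  shows "0 \<le> (v - w) \<bullet> (x - y)"
proof -
  have "real_of_ereal (f x) + v \<bullet> (y - x) \<le> real_of_ereal (f y)"
    "real_of_ereal (f y) + w \<bullet> (x - y) \<le> real_of_ereal (f x)"
    using assms subdiff_finite subdiff_ineq_real by metis+
  then show ?thesis by (simp add: algebra_simps)
qed

section \<open>Lower semicontinuity and the proximal map\<close>

lemma lsc_fun_open_superlevel:
  assumes "lsc_fun f" "f x > c"
  shows "\<forall>\<^sub>F y in nhds x. f y > c"
proof -
  have "c < Liminf (at x) f" using assms by (auto simp: lsc_fun_def intro: less_le_trans)
  then have "\<forall>\<^sub>F y in at x. c < f y" by (rule less_LiminfD)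
  then show ?thesis using assms(2) by (simp add: eventually_nhds_conv_at)
qed

text \<open>Without a minimizer every \<open>x\<close> has a neighbourhood on which \<open>f\<close>
  stays above a value \<open>f (m x)\<close> attained in \<open>K\<close>. Among finitely many such
  neighbourhoods covering \<open>K\<close>, one contains the point \<open>m c\<close> with the least
  of these values, which would then exceed another of them. Semicontinuity is asked only at levels
  attained on \<open>K\<close>, so a single finite level has to be treated at a time.\<close>

lemma lsc_attains_min:
  fixes f :: "'a::topological_space \<Rightarrow> ereal"
  assumes K: "compact K" "K \<noteq> {}"
    and lsc: "\<And>x y. x \<in> K \<Longrightarrow> y \<in> K \<Longrightarrow> f y < f x \<Longrightarrow> \<forall>\<^sub>F z in nhds x. f y < f z"
  shows "\<exists>x\<in>K. \<forall>y\<in>K. f x \<le> f y"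
proof (rule ccontr)
  assume "\<not> ?thesis"
  then have "\<forall>x\<in>K. \<exists>y\<in>K. f y < f x" by (auto simp: not_le)
  then obtain m where m: "\<And>x. x \<in> K \<Longrightarrow> m x \<in> K \<and> f (m x) < f x" by metis
  have "\<forall>x\<in>K. \<exists>S. open S \<and> x \<in> S \<and> (\<forall>z\<in>S. f (m x) < f z)"
    using lsc m unfolding eventually_nhds by blast
  then obtain S where S: "\<And>x. x \<in> K \<Longrightarrow> open (S x) \<and> x \<in> S x \<and> (\<forall>z\<in>S x. f (m x) < f z)" by metis
  obtain C where C: "C \<subseteq> K" "finite C" "K \<subseteq> (\<Union>c\<in>C. S c)"
    using compactE_image[OF K(1), of K S] S by blast
  have "C \<noteq> {}" using C K(2) by auto
  define a where "a = Min ((f \<circ> m) ` C)"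
  have "a \<in> (f \<circ> m) ` C" using C \<open>C \<noteq> {}\<close> by (auto simp: a_def intro!: Min_in)
  then obtain c where c: "c \<in> C" "a = f (m c)" by auto
  have "m c \<in> K" using c C m by blast
  then obtain c' where c': "c' \<in> C" "m c \<in> S c'" using C by blast
  then have "f (m c') < a" using S C c by auto
  moreover have "a \<le> f (m c')" using c' C by (auto simp: a_def)
  ultimately show False by simp
qed

text \<open>One subgradient supplies an affine minorant, against which the quadratic term wins
  outside a ball around \<open>a\<close>; inside the ball compactness and lower semicontinuity yield
  a minimizer.\<close>

lemma Argmin_prox_exists:
  fixes R :: "'a::euclidean_space \<Rightarrow> ereal"
  assumes R: "proper_fun R" "lsc_fun R" and g: "g > 0" and v: "v \<in> subdiff R a"
  shows "\<exists>p. p \<in> Argmin (\<lambda>u. ereal g * R u + ereal ((norm (u - y))\<^sup>2 / 2))"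
proof -
  define h where "h = (\<lambda>u. ereal g * R u + ereal ((norm (u - y))\<^sup>2 / 2))"
  \<comment> \<open>By the subgradient inequality \<open>h u - h a\<close> is at least |u - a|^2 / 2
    - r |u - a| when \<open>R u\<close> is finite, which is nonnegative once |u - a| \<ge> 2 r;
    hence the radius of \<open>K\<close>.\<close>
  define r where "r = norm (g *\<^sub>R v + a - y)"
  have fin: "\<bar>R a\<bar> \<noteq> \<infinity>" using subdiff_finite[OF R(1) v] by simp
  have ninf: "R u \<noteq> -\<infinity>" for u using R by (auto simp: proper_fun_def)
  define K where "K = cball a (2 * r)"
  have aK: "a \<in> K" by (simp add: K_def r_def)
  have "\<exists>x\<in>K. \<forall>y\<in>K. h x \<le> h y"
  proof (rule lsc_attains_min)
    fix x z assume lt: "h z < h x"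
    have "R z \<noteq> \<infinity>" using lt g by (auto simp: h_def)
    then obtain rz where rz: "R z = ereal rz" using ninf[of z] by (cases "R z") auto
    define c where "c = g * rz + (norm (z - y))\<^sup>2 / 2"
    have hz: "h z = ereal c" by (simp add: h_def rz c_def)
    have "ereal ((c - (norm (x - y))\<^sup>2 / 2) / g) < R x"
    proof (cases "R x")
      case (real rx)
      have "c < g * rx + (norm (x - y))\<^sup>2 / 2" using lt unfolding hz by (simp add: h_def real)
      then have "(c - (norm (x - y))\<^sup>2 / 2) / g < rx" using g by (simp add: pos_divide_less_eq mult.commute)
      then show ?thesis by (simp add: real)
    qed (use ninf[of x] in auto)
    \<comment> \<open>The number \<open>d\<close> leaves a gap on both sides: semicontinuity keeps
      \<open>R\<close> above it near \<open>x\<close>, continuity keeps the quadratic expression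
      below it.\<close>
    then obtain d where d: "(c - (norm (x - y))\<^sup>2 / 2) / g < d" "ereal d < R x"
      using ereal_dense2[of "ereal ((c - (norm (x - y))\<^sup>2 / 2) / g)" "R x"] by auto
    have "((\<lambda>u. (c - (norm (u - y))\<^sup>2 / 2) / g) \<longlongrightarrow> (c - (norm (x - y))\<^sup>2 / 2) / g) (nhds x)"
      using g by (intro tendsto_intros filterlim_ident) auto
    then have "\<forall>\<^sub>F u in nhds x. (c - (norm (u - y))\<^sup>2 / 2) / g < d"
      using d(1) by (rule order_tendstoD(2))
    moreover have "\<forall>\<^sub>F u in nhds x. ereal d < R u"
      by (rule lsc_fun_open_superlevel[OF R(2) d(2)])
    ultimately show "\<forall>\<^sub>F u in nhds x. h z < h u"
    proof eventually_elim
      case (elim u)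
      show ?case
      proof (cases "R u")
        case (real ru)
        have "d < ru" using elim(2) by (simp add: real)
        with elim(1) have "(c - (norm (u - y))\<^sup>2 / 2) / g < ru" by linarith
        then have "c < g * ru + (norm (u - y))\<^sup>2 / 2"
          using g by (simp add: pos_divide_less_eq mult.commute)
        then show ?thesis unfolding hz by (simp add: h_def real)
      next
        case PInf
        then show ?thesis unfolding hz using g by (simp add: h_def)
      qed (use ninf[of u] in auto)
    qed
  qed (use aK in \<open>auto simp: K_def\<close>)
  then obtain p where p: "p \<in> K" "\<And>y. y \<in> K \<Longrightarrow> h p \<le> h y" by blast
  have hpa: "h p \<le> h a" using p aK by blast
  have out: "h a \<le> h u" if "u \<notin> K" for u
  proof (cases "R u = \<infinity>")
    case True then show ?thesis using g by (simp add: h_def)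
  next
    case False
    then have fu: "\<bar>R u\<bar> \<noteq> \<infinity>" using ninf[of u] by auto
    then obtain ra ru where ra: "R a = ereal ra" and ru: "R u = ereal ru" using fin by auto
    have "ra + v \<bullet> (u - a) \<le> ru" using subdiff_ineq_real[OF R(1) v fu] by (simp add: ra ru)
    then have 1: "g * ra + g * (v \<bullet> (u - a)) \<le> g * ru"
      using mult_left_mono[of "ra + v \<bullet> (u - a)" ru g] g by (simp add: distrib_left)
    have "(norm (u - y))\<^sup>2 = (norm (u - a))\<^sup>2 + 2 * ((u - a) \<bullet> (a - y)) + (norm (a - y))\<^sup>2"
      unfolding power2_norm_eq_inner
      by (simp add: inner_add_left inner_add_right inner_diff_left inner_diff_right inner_commute)
    moreover have "- (norm (u - a) * r) \<le> (u - a) \<bullet> (g *\<^sub>R v + a - y)"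
      using Cauchy_Schwarz_ineq2[of "u - a" "g *\<^sub>R v + a - y"] by (auto simp: r_def)
    moreover have "norm (u - a) * r \<le> (norm (u - a))\<^sup>2 / 2"
      using that mult_left_mono[of "2 * r" "norm (u - a)" "norm (u - a)"]
      by (simp add: K_def dist_norm norm_minus_commute power2_eq_square mult_ac)
    moreover have "(u - a) \<bullet> (g *\<^sub>R v + a - y) = g * (v \<bullet> (u - a)) + (u - a) \<bullet> (a - y)"
      by (simp add: inner_add_left inner_add_right inner_diff_left inner_diff_right inner_commute)
    ultimately have "g * ra + (norm (a - y))\<^sup>2 / 2 \<le> g * ru + (norm (u - y))\<^sup>2 / 2"
      using 1 by linarith
    then show ?thesis by (simp add: h_def ra ru)
  qed
  have "h p \<le> h u" for u using p(2)[of u] out[of u] hpa order_trans by blast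
  moreover have "h p < \<infinity>" using hpa fin by (cases "R a") (auto simp: h_def)
  ultimately show ?thesis unfolding h_def Argmin_def by blast
qed

text \<open>Compare \<open>p\<close> with a point at parameter \<open>t\<close> on the segment to
  \<open>w\<close>: convexity bounds \<open>R\<close> there, the square contributes a linear term in
  \<open>t\<close> and an error t^2 |w - p|^2 / 2. Dividing by \<open>t\<close> and letting it tend
  to 0 leaves the subgradient inequality.\<close>

lemma Argmin_prox_subdiff:
  fixes R :: "'a::euclidean_space \<Rightarrow> ereal"
  assumes R: "proper_fun R" "convex_fun R" and g: "g > 0"
    and p: "p \<in> Argmin (\<lambda>u. ereal g * R u + ereal ((norm (u - y))\<^sup>2 / 2))"
  shows "(1/g) *\<^sub>R (y - p) \<in> subdiff R p"
proof -
  have ninf: "R u \<noteq> -\<infinity>" for u using R by (auto simp: proper_fun_def)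
  have "ereal g * R p + ereal ((norm (p - y))\<^sup>2 / 2) < \<infinity>" using p by (auto simp: Argmin_def)
  then obtain rp where rp: "R p = ereal rp" using ninf[of p] g by (cases "R p") auto
  have "R p + ereal ((1/g) *\<^sub>R (y - p) \<bullet> (w - p)) \<le> R w" for w
  proof (cases "R w = \<infinity>")
    case False
    then obtain rw where rw: "R w = ereal rw" using ninf[of w] by (cases "R w") auto
    have key: "g * rp + (y - p) \<bullet> (w - p) - t * ((norm (w - p))\<^sup>2 / 2) \<le> g * rw"
      if t: "0 < t" "t < 1" for t
    proof -
      define q where "q = (1 - t) *\<^sub>R p + t *\<^sub>R w"
      have "R q \<le> ereal (1 - t) * R p + ereal t * R w"
        using R(2) t unfolding convex_fun_def q_def by blast
      then have cq: "R q \<le> ereal ((1 - t) * rp + t * rw)" by (simp add: rp rw)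
      then obtain rq where rq: "R q = ereal rq" using ninf[of q] by (cases "R q") auto
      have "ereal g * R p + ereal ((norm (p - y))\<^sup>2 / 2) \<le> ereal g * R q + ereal ((norm (q - y))\<^sup>2 / 2)"
        using p by (auto simp: Argmin_def)
      then have 1: "g * rp + (norm (p - y))\<^sup>2 / 2 \<le> g * rq + (norm (q - y))\<^sup>2 / 2" by (simp add: rp rq)
      have qy: "q - y = (p - y) + t *\<^sub>R (w - p)" by (simp add: q_def algebra_simps)
      have 2: "(norm (q - y))\<^sup>2 = (norm (p - y))\<^sup>2 - 2 * t * ((y - p) \<bullet> (w - p)) + t\<^sup>2 * (norm (w - p))\<^sup>2"
        unfolding qy power2_norm_eq_inner by (simp add: inner_add_left inner_add_right inner_diff_left inner_diff_right inner_commute power2_eq_square) (simp add: algebra_simps)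
      have "g * rq \<le> g * ((1 - t) * rp + t * rw)" using cq g by (simp add: rq)
      with 1 2 have "t * (g * rp + (y - p) \<bullet> (w - p) - t * ((norm (w - p))\<^sup>2 / 2)) \<le> t * (g * rw)"
        by (simp add: algebra_simps power2_eq_square)
      then show ?thesis using t(1) by simp
    qed
    have "((\<lambda>t. g * rp + (y - p) \<bullet> (w - p) - t * ((norm (w - p))\<^sup>2 / 2)) \<longlongrightarrow>
        g * rp + (y - p) \<bullet> (w - p) - 0 * ((norm (w - p))\<^sup>2 / 2)) (at_right 0)"
      by (intro tendsto_intros)
    moreover have "\<forall>\<^sub>F t in at_right 0. g * rp + (y - p) \<bullet> (w - p) - t * ((norm (w - p))\<^sup>2 / 2) \<le> g * rw"
      using eventually_at_right_less[of "0::real"] eventually_at_right_field[of _ "0::real"] key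
      by (auto simp: eventually_at_right_field intro!: exI[of _ 1])
    ultimately have "g * rp + (y - p) \<bullet> (w - p) - 0 * ((norm (w - p))\<^sup>2 / 2) \<le> g * rw"
      by (intro tendsto_upperbound) auto
    then have "rp + ((y - p) \<bullet> (w - p)) / g \<le> rw" using g by (simp add: field_simps)
    then show ?thesis by (simp add: rp rw)
  qed simp
  then show ?thesis by (auto simp: subdiff_def)
qed

text \<open>\<open>prox\<close> is a definite description, so the minimizer must also be unique: two
  minimizers carry the subgradients (y - p)/g and (y - q)/g, and monotonicity makes - |p - q|^2 / g
  nonnegative. The subgradient \<open>v\<close> at an arbitrary point \<open>a\<close> feeds the
  existence part.\<close>

lemma prox_subdiff:
  fixes R :: "'a::euclidean_space \<Rightarrow> ereal"
  assumes R: "proper_fun R" "convex_fun R" "lsc_fun R" and g: "g > 0" and v: "v \<in> subdiff R a"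
  shows "(1/g) *\<^sub>R (y - prox (\<lambda>u. ereal g * R u) y) \<in> subdiff R (prox (\<lambda>u. ereal g * R u) y)"
proof -
  let ?A = "Argmin (\<lambda>u. ereal g * R u + ereal ((norm (u - y))\<^sup>2 / 2))"
  obtain p where p: "p \<in> ?A" using Argmin_prox_exists[OF R(1,3) g v] by blast
  have "q = p" if q: "q \<in> ?A" for q
  proof -
    have "0 \<le> ((1/g) *\<^sub>R (y - p) - (1/g) *\<^sub>R (y - q)) \<bullet> (p - q)"
      using Argmin_prox_subdiff[OF R(1,2) g] p q subdiff_monotone[OF R(1)] by blast
    also have "(1/g) *\<^sub>R (y - p) - (1/g) *\<^sub>R (y - q) = (-(1/g)) *\<^sub>R (p - q)"
      by (simp add: algebra_simps)
    finally have "(p - q) \<bullet> (p - q) \<le> 0" using g by (simp add: divide_le_0_iff)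
    then have "(p - q) \<bullet> (p - q) = 0" using inner_ge_zero[of "p - q"] by linarith
    then show "q = p" by simp
  qed
  then have "prox (\<lambda>u. ereal g * R u) y = p" unfolding prox_def using p by blast
  then show ?thesis using Argmin_prox_subdiff[OF R(1,2) g p] by simp
qed

section \<open>Twice differentiable maps\<close>

lemma C2_on_subset: "C2_on U f \<Longrightarrow> U' \<subseteq> U \<Longrightarrow> C2_on U' f"
  unfolding C2_on_def by (meson continuous_on_subset subsetD)

lemma C2_onI:
  assumes "\<And>x. x \<in> U \<Longrightarrow> (f has_derivative blinfun_apply (f' x)) (at x)"
    and "\<And>x. x \<in> U \<Longrightarrow> (f' has_derivative blinfun_apply (f'' x)) (at x)"
    and "continuous_on U f''"
  shows "C2_on U f"
  unfolding C2_on_def by (intro exI[of _ f'] exI[of _ f''] conjI ballI assms)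

lemma C2_on_affine: "C2_on U (\<lambda>x. a + blinfun_apply A x)"
  unfolding C2_on_def
  by (rule exI[of _ "\<lambda>_. A"], rule exI[of _ "\<lambda>_. 0"])
    (auto intro!: derivative_eq_intros continuous_intros bounded_linear.has_derivative[OF blinfun.bounded_linear_right])

lemma C2_on_minus_inner:
  fixes g :: "'a::real_inner \<Rightarrow> real"
  assumes "C2_on U g"
  shows "C2_on U (\<lambda>y. r * g y - y \<bullet> c)"
proof -
  obtain g' g'' where g: "\<And>x. x \<in> U \<Longrightarrow> (g has_derivative blinfun_apply (g' x)) (at x)"
    "\<And>x. x \<in> U \<Longrightarrow> (g' has_derivative blinfun_apply (g'' x)) (at x)"
    "continuous_on U g''"
    using assms unfolding C2_on_def by blast
  have "((\<lambda>y. r * g y - y \<bullet> c) has_derivative blinfun_apply (r *\<^sub>R g' x - blinfun_inner_left c)) (at x)"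
    if "x \<in> U" for x
    by (auto intro!: derivative_eq_intros g that simp: blinfun.bilinear_simps)
  moreover have "((\<lambda>x. r *\<^sub>R g' x - blinfun_inner_left c) has_derivative blinfun_apply (r *\<^sub>R g'' x)) (at x)"
    if "x \<in> U" for x
    by (auto intro!: derivative_eq_intros g that simp: blinfun.bilinear_simps)
  moreover have "continuous_on U (\<lambda>x. r *\<^sub>R g'' x)"
    by (intro continuous_intros g)
  ultimately show ?thesis by (rule C2_onI)
qed

lemma C2_on_compose:
  fixes f :: "'a::euclidean_space \<Rightarrow> 'b::real_normed_vector" and g :: "'b \<Rightarrow> 'c::real_normed_vector"
  assumes f: "C2_on U f" and g: "C2_on W g" and sub: "f ` U \<subseteq> W"
  shows "C2_on U (\<lambda>x. g (f x))"
proof -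
  obtain f' f'' where f: "\<And>x. x \<in> U \<Longrightarrow> (f has_derivative blinfun_apply (f' x)) (at x)"
    "\<And>x. x \<in> U \<Longrightarrow> (f' has_derivative blinfun_apply (f'' x)) (at x)"
    and f'': "continuous_on U f''"
    using f unfolding C2_on_def by blast
  obtain g' g'' where g: "\<And>x. x \<in> W \<Longrightarrow> (g has_derivative blinfun_apply (g' x)) (at x)"
    "\<And>x. x \<in> W \<Longrightarrow> (g' has_derivative blinfun_apply (g'' x)) (at x)"
    and g'': "continuous_on W g''"
    using g unfolding C2_on_def by blast
  \<comment> \<open>The product rule yields the second derivative only as a function of
    \<open>h\<close>. Wrapping it in \<open>Blinfun\<close> makes it operator-valued, and on a
    Euclidean domain its continuity can be tested on basis vectors.\<close>
  define D where "D x = Blinfun (\<lambda>h. (g' (f x) o\<^sub>L f'' x h) + (g'' (f x) (f' x h) o\<^sub>L f' x))" for x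
  have 1: "((\<lambda>x. g (f x)) has_derivative blinfun_apply (g' (f x) o\<^sub>L f' x)) (at x)" if "x \<in> U" for x
    using has_derivative_compose[OF f(1)[OF that] g(1)] sub that
    by (auto simp: image_subset_iff blinfun_compose.rep_eq comp_def)
  have d: "((\<lambda>x. g' (f x) o\<^sub>L f' x) has_derivative
      (\<lambda>h. (g' (f x) o\<^sub>L f'' x h) + (g'' (f x) (f' x h) o\<^sub>L f' x))) (at x)" if "x \<in> U" for x
  proof -
    have "((\<lambda>x. g' (f x)) has_derivative (\<lambda>h. g'' (f x) (f' x h))) (at x)"
      using has_derivative_compose[OF f(1)[OF that] g(2)] sub that by (simp add: image_subset_iff)
    from bounded_bilinear.FDERIV[OF bounded_bilinear_blinfun_compose this f(2)[OF that]]
    show ?thesis .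
  qed
  have D: "blinfun_apply (D x) = (\<lambda>h. (g' (f x) o\<^sub>L f'' x h) + (g'' (f x) (f' x h) o\<^sub>L f' x))"
    if "x \<in> U" for x
    unfolding D_def by (rule bounded_linear_Blinfun_apply) (rule has_derivative_bounded_linear[OF d[OF that]])
  have cf: "continuous_on U f" "continuous_on U f'"
    by (auto intro!: continuous_at_imp_continuous_on has_derivative_continuous[OF f(1)]
        has_derivative_continuous[OF f(2)])
  have "continuous_on W g'"
    by (auto intro!: continuous_at_imp_continuous_on has_derivative_continuous[OF g(2)])
  then have cg: "continuous_on U (\<lambda>x. g' (f x))"
    using cf(1) sub by (rule continuous_on_compose2)
  have cg2: "continuous_on U (\<lambda>x. g'' (f x))"
    using g'' cf(1) sub by (rule continuous_on_compose2)
  have cD: "continuous_on U D"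
  proof (rule continuous_on_blinfun_componentwise)
    fix i :: 'a assume "i \<in> Basis"
    note ap = bounded_bilinear.continuous_on[OF bounded_bilinear_blinfun_apply _ continuous_on_const]
    note co = bounded_bilinear.continuous_on[OF bounded_bilinear_blinfun_compose]
    have "continuous_on U (\<lambda>x. g'' (f x) (f' x i))"
      by (rule bounded_bilinear.continuous_on[OF bounded_bilinear_blinfun_apply cg2 ap[OF cf(2)]])
    then have "continuous_on U (\<lambda>x. (g' (f x) o\<^sub>L f'' x i) + (g'' (f x) (f' x i) o\<^sub>L f' x))"
      by (rule continuous_on_add[OF co[OF cg ap[OF f'', of i]] co[OF _ cf(2)]])
    then show "continuous_on U (\<lambda>x. blinfun_apply (D x) i)"
      by (rule continuous_on_eq) (simp add: D)
  qed
  have d':  "((\<lambda>x. g' (f x) o\<^sub>L f' x) has_derivative blinfun_apply (D x)) (at x)" if "x \<in> U" for x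
    using d[OF that] D[OF that] by simp
  show ?thesis by (rule C2_onI[OF 1 d' cD])
qed

lemma second_difference_approx:
  fixes f :: "'a::real_normed_vector \<Rightarrow> real"
  assumes f': "\<forall>\<^sub>F x in nhds a. (f has_derivative blinfun_apply (f' x)) (at x)"
    and B: "(f' has_derivative blinfun_apply B) (at a)" and e: "e > 0"
  shows "\<forall>\<^sub>F t in at_right 0. \<bar>f (a + t *\<^sub>R h + t *\<^sub>R k) - f (a + t *\<^sub>R h) - f (a + t *\<^sub>R k) + f a
           - t\<^sup>2 * B k h\<bar> \<le> e * t\<^sup>2"
proof -
  define c where "c = norm h + norm k + 1"
  have c: "c \<ge> 1" "norm h \<le> c" "norm k \<le> c" by (auto simp: c_def)
  \<comment> \<open>Each of the two linearization errors is at most \<open>e' * (t * c)\<close>, and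
    evaluating at \<open>h\<close> costs another factor \<open>c\<close>; together they make
    \<open>e * t\<close>.\<close>
  define e' where "e' = e / (2 * c * c)"
  have e': "e' > 0" using e c by (simp add: e'_def)
  obtain d1 where d1: "d1 > 0" "\<And>x. dist x a < d1 \<Longrightarrow> (f has_derivative blinfun_apply (f' x)) (at x)"
    using f' unfolding eventually_nhds_metric by blast
  obtain d2 where d2: "d2 > 0" "\<And>y. norm (y - a) < d2 \<Longrightarrow> norm (f' y - f' a - B (y - a)) \<le> e' * norm (y - a)"
    using B e' unfolding has_derivative_at_alt by metis
  define d where "d = min d1 d2"
  have d: "d > 0" using d1 d2 by (simp add: d_def)
  have "\<bar>f (a + t *\<^sub>R h + t *\<^sub>R k) - f (a + t *\<^sub>R h) - f (a + t *\<^sub>R k) + f a - t\<^sup>2 * B k h\<bar> \<le> e * t\<^sup>2"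
    if t: "0 < t" "t < d / c" for t
  proof -
    have near: "norm ((a + s *\<^sub>R h + r *\<^sub>R k) - a) \<le> t * c" if "0 \<le> s" "s \<le> t" "0 \<le> r" "r \<le> t" for s r
    proof -
      have "norm ((a + s *\<^sub>R h + r *\<^sub>R k) - a) \<le> s * norm h + r * norm k"
        using that norm_triangle_ineq[of "s *\<^sub>R h" "r *\<^sub>R k"] by (simp add: algebra_simps)
      also have "\<dots> \<le> t * norm h + t * norm k" using that by (intro add_mono mult_right_mono) auto
      also have "\<dots> \<le> t * c" using t by (simp add: c_def algebra_simps)
      finally show ?thesis .
    qed
    have tc: "t * c < d" using t c by (simp add: pos_less_divide_eq)
    have df: "((\<lambda>s. f (a + s *\<^sub>R h + r *\<^sub>R k)) has_real_derivative f' (a + s *\<^sub>R h + r *\<^sub>R k) h) (at s)"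
      if "0 \<le> s" "s \<le> t" "0 \<le> r" "r \<le> t" for s r
    proof -
      have "(f has_derivative blinfun_apply (f' (a + s *\<^sub>R h + r *\<^sub>R k))) (at (a + s *\<^sub>R h + r *\<^sub>R k))"
        using near[OF that] tc by (intro d1) (auto simp: dist_norm d_def)
      moreover have "((\<lambda>s. a + s *\<^sub>R h + r *\<^sub>R k) has_derivative (\<lambda>u. u *\<^sub>R h)) (at s)"
        by (auto intro!: derivative_eq_intros)
      ultimately have "((\<lambda>s. f (a + s *\<^sub>R h + r *\<^sub>R k)) has_derivative (\<lambda>u. f' (a + s *\<^sub>R h + r *\<^sub>R k) (u *\<^sub>R h))) (at s)"
        by (rule has_derivative_compose[rotated])
      then show ?thesis
        by (simp add: has_field_derivative_def blinfun.scaleR_right mult_commute_abs)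
    qed
    \<comment> \<open>The vanishing term \<open>0 *\<^sub>R k\<close> is kept so that
      \<open>df\<close> applies to both summands.\<close>
    define g where "g s = f (a + s *\<^sub>R h + t *\<^sub>R k) - f (a + s *\<^sub>R h + 0 *\<^sub>R k)" for s
    have "\<exists>z. 0 < z \<and> z < t \<and> g t - g 0 =
      (t - 0) * (f' (a + z *\<^sub>R h + t *\<^sub>R k) h - f' (a + z *\<^sub>R h + 0 *\<^sub>R k) h)"
      unfolding g_def using t by (intro MVT2 DERIV_diff df) auto
    then obtain z where z: "0 < z" "z < t"
      "g t - g 0 = t * (f' (a + z *\<^sub>R h + t *\<^sub>R k) h - f' (a + z *\<^sub>R h + 0 *\<^sub>R k) h)" by auto
    define y1 y2 where "y1 = a + z *\<^sub>R h + t *\<^sub>R k" and "y2 = a + z *\<^sub>R h + 0 *\<^sub>R k"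
    have n: "norm (y1 - a) \<le> t * c" "norm (y2 - a) \<le> t * c"
      unfolding y1_def y2_def using z by (intro near; simp)+
    have b: "norm (f' y - f' a - B (y - a)) \<le> e' * (t * c)" if "norm (y - a) \<le> t * c" for y
    proof -
      have "norm (f' y - f' a - B (y - a)) \<le> e' * norm (y - a)"
        using that tc by (intro d2) (auto simp: d_def)
      also have "\<dots> \<le> e' * (t * c)" using that e' by (intro mult_left_mono) auto
      finally show ?thesis .
    qed
    have yk: "y1 - y2 = t *\<^sub>R k" by (simp add: y1_def y2_def)
    have "f' y1 - f' y2 - B (t *\<^sub>R k) = (f' y1 - f' a - B (y1 - a)) - (f' y2 - f' a - B (y2 - a))"
      unfolding yk[symmetric] by (simp add: blinfun.diff_right)
    then have "norm (f' y1 - f' y2 - B (t *\<^sub>R k)) \<le> e' * (t * c) + e' * (t * c)"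
      using b[OF n(1)] b[OF n(2)] by (simp only:) (rule order_trans[OF norm_triangle_ineq4 add_mono])
    then have "norm ((f' y1 - f' y2 - B (t *\<^sub>R k)) h) \<le> (e' * (t * c) + e' * (t * c)) * c"
      using c e' t by (intro order_trans[OF norm_blinfun] mult_mono) auto
    also have "\<dots> = e * t" using c by (simp add: e'_def field_simps)
    finally have "\<bar>f' y1 h - f' y2 h - t * B k h\<bar> \<le> e * t"
      by (simp add: blinfun.bilinear_simps)
    then have "t * \<bar>f' y1 h - f' y2 h - t * B k h\<bar> \<le> t * (e * t)"
      using t by (intro mult_left_mono) auto
    moreover have "g t - g 0 - t\<^sup>2 * B k h = t * (f' y1 h - f' y2 h - t * B k h)"
      using z(3) by (simp add: y1_def y2_def power2_eq_square algebra_simps)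
    ultimately have "\<bar>g t - g 0 - t\<^sup>2 * B k h\<bar> \<le> e * t\<^sup>2"
      using t by (simp add: abs_mult power2_eq_square mult_ac)
    moreover have "g t - g 0 = f (a + t *\<^sub>R h + t *\<^sub>R k) - f (a + t *\<^sub>R h) - f (a + t *\<^sub>R k) + f a"
      by (simp add: g_def)
    ultimately show ?thesis by simp
  qed
  then show ?thesis
    using d c unfolding eventually_at_right_field by (intro exI[of _ "d / c"]) auto
qed

text \<open>The second difference does not change when \<open>h\<close> and \<open>k\<close> are
  exchanged, so both \<open>B k h\<close> and \<open>B h k\<close> are its leading coefficient at
  order t^2.\<close>

lemma second_derivative_symmetric:
  fixes f :: "'a::real_normed_vector \<Rightarrow> real"
  assumes f': "\<forall>\<^sub>F x in nhds a. (f has_derivative blinfun_apply (f' x)) (at x)"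
    and B: "(f' has_derivative blinfun_apply B) (at a)"
  shows "B h k = B k h"
proof -
  have "\<bar>B h k - B k h\<bar> \<le> 0 + e" if e: "e > 0" for e
  proof -
    have "e / 2 > 0" using e by simp
    note ev = second_difference_approx[OF f' B this]
    have "\<forall>\<^sub>F t in at_right (0::real). \<bar>B h k - B k h\<bar> \<le> e"
      using ev[of h k] ev[of k h] eventually_at_right_less[of "0::real"]
    proof eventually_elim
      case (elim t)
      have "\<bar>t\<^sup>2 * B h k - t\<^sup>2 * B k h\<bar> \<le> e * t\<^sup>2"
      proof -
        have "a + t *\<^sub>R k + t *\<^sub>R h = a + t *\<^sub>R h + t *\<^sub>R k" by (simp add: add_ac)
        then show ?thesis using elim(1,2) by (simp only:)
      qed
      then have "t\<^sup>2 * \<bar>B h k - B k h\<bar> \<le> t\<^sup>2 * e"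
        by (simp add: abs_mult flip: right_diff_distrib) (simp add: mult_ac)
      then show ?case using elim(3) by simp
    qed
    then show ?thesis by (simp add: trivial_limit_at_right_real)
  qed
  then have "\<bar>B h k - B k h\<bar> \<le> 0" by (rule field_le_epsilon)
  then show ?thesis by simp
qed

text \<open>Product rule in which the second factor is only continuous: the first factor annihilates
  it at the point in question.\<close>

lemma has_real_derivative_apply_vanishing:
  fixes Q :: "real \<Rightarrow> 'a::real_normed_vector \<Rightarrow>\<^sub>L real"
  assumes Q: "(Q has_vector_derivative q) (at 0)" and s: "isCont s 0"
    and van: "\<forall>\<^sub>F t in nhds 0. Q 0 (s t) = 0"
  shows "((\<lambda>t. Q t (s t)) has_real_derivative q (s 0)) (at 0)"
proof -
  have "((\<lambda>t. norm (Q (0 + t) - Q 0 - t *\<^sub>R q) / norm t) \<longlongrightarrow> 0) (at 0)"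
    using Q unfolding has_vector_derivative_def has_derivative_at by (rule conjunct2)
  moreover have "\<forall>\<^sub>F t in at 0. norm (Q (0 + t) - Q 0 - t *\<^sub>R q) / norm t = norm ((1/t) *\<^sub>R (Q t - Q 0) - q)"
    unfolding eventually_at_filter
  proof (intro always_eventually allI impI)
    fix t :: real assume t: "t \<noteq> 0"
    have "(1/t) *\<^sub>R (Q t - Q 0) - q = (1/t) *\<^sub>R (Q (0 + t) - Q 0 - t *\<^sub>R q)"
      using t by (simp add: scaleR_diff_right)
    then show "norm (Q (0 + t) - Q 0 - t *\<^sub>R q) / norm t = norm ((1/t) *\<^sub>R (Q t - Q 0) - q)"
      by simp
  qed
  ultimately have "((\<lambda>t. norm ((1/t) *\<^sub>R (Q t - Q 0) - q)) \<longlongrightarrow> 0) (at 0)"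
    by (rule Lim_transform_eventually)
  then have "((\<lambda>t. (1/t) *\<^sub>R (Q t - Q 0)) \<longlongrightarrow> q) (at 0)"
    by (rule LIM_zero_cancel[OF tendsto_norm_zero_cancel])
  moreover have "(s \<longlongrightarrow> s 0) (at 0)" using s by (simp add: isCont_def)
  ultimately have "((\<lambda>t. ((1/t) *\<^sub>R (Q t - Q 0)) (s t)) \<longlongrightarrow> q (s 0)) (at 0)"
    by (rule blinfun.tendsto)
  moreover have "\<forall>\<^sub>F t in at 0. Q 0 (s t) = 0"
    using van unfolding eventually_nhds_conv_at by (rule conjunct1)
  then have "\<forall>\<^sub>F t in at 0. ((1/t) *\<^sub>R (Q t - Q 0)) (s t) = (Q (0 + t) (s (0 + t)) - Q 0 (s 0)) / t"
    by eventually_elim (simp add: blinfun.diff_left blinfun.scaleR_left eventually_nhds_x_imp_x[OF van])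
  ultimately show ?thesis unfolding DERIV_def by (rule Lim_transform_eventually)
qed

text \<open>Pairing with any vector orthogonal to \<open>S\<close> gives a locally constant
  function, so the derivative is orthogonal to the whole complement of \<open>S\<close>.\<close>

lemma has_vector_derivative_in_subspace:
  fixes f :: "real \<Rightarrow> 'a::euclidean_space"
  assumes S: "subspace S" and f: "(f has_vector_derivative v) (at t)"
    and mem: "\<forall>\<^sub>F r in nhds t. f r - a \<in> S"
  shows "v \<in> S"
proof -
  have "w \<bullet> v = 0" if w: "w \<in> orthogonal_comp S" for w
  proof -
    have "((\<lambda>r. w \<bullet> f r) has_derivative (\<lambda>u. w \<bullet> (u *\<^sub>R v))) (at t)"
      using f unfolding has_vector_derivative_def by (intro has_derivative_inner_right)
    moreover have "\<forall>\<^sub>F r in nhds t. w \<bullet> f r = w \<bullet> a"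
      using mem
    proof eventually_elim
      case (elim r)
      then have "(f r - a) \<bullet> w = 0" using w by (auto simp: orthogonal_comp_def orthogonal_def)
      then show ?case by (simp add: inner_diff_left inner_commute[of w])
    qed
    then have "((\<lambda>r. w \<bullet> f r) has_derivative (\<lambda>u. 0)) (at t)"
      by (intro has_derivative_transform_eventually[OF has_derivative_const])
        (auto simp: eventually_nhds_conv_at eq_commute)
    ultimately have "(\<lambda>u. w \<bullet> (u *\<^sub>R v)) = (\<lambda>u. 0)" by (rule has_derivative_unique)
    from fun_cong[OF this, of 1] show ?thesis by simp
  qed
  then have "v \<in> orthogonal_comp (orthogonal_comp S)"
    by (auto simp: orthogonal_comp_def orthogonal_def)
  then show ?thesis using S by (simp add: orthogonal_comp_self)
qed

section \<open>Slice charts\<close>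

text \<open>This yields continuity of the derivative of a local inverse from a left inverse at the
  limit alone. Since \<open>q y - L h = - L ((A y - A0) (q y))\<close>, a small
  \<open>A y - A0\<close> first bounds \<open>q y\<close> by twice |L| |h|, the threshold 1/2
  absorbing its own norm, and the same identity then gives convergence.\<close>

lemma tendsto_solution:
  fixes A :: "'b \<Rightarrow> 'a::real_normed_vector \<Rightarrow>\<^sub>L 'a"
  assumes A: "(A \<longlongrightarrow> A0) F" and L: "L o\<^sub>L A0 = id_blinfun"
    and q: "\<forall>\<^sub>F y in F. A y (q y) = h"
  shows "(q \<longlongrightarrow> L h) F"
proof -
  have LA: "L (A0 v) = v" for v using L by (metis blinfun_apply_blinfun_compose blinfun_apply_id_blinfun)
  have z: "((\<lambda>y. norm L * norm (A y - A0)) \<longlongrightarrow> norm L * norm (A0 - A0)) F"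
    by (intro tendsto_intros A)
  then have "\<forall>\<^sub>F y in F. norm L * norm (A y - A0) < 1/2"
    by (rule order_tendstoD(2)) simp
  then have b: "\<forall>\<^sub>F y in F. norm (q y - L h) \<le> (norm L * norm (A y - A0)) * (2 * (norm L * norm h))"
    using q
  proof eventually_elim
    case (elim y)
    have e: "q y - L h = - L ((A y - A0) (q y))"
      using elim(2) LA[of "q y"] by (simp add: blinfun.diff_left blinfun.diff_right)
    have n: "norm (q y - L h) \<le> norm L * norm (A y - A0) * norm (q y)"
      unfolding e norm_minus_cancel
      by (metis (no_types) norm_blinfun mult.assoc mult_left_mono norm_ge_zero order_trans)
    have "norm (q y) \<le> norm (L h) + norm (q y - L h)" by (metis norm_triangle_sub)
    also have "\<dots> \<le> norm L * norm h + 1/2 * norm (q y)"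
      by (intro add_mono norm_blinfun order_trans[OF n] mult_right_mono) (use elim(1) in auto)
    finally have "norm (q y) \<le> 2 * (norm L * norm h)" by simp
    then show ?case by (intro order_trans[OF n] mult_left_mono) auto
  qed
  have "((\<lambda>y. (norm L * norm (A y - A0)) * (2 * (norm L * norm h))) \<longlongrightarrow> 0) F"
    using z by (intro tendsto_mult_left_zero) simp
  then have "((\<lambda>y. q y - L h) \<longlongrightarrow> 0) F"
    by (rule Lim_null_comparison[OF b])
  then show ?thesis by (rule LIM_zero_cancel)
qed

text \<open>The sum is the adjoint of \<open>f\<close> applied to \<open>u\<close>. Writing it in
  coordinates lets its dependence on parameters be differentiated term by term.\<close>

lemma sum_inner_Basis_scaleR_inner:
  fixes f :: "'a::euclidean_space \<Rightarrow> 'a"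
  assumes "linear f"
  shows "(\<Sum>b\<in>Basis. (f b \<bullet> u) *\<^sub>R b) \<bullet> v = f v \<bullet> u"
proof -
  have "f v = (\<Sum>b\<in>Basis. (v \<bullet> b) *\<^sub>R f b)"
    using linear_sum[OF assms, of "\<lambda>b. (v \<bullet> b) *\<^sub>R b" Basis]
    by (simp add: euclidean_representation linear_scale[OF assms])
  then show ?thesis
    by (simp add: inner_sum_left inner_commute[of v] mult.commute)
qed

lemma isCont_eventually_mem_open:
  assumes "isCont f t" "open U" "f t \<in> U"
  shows "\<forall>\<^sub>F r in nhds t. f r \<in> U"
proof -
  have "(f \<longlongrightarrow> f t) (nhds t)"
    using assms(1) tendsto_at_iff_tendsto_nhds by (metis isCont_def)
  then show ?thesis using assms(2,3) by (rule topological_tendstoD)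
qed

text \<open>These are the witnesses hidden in \<open>C2_submanifold_around\<close> and
  \<open>C2_on\<close>, fixed as parameters so that both derivatives of the chart and of its inverse
  have names.\<close>

locale slice_chart =
  fixes M U W S :: "'a::euclidean_space set" and \<phi> \<psi> :: "'a \<Rightarrow> 'a"
    and \<phi>' \<psi>' :: "'a \<Rightarrow> 'a \<Rightarrow>\<^sub>L 'a" and \<phi>'' \<psi>'' :: "'a \<Rightarrow> 'a \<Rightarrow>\<^sub>L 'a \<Rightarrow>\<^sub>L 'a" and x :: 'a
  assumes U: "open U" and xU: "x \<in> U" and W: "open W" and S: "subspace S" and xM: "x \<in> M"
    and phi1: "\<And>y. y \<in> U \<Longrightarrow> (\<phi> has_derivative blinfun_apply (\<phi>' y)) (at y)"
    and phi2: "\<And>y. y \<in> U \<Longrightarrow> (\<phi>' has_derivative blinfun_apply (\<phi>'' y)) (at y)"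
    and phi3: "continuous_on U \<phi>''"
    and psi1: "\<And>y. y \<in> W \<Longrightarrow> (\<psi> has_derivative blinfun_apply (\<psi>' y)) (at y)"
    and psi2: "\<And>y. y \<in> W \<Longrightarrow> (\<psi>' has_derivative blinfun_apply (\<psi>'' y)) (at y)"
    and psi3: "continuous_on W \<psi>''"
    and img: "\<phi> ` U = W" and inv: "\<And>y. y \<in> U \<Longrightarrow> \<psi> (\<phi> y) = y"
    and slice: "\<phi> ` (M \<inter> U) = S \<inter> W"
begin

lemma phi_mem: "y \<in> U \<Longrightarrow> \<phi> y \<in> W" using img by blast
lemma psi_mem: "s \<in> W \<Longrightarrow> \<psi> s \<in> U" using img inv by (metis imageE)
lemma phi_psi: "s \<in> W \<Longrightarrow> \<phi> (\<psi> s) = s" using img inv by (metis imageE)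
lemma mem_M_iff: "y \<in> U \<Longrightarrow> y \<in> M \<longleftrightarrow> \<phi> y \<in> S"
  using slice inv phi_mem by (metis (no_types, lifting) IntD1 IntD2 IntI imageE imageI)
lemma psi_mem_M: "s \<in> S \<Longrightarrow> s \<in> W \<Longrightarrow> \<psi> s \<in> M" using mem_M_iff psi_mem phi_psi by metis
lemma base_mem: "\<phi> x \<in> W" "\<phi> x \<in> S" using phi_mem xU mem_M_iff xM by auto

lemma psi'_phi': "y \<in> U \<Longrightarrow> \<psi>' (\<phi> y) (\<phi>' y h) = h"
proof -
  assume y: "y \<in> U"
  have "((\<lambda>y. \<psi> (\<phi> y)) has_derivative (\<lambda>h. \<psi>' (\<phi> y) (\<phi>' y h))) (at y)"
    using phi1[OF y] psi1[OF phi_mem[OF y]] by (rule has_derivative_compose)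
  moreover have "((\<lambda>y. \<psi> (\<phi> y)) has_derivative (\<lambda>h. h)) (at y)"
    by (rule has_derivative_transform_within_open[OF has_derivative_ident U y]) (simp add: inv)
  ultimately have "(\<lambda>h. \<psi>' (\<phi> y) (\<phi>' y h)) = (\<lambda>h. h)" by (rule has_derivative_unique)
  then show ?thesis by (rule fun_cong)
qed

lemma phi'_psi': "s \<in> W \<Longrightarrow> \<phi>' (\<psi> s) (\<psi>' s h) = h"
proof -
  assume y: "s \<in> W"
  have "((\<lambda>y. \<phi> (\<psi> y)) has_derivative (\<lambda>h. \<phi>' (\<psi> s) (\<psi>' s h))) (at s)"
    using psi1[OF y] phi1[OF psi_mem[OF y]] by (rule has_derivative_compose)
  moreover have "((\<lambda>y. \<phi> (\<psi> y)) has_derivative (\<lambda>h. h)) (at s)"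
    by (rule has_derivative_transform_within_open[OF has_derivative_ident W y]) (simp add: phi_psi)
  ultimately have "(\<lambda>h. \<phi>' (\<psi> s) (\<psi>' s h)) = (\<lambda>h. h)" by (rule has_derivative_unique)
  then show ?thesis by (rule fun_cong)
qed

text \<open>A curve in \<open>M\<close> read in the chart stays in \<open>S\<close>, hence so does
  its velocity. Conversely \<open>\<psi>\<close> carries a straight line in \<open>S\<close> to a
  curve in \<open>M\<close> with the prescribed velocity.\<close>

lemma tangent_space_eq: "tangent_space M x = \<psi>' (\<phi> x) ` S"
proof (intro equalityI subsetI)
  fix v assume "v \<in> tangent_space M x"
  then obtain e c where e: "e > 0" and c: "c ` {-e<..<e} \<subseteq> M" "c 0 = x"
    and dc: "(c has_vector_derivative v) (at 0)"
    unfolding tangent_space_def by blast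
  have "isCont c 0" using dc has_vector_derivative_continuous by blast
  then have "\<forall>\<^sub>F t in nhds 0. c t \<in> U"
    using U xU c(2) by (intro isCont_eventually_mem_open) auto
  moreover have "\<forall>\<^sub>F t in nhds (0::real). t \<in> {-e<..<e}" using e by (intro eventually_nhds_in_open) auto
  ultimately have ev: "\<forall>\<^sub>F t in nhds 0. \<phi> (c t) - 0 \<in> S"
  proof eventually_elim
    case (elim t)
    then have "c t \<in> M" using c(1) by blast
    then show ?case using elim(1) mem_M_iff by simp
  qed
  have "((\<lambda>t. \<phi> (c t)) has_vector_derivative \<phi>' x v) (at 0)"
    using has_derivative_compose[OF dc[unfolded has_vector_derivative_def], of \<phi> "\<phi>' x"] phi1[OF xU] c(2)
    by (simp add: has_vector_derivative_def blinfun.scaleR_right)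
  then have "\<phi>' x v \<in> S" using has_vector_derivative_in_subspace[OF S _ ev] by blast
  then show "v \<in> \<psi>' (\<phi> x) ` S" using psi'_phi'[OF xU, of v] by (metis imageI)
next
  fix v assume "v \<in> \<psi>' (\<phi> x) ` S"
  then obtain h where h: "h \<in> S" "v = \<psi>' (\<phi> x) h" by blast
  \<comment> \<open>The line is written through a bounded linear map so that
    \<open>C2_on_affine\<close> applies.\<close>
  define l where "l = (\<lambda>t::real. \<phi> x + blinfun_apply (blinfun_scaleR_left h) t)"
  have "isCont l 0" unfolding l_def by (intro continuous_intros)
  moreover have "l 0 = \<phi> x" by (simp add: l_def)
  ultimately have "\<forall>\<^sub>F t in nhds 0. l t \<in> W"
    using W base_mem(1) by (intro isCont_eventually_mem_open) auto
  then obtain e where e: "e > 0" "\<And>t. \<bar>t\<bar> < e \<Longrightarrow> l t \<in> W"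
    unfolding eventually_nhds_metric by (auto simp: dist_real_def)
  have "C2_on {-e<..<e} (\<lambda>t. \<psi> (l t))"
  proof (rule C2_on_compose[where f = l and g = \<psi> and W = W])
    show "C2_on {-e<..<e} l" unfolding l_def by (rule C2_on_affine)
    show "C2_on W \<psi>" using psi1 psi2 psi3 by (rule C2_onI)
    show "l ` {-e<..<e} \<subseteq> W" using e(2) by auto
  qed
  moreover have "(\<lambda>t. \<psi> (l t)) ` {-e<..<e} \<subseteq> M"
    using e(2) h base_mem S by (auto intro!: psi_mem_M simp: l_def subspace_add subspace_scale abs_less_iff)
  moreover have "\<psi> (l 0) = x" using inv xU by (simp add: l_def)
  moreover have "((\<lambda>t. \<psi> (l t)) has_vector_derivative v) (at 0)"
  proof -
    have "(l has_derivative (\<lambda>t. t *\<^sub>R h)) (at 0)"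
      unfolding l_def by (auto intro!: derivative_eq_intros)
    moreover have "(\<psi> has_derivative \<psi>' (\<phi> x)) (at (l 0))"
      using psi1[OF base_mem(1)] by (simp add: \<open>l 0 = \<phi> x\<close>)
    ultimately have "((\<lambda>t. \<psi> (l t)) has_derivative (\<lambda>t. \<psi>' (\<phi> x) (t *\<^sub>R h))) (at 0)"
      by (rule has_derivative_compose)
    then show ?thesis by (simp add: has_vector_derivative_def h(2) blinfun.scaleR_right)
  qed
  ultimately show "v \<in> tangent_space M x" unfolding tangent_space_def using e(1) by blast
qed

lemma phi'_tangent: "h \<in> tangent_space M x \<Longrightarrow> \<phi>' x h \<in> S"
  using tangent_space_eq phi'_psi'[OF base_mem(1)] inv[OF xU] by auto

lemma continuous_phi: "continuous_on U \<phi>" "continuous_on U \<phi>'"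
  by (auto intro!: continuous_at_imp_continuous_on has_derivative_continuous[OF phi1]
        has_derivative_continuous[OF phi2])

lemma continuous_psi: "continuous_on W \<psi>" "continuous_on W \<psi>'"
  by (auto intro!: continuous_at_imp_continuous_on has_derivative_continuous[OF psi1]
        has_derivative_continuous[OF psi2])

text \<open>\<open>closest_point\<close> is a choice and says something only where a nearest point
  exists, while \<open>M\<close> may fail to be closed. Inside a small ball the chart shows
  \<open>M\<close> to be closed, and points of \<open>M\<close> outside that ball are farther from
  \<open>y\<close> than \<open>x\<close> is. The factor 2 is the triangle inequality, using
  \<open>x\<close> as a competitor.\<close>

lemma closest_point_near:
  "\<forall>\<^sub>F y in nhds x. closest_point M y \<in> M \<inter> U \<and> (\<forall>m\<in>M. dist y (closest_point M y) \<le> dist y m)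
     \<and> dist (closest_point M y) x \<le> 2 * dist y x"
proof -
  obtain r where r: "r > 0" "cball x r \<subseteq> U" using U xU open_contains_cball by blast
  define K where "K = {y \<in> cball x r. \<phi> y \<in> S}"
  have KM: "K = M \<inter> cball x r" using r mem_M_iff by (auto simp: K_def)
  have "closed K" unfolding K_def
    using continuous_closed_preimage[OF continuous_on_subset[OF continuous_phi(1) r(2)] closed_cball closed_subspace[OF S]]
    by (simp add: vimage_def Int_def)
  have xK: "x \<in> K" using KM xM r by simp
  have "closest_point M y \<in> M \<inter> U \<and> (\<forall>m\<in>M. dist y (closest_point M y) \<le> dist y m)
     \<and> dist (closest_point M y) x \<le> 2 * dist y x" if y: "dist y x < r/2" for y
  proof -
    obtain p where p: "p \<in> K" "\<And>m. m \<in> K \<Longrightarrow> dist y p \<le> dist y m"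
      using distance_attains_inf[OF \<open>closed K\<close>, of y] xK by blast
    have pm: "dist y p \<le> dist y m" if "m \<in> M" for m
    proof (cases "m \<in> K")
      case False
      then have "dist x m > r" using that KM by auto
      then have "dist y m > r/2" using y dist_triangle[of x m y] by (simp add: dist_commute)
      then show ?thesis using p(2)[OF xK] y by simp
    qed (use p in auto)
    have ex: "closest_point M y \<in> M \<and> (\<forall>m\<in>M. dist y (closest_point M y) \<le> dist y m)"
      unfolding closest_point_def by (rule someI[of _ p]) (use pm p KM in auto)
    then have "dist y (closest_point M y) \<le> dist y x" using xM by blast
    then have d: "dist (closest_point M y) x \<le> 2 * dist y x"
      using dist_triangle[of "closest_point M y" x y] by (simp add: dist_commute)
    then have "closest_point M y \<in> U" using y r by (auto simp: subset_iff dist_commute)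
    then show ?thesis using ex d by blast
  qed
  then show ?thesis using r(1) unfolding eventually_nhds_metric by (intro exI[of _ "r/2"]) auto
qed

lemma closest_point_tendsto: "(closest_point M \<longlongrightarrow> x) (nhds x)"
proof -
  have "((\<lambda>y. dist (closest_point M y) x) \<longlongrightarrow> 0) (nhds x)"
  proof (rule tendsto_sandwich)
    show "\<forall>\<^sub>F y in nhds x. 0 \<le> dist (closest_point M y) x" by simp
    show "\<forall>\<^sub>F y in nhds x. dist (closest_point M y) x \<le> 2 * dist y x"
      using closest_point_near by eventually_elim blast
    have "((\<lambda>y. 2 * dist y x) \<longlongrightarrow> 2 * dist x x) (nhds x)"
      by (intro tendsto_intros filterlim_ident)
    then show "((\<lambda>y. 2 * dist y x) \<longlongrightarrow> 0) (nhds x)" by simp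
  qed simp
  then show ?thesis by (rule tendsto_dist_iff[THEN iffD2])
qed

text \<open>Along the curve \<open>\<psi> (\<phi> p + t *\<^sub>R h)\<close> in \<open>M\<close> the
  squared distance to \<open>y\<close> is minimal at t = 0, so its derivative there
  vanishes.\<close>

lemma closest_normal:
  assumes p: "p \<in> M" "p \<in> U" and min: "\<And>m. m \<in> M \<Longrightarrow> dist y p \<le> dist y m" and h: "h \<in> S"
  shows "(y - p) \<bullet> \<psi>' (\<phi> p) h = 0"
proof -
  define l where "l = (\<lambda>t. \<phi> p + t *\<^sub>R h)"
  define k where "k = (\<lambda>t. (\<psi> (l t) - y) \<bullet> (\<psi> (l t) - y))"
  have W0: "\<phi> p \<in> W" and S0: "\<phi> p \<in> S" using p phi_mem mem_M_iff by auto
  have "((\<lambda>t. l t) \<longlongrightarrow> \<phi> p + 0 *\<^sub>R h) (nhds 0)"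
    unfolding l_def by (intro tendsto_intros filterlim_ident)
  then have "\<forall>\<^sub>F t in nhds 0. l t \<in> W" using W W0 by (simp add: topological_tendstoD)
  then obtain e where e: "e > 0" "\<And>t. \<bar>t\<bar> < e \<Longrightarrow> l t \<in> W"
    unfolding eventually_nhds_metric by (auto simp: dist_real_def)
  have "(l has_derivative (\<lambda>t. t *\<^sub>R h)) (at 0)"
    unfolding l_def by (auto intro!: derivative_eq_intros)
  moreover have "(\<psi> has_derivative \<psi>' (\<phi> p)) (at (l 0))" using psi1[OF W0] by (simp add: l_def)
  ultimately have "((\<lambda>t. \<psi> (l t)) has_derivative (\<lambda>t. \<psi>' (\<phi> p) (t *\<^sub>R h))) (at 0)"
    by (rule has_derivative_compose)
  then have d: "((\<lambda>t. \<psi> (l t)) has_derivative (\<lambda>t. t *\<^sub>R \<psi>' (\<phi> p) h)) (at 0)"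
    by (simp add: blinfun.scaleR_right)
  have "((\<lambda>t. \<psi> (l t) - y) has_derivative (\<lambda>t. t *\<^sub>R \<psi>' (\<phi> p) h)) (at 0)"
    using has_derivative_diff[OF d has_derivative_const[of y]] by simp
  from has_derivative_inner[OF this this]
  have "(k has_derivative (\<lambda>t. (\<psi> (l 0) - y) \<bullet> t *\<^sub>R \<psi>' (\<phi> p) h + t *\<^sub>R \<psi>' (\<phi> p) h \<bullet> (\<psi> (l 0) - y))) (at 0)"
    unfolding k_def .
  moreover have "(\<lambda>t. (\<psi> (l 0) - y) \<bullet> t *\<^sub>R \<psi>' (\<phi> p) h + t *\<^sub>R \<psi>' (\<phi> p) h \<bullet> (\<psi> (l 0) - y))
      = (*) (2 * ((p - y) \<bullet> \<psi>' (\<phi> p) h))"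
    using inv[OF p(2)] by (simp add: l_def inner_commute[of "\<psi>' (\<phi> p) h"] fun_eq_iff)
  ultimately have "(k has_real_derivative 2 * ((p - y) \<bullet> \<psi>' (\<phi> p) h)) (at 0)"
    by (simp add: has_field_derivative_def)
  moreover have "\<forall>t. \<bar>0 - t\<bar> < e \<longrightarrow> k 0 \<le> k t"
  proof (intro allI impI)
    fix t assume "\<bar>0 - t\<bar> < e"
    then have "\<psi> (l t) \<in> M" using e(2)[of t] S S0 h by (auto intro!: psi_mem_M simp: l_def subspace_add subspace_scale)
    then have "(dist y p)\<^sup>2 \<le> (dist y (\<psi> (l t)))\<^sup>2" using min by (simp add: power_mono)
    then show "k 0 \<le> k t" using inv[OF p(2)]
      by (simp add: k_def l_def dist_norm norm_minus_commute flip: power2_norm_eq_inner)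
  qed
  ultimately have "2 * ((p - y) \<bullet> \<psi>' (\<phi> p) h) = 0" by (rule DERIV_local_min[OF _ e(1)])
  then show ?thesis by (simp add: inner_diff_left)
qed

text \<open>The normal space of \<open>M\<close> at \<open>\<psi> s\<close> is the image of the orthogonal complement of \<open>S\<close> under
  the adjoint of \<open>\<phi>' (\<psi> s)\<close>. Hence \<open>s + \<nu> \<mapsto> \<psi> s + (\<phi>' (\<psi> s))\<^sup>* \<nu>\<close> is a tubular neighbourhood map,
  and the inverse function theorem makes the nearest-point projection differentiable.\<close>

lemma closest_point_chart:
  obtains X X' where
    "\<forall>\<^sub>F y in nhds x. closest_point M y = \<psi> (X y) \<and> X y \<in> S \<inter> W \<and> (X has_derivative X' y) (at y)"
    "\<And>h. isCont (\<lambda>y. X' y h) x" "\<And>a. a \<in> S \<Longrightarrow> X' x (\<psi>' (\<phi> x) a) = a"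
    "\<And>y h. X' y h \<in> S" "X x = \<phi> x" "isCont X x"
proof -
  define P where "P = orth_proj S"
  have blP: "bounded_linear P"
    unfolding P_def using linear_orth_proj[OF S] by (simp add: linear_conv_bounded_linear)
  have PS: "P y \<in> S" for y unfolding P_def by (rule orth_proj_mem[OF S])
  have Pid: "P y = y" if "y \<in> S" for y unfolding P_def by (rule orth_proj_id[OF S that])
  have Po: "(y - P y) \<bullet> v = 0" if "v \<in> S" for y v unfolding P_def by (rule orth_proj_orthogonal[OF S that])
  have contP: "continuous_on A P" for A by (rule linear_continuous_on[OF blP])
  have dP: "(P has_derivative P) (at y)" for y
    using bounded_linear_imp_has_derivative[OF blP] by simp
  define D where "D = P -` W"
  have D: "open D" unfolding D_def using contP W by (intro open_vimage) auto
  define s0 where "s0 = \<phi> x"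
  have s0: "s0 \<in> S" "s0 \<in> W" "P s0 = s0" "\<psi> s0 = x" using base_mem Pid inv[OF xU] by (auto simp: s0_def)
  have s0D: "s0 \<in> D" using s0 by (simp add: D_def)
  \<comment> \<open>\<open>P w\<close> serves as the chart coordinate and \<open>w - P w\<close> as
    the normal coordinate; the sum is the adjoint of \<open>\<phi>' (\<psi> (P w))\<close> at the
    latter.\<close>
  define T where "T w = \<psi> (P w) + (\<Sum>b\<in>Basis. (\<phi>' (\<psi> (P w)) b \<bullet> (w - P w)) *\<^sub>R b)" for w
  define T1 where "T1 w k = \<psi>' (P w) (P k) + (\<Sum>b\<in>Basis. (\<phi>' (\<psi> (P w)) b \<bullet> (k - P k)
    + \<phi>'' (\<psi> (P w)) (\<psi>' (P w) (P k)) b \<bullet> (w - P w)) *\<^sub>R b)" for w k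
  define T' where "T' w = Blinfun (T1 w)" for w
  have dT: "(T has_derivative T1 w) (at w)" if w: "w \<in> D" for w
  proof -
    have PW: "P w \<in> W" using w by (simp add: D_def)
    have a: "((\<lambda>w. \<psi> (P w)) has_derivative (\<lambda>k. \<psi>' (P w) (P k))) (at w)"
      using dP psi1[OF PW] by (rule has_derivative_compose)
    have b: "((\<lambda>w. \<phi>' (\<psi> (P w))) has_derivative (\<lambda>k. \<phi>'' (\<psi> (P w)) (\<psi>' (P w) (P k)))) (at w)"
      using a phi2[OF psi_mem[OF PW]] by (rule has_derivative_compose)
    have c: "((\<lambda>w. \<phi>' (\<psi> (P w)) i) has_derivative (\<lambda>k. \<phi>'' (\<psi> (P w)) (\<psi>' (P w) (P k)) i)) (at w)" for i
      by (rule bounded_linear.has_derivative[OF blinfun.bounded_linear_left b])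
    have d: "((\<lambda>w. w - P w) has_derivative (\<lambda>k. k - P k)) (at w)"
      by (rule has_derivative_diff[OF has_derivative_ident dP])
    show ?thesis unfolding T_def T1_def
      by (rule has_derivative_add[OF a has_derivative_sum[OF has_derivative_scaleR_left[OF has_derivative_inner[OF c d]]]])
  qed
  have T': "blinfun_apply (T' w) = T1 w" if "w \<in> D" for w
    unfolding T'_def by (rule bounded_linear_Blinfun_apply[OF has_derivative_bounded_linear[OF dT[OF that]]])
  have cont: "continuous_on D T'"
  proof (rule continuous_on_blinfun_componentwise)
    fix i :: 'a
    note ap = bounded_bilinear.continuous_on[OF bounded_bilinear_blinfun_apply]
    note ap1 = bounded_bilinear.continuous_on[OF bounded_bilinear_blinfun_apply _ continuous_on_const]
    have im: "P ` D \<subseteq> W" by (auto simp: D_def)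
    have c1: "continuous_on D (\<lambda>w. \<psi> (P w))" using continuous_psi(1) contP im by (rule continuous_on_compose2)
    have c2: "continuous_on D (\<lambda>w. \<psi>' (P w))" using continuous_psi(2) contP im by (rule continuous_on_compose2)
    have im2: "(\<lambda>w. \<psi> (P w)) ` D \<subseteq> U" using im psi_mem by auto
    have c3: "continuous_on D (\<lambda>w. \<phi>' (\<psi> (P w)))" using continuous_phi(2) c1 im2 by (rule continuous_on_compose2)
    have c4: "continuous_on D (\<lambda>w. \<phi>'' (\<psi> (P w)))" using phi3 c1 im2 by (rule continuous_on_compose2)
    have c5: "continuous_on D (\<lambda>w. \<phi>'' (\<psi> (P w)) (\<psi>' (P w) (P i)) b \<bullet> (w - P w))" for b
      by (rule continuous_on_inner[OF ap1[OF ap[OF c4 ap1[OF c2]]] continuous_on_diff[OF continuous_on_id contP]])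
    have c6: "continuous_on D (\<lambda>w. \<phi>' (\<psi> (P w)) b \<bullet> (i - P i))" for b
      by (rule continuous_on_inner[OF ap1[OF c3] continuous_on_const])
    have "continuous_on D (\<lambda>w. T1 w i)" unfolding T1_def
      by (rule continuous_on_add[OF ap1[OF c2] continuous_on_sum[OF continuous_on_scaleR[OF continuous_on_add[OF c6 c5] continuous_on_const]]])
    then show "continuous_on D (\<lambda>w. T' w i)" by (rule continuous_on_eq) (simp add: T')
  qed
  have T1s0: "T1 s0 k = \<psi>' s0 (P k) + (\<Sum>b\<in>Basis. (\<phi>' x b \<bullet> (k - P k)) *\<^sub>R b)" for k
    by (simp add: T1_def s0)
  \<comment> \<open>The tangential and the normal part of \<open>T1 s0 k\<close> are orthogonal,
    because the adjoint moves \<open>\<phi>' x\<close> onto \<open>\<psi>' s0 (P k)\<close> and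
    leaves \<open>P k \<bullet> (k - P k)\<close>. Both parts therefore vanish separately, and each
    determines its component of \<open>k\<close>.\<close>
  have inj: "k = 0" if k: "T1 s0 k = 0" for k
  proof -
    define nu where "nu = (\<Sum>b\<in>Basis. (\<phi>' x b \<bullet> (k - P k)) *\<^sub>R b)"
    have nu: "nu \<bullet> v = \<phi>' x v \<bullet> (k - P k)" for v
      unfolding nu_def by (rule sum_inner_Basis_scaleR_inner) (simp add: bounded_linear.linear blinfun.bounded_linear_right)
    have e: "\<psi>' s0 (P k) = - nu" using k T1s0[of k] by (simp add: nu_def eq_neg_iff_add_eq_0)
    have "nu \<bullet> \<psi>' s0 (P k) = P k \<bullet> (k - P k)"
      using nu[of "\<psi>' s0 (P k)"] phi'_psi'[OF s0(2)] s0(4) by simp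
    also have "\<dots> = 0" using Po[OF PS] by (simp add: inner_commute)
    finally have "nu = 0" by (simp add: e)
    then have "P k = 0" using e phi'_psi'[OF s0(2), of "P k"] by (simp add: blinfun.zero_right)
    have "\<phi>' x (\<psi>' s0 (k - P k)) \<bullet> (k - P k) = 0" using nu[of "\<psi>' s0 (k - P k)"] \<open>nu = 0\<close> by simp
    then have "k - P k = 0" using phi'_psi'[OF s0(2), of "k - P k"] s0(4) by simp
    with \<open>P k = 0\<close> show "k = 0" by simp
  qed
  have linT: "linear (T' s0)" by (simp add: bounded_linear.linear blinfun.bounded_linear_right)
  moreover have "inj (T' s0)" using inj T'[OF s0D] linear_injective_0[OF linT] by auto
  ultimately obtain g0 where g0: "linear g0" "g0 \<circ> T' s0 = id" using linear_injective_left_inverse by blast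
  define L where "L = Blinfun g0"
  have L: "blinfun_apply L = g0" unfolding L_def
    using g0(1) by (intro bounded_linear_Blinfun_apply) (simp add: linear_conv_bounded_linear)
  have invL: "L o\<^sub>L T' s0 = id_blinfun"
    by (rule blinfun_eqI) (use g0(2) L in \<open>simp add: fun_eq_iff\<close>)
  have Ts0: "T s0 = x" by (simp add: T_def s0)
  obtain U' V g g' where g: "open U'" "U' \<subseteq> D" "s0 \<in> U'" "open V" "T s0 \<in> V" "homeomorphism U' V T g"
    "\<And>y. y \<in> V \<Longrightarrow> (g has_derivative (g' y)) (at y)"
    "\<And>y. y \<in> V \<Longrightarrow> g' y = Hilbert_Choice.inv (blinfun_apply (T' (g y)))"
    "\<And>y. y \<in> V \<Longrightarrow> bij (blinfun_apply (T' (g y)))"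
    using inverse_function_theorem[OF D, of T T' s0 L] dT T' cont s0D invL by metis
  have xV: "x \<in> V" using g(5) Ts0 by simp
  have gT: "g (T w) = w" if "w \<in> U'" for w using g(6) that by (simp add: homeomorphism_def)
  have gx: "g x = s0" using gT[OF g(3)] Ts0 by simp
  define X where "X y = P (g y)" for y
  \<comment> \<open>The value 0 outside \<open>V\<close> makes \<open>X' y h \<in> S\<close> true
    for every \<open>y\<close>.\<close>
  define X' where "X' y h = (if y \<in> V then P (g' y h) else 0)" for y h
  have X'S: "X' y h \<in> S" for y h using PS subspace_0[OF S] by (simp add: X'_def)
  have contg: "isCont g x" using g(7)[OF xV] has_derivative_continuous by blast
  have dX: "(X has_derivative X' y) (at y)" if "y \<in> V" for y
    using has_derivative_compose[OF g(7)[OF that] dP] that by (simp add: X_def[abs_def] X'_def[abs_def])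
  have Xx: "X x = \<phi> x" by (simp add: X_def gx s0 flip: s0_def)
  have solve: "T' (g y) (g' y h) = h" if "y \<in> V" for y h
    using g(8,9)[OF that] by (simp add: bij_is_surj surj_f_inv_f)
  have "isCont T' s0" using cont s0D continuous_on_eq_continuous_at[OF D] by blast
  moreover have "(g \<longlongrightarrow> s0) (at x)" using contg gx by (simp add: isCont_def)
  ultimately have limA: "((\<lambda>y. T' (g y)) \<longlongrightarrow> T' s0) (at x)" by (rule isCont_tendsto_compose)
  have LT: "L (T' s0 v) = v" for v using g0(2) L by (simp add: fun_eq_iff)
  have g'x: "g' x h = L h" for h
    using solve[OF xV, of h] LT[of "g' x h"] gx by simp
  have inV: "\<forall>\<^sub>F y in at x. y \<in> V" using g(4) xV by (simp add: eventually_at_in_open')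
  \<comment> \<open>The derivative of the local inverse is known only as a set-theoretic inverse; it
    is treated as the solution of a linear equation whose coefficients converge.\<close>
  have contX': "isCont (\<lambda>y. X' y h) x" for h
  proof -
    have "((\<lambda>y. g' y h) \<longlongrightarrow> L h) (at x)"
      by (rule tendsto_solution[OF limA invL]) (use inV in \<open>eventually_elim, simp add: solve\<close>)
    then have "((\<lambda>y. P (g' y h)) \<longlongrightarrow> P (L h)) (at x)" by (rule bounded_linear.tendsto[OF blP])
    moreover have "\<forall>\<^sub>F y in at x. P (g' y h) = X' y h" using inV by eventually_elim (simp add: X'_def)
    ultimately have "((\<lambda>y. X' y h) \<longlongrightarrow> P (L h)) (at x)" by (rule Lim_transform_eventually)
    then show ?thesis by (simp add: isCont_def X'_def xV g'x)
  qed
  have X'a: "X' x (\<psi>' (\<phi> x) a) = a" if a: "a \<in> S" for a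
  proof -
    have "T' s0 a = \<psi>' s0 a" using a by (simp add: T'[OF s0D] T1s0 Pid)
    then have "L (\<psi>' s0 a) = a" using LT[of a] by simp
    then show ?thesis using a xV by (simp add: X'_def g'x Pid flip: s0_def)
  qed
  let ?p = "closest_point M"
  \<comment> \<open>The adjoint of \<open>\<psi>'\<close> inverts the adjoint of
    \<open>\<phi>'\<close>, so this is the normal coordinate of \<open>y - ?p y\<close>, and
    \<open>\<phi> (?p y) + nu y\<close> is the expected preimage of \<open>y\<close> under
    \<open>T\<close>.\<close>
  define nu where "nu y = (\<Sum>b\<in>Basis. (\<psi>' (\<phi> (?p y)) b \<bullet> (y - ?p y)) *\<^sub>R b)" for y
  have cphi: "isCont \<phi> x" using phi1[OF xU] has_derivative_continuous by blast
  have cpsi': "isCont \<psi>' s0" using psi2[OF s0(2)] has_derivative_continuous by blast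
  have lim1: "((\<lambda>y. \<phi> (?p y)) \<longlongrightarrow> s0) (nhds x)"
    using isCont_tendsto_compose[OF cphi closest_point_tendsto] by (simp add: s0_def)
  then have lim2: "((\<lambda>y. \<psi>' (\<phi> (?p y))) \<longlongrightarrow> \<psi>' s0) (nhds x)"
    by (rule isCont_tendsto_compose[OF cpsi'])
  have lim3: "((\<lambda>y. y - ?p y) \<longlongrightarrow> x - x) (nhds x)"
    by (rule tendsto_diff[OF filterlim_ident closest_point_tendsto])
  have "(nu \<longlongrightarrow> (\<Sum>b\<in>Basis. (\<psi>' s0 b \<bullet> (x - x)) *\<^sub>R b)) (nhds x)"
    unfolding nu_def[abs_def]
    by (intro tendsto_sum tendsto_scaleR tendsto_const tendsto_inner lim3 blinfun.tendsto lim2)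
  then have "((\<lambda>y. \<phi> (?p y) + nu y) \<longlongrightarrow> s0 + 0) (nhds x)"
    by (intro tendsto_add lim1) simp
  \<comment> \<open>\<open>g\<close> inverts \<open>T\<close> only on \<open>U'\<close>, so the
    candidate preimage must be known to lie there.\<close>
  then have inU': "\<forall>\<^sub>F y in nhds x. \<phi> (?p y) + nu y \<in> U'"
    using g(1,3) by (simp add: topological_tendstoD)
  have "\<forall>\<^sub>F y in nhds x. y \<in> V" using g(4) xV by (rule eventually_nhds_in_open)
  with inU' closest_point_near
  have ev: "\<forall>\<^sub>F y in nhds x. ?p y = \<psi> (X y) \<and> X y \<in> S \<inter> W \<and> (X has_derivative X' y) (at y)"
  proof eventually_elim
    case (elim y)
    define p s where "p = ?p y" and "s = \<phi> p"
    have p: "p \<in> M" "p \<in> U" "\<And>m. m \<in> M \<Longrightarrow> dist y p \<le> dist y m" using elim(2) by (auto simp: p_def)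
    have s: "s \<in> S" "s \<in> W" "\<psi> s = p" using p mem_M_iff phi_mem inv by (auto simp: s_def)
    have nu: "nu y \<bullet> v = \<psi>' s v \<bullet> (y - p)" for v
      unfolding nu_def s_def p_def
      by (rule sum_inner_Basis_scaleR_inner) (simp add: bounded_linear.linear blinfun.bounded_linear_right)
    have Ps: "P (s + nu y) = s"
      unfolding P_def
    proof (rule orth_proj_eqI[OF S s(1)])
      fix v assume "v \<in> S"
      then have "(y - p) \<bullet> \<psi>' (\<phi> p) v = 0" by (intro closest_normal p)
      then have "nu y \<bullet> v = 0" using nu[of v] by (simp add: s_def inner_commute)
      then show "(s + nu y - s) \<bullet> v = 0" by simp
    qed
    have "\<phi>' p b \<bullet> nu y = (y - p) \<bullet> b" for b
      using nu[of "\<phi>' p b"] psi'_phi'[OF p(2), of b] by (simp add: s_def inner_commute)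
    then have "T (s + nu y) = p + (\<Sum>b\<in>Basis. ((y - p) \<bullet> b) *\<^sub>R b)" by (simp add: T_def Ps s)
    then have "T (s + nu y) = y" unfolding euclidean_representation by simp
    moreover have "g (T (s + nu y)) = s + nu y" using gT elim(1) by (simp add: s_def p_def)
    ultimately have "g y = s + nu y" by simp
    then have "X y = s" by (simp add: X_def Ps)
    then show ?case using s dX[OF elim(3)] by (simp add: p_def)
  qed
  have "isCont X x" using dX[OF xV] has_derivative_continuous by blast
  with that[of X X'] ev contX' X'a X'S Xx show ?thesis by blast
qed

text \<open>A second derivative of the chart-valued projection \<open>X\<close>, which need not
  exist, would enter only through \<open>L' (\<phi> x)\<close> on \<open>S\<close>, where that
  functional vanishes. What remains is \<open>B\<close> at \<open>X' x h\<close> twice, and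
  \<open>X' x\<close> recovers the chart direction \<open>a\<close>.\<close>

lemma deriv_deriv_closest_point:
  assumes L1: "\<forall>\<^sub>F s in nhds (\<phi> x). (L has_derivative blinfun_apply (L' s)) (at s)"
    and L2: "(L' has_derivative blinfun_apply B) (at (\<phi> x))"
    and van: "\<And>a. a \<in> S \<Longrightarrow> L' (\<phi> x) a = 0"
    and J: "\<forall>\<^sub>F s in nhds (\<phi> x). s \<in> S \<longrightarrow> J (\<psi> s) = L s"
    and a: "a \<in> S"
  shows "deriv (deriv (\<lambda>t. J (closest_point M (x + t *\<^sub>R \<psi>' (\<phi> x) a)))) 0 = B a a"
proof -
  obtain X X' where X: "\<forall>\<^sub>F y in nhds x. closest_point M y = \<psi> (X y) \<and> X y \<in> S \<inter> W \<and> (X has_derivative X' y) (at y)"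
    and contX': "\<And>h. isCont (\<lambda>y. X' y h) x" and X'a: "\<And>a. a \<in> S \<Longrightarrow> X' x (\<psi>' (\<phi> x) a) = a"
    and X'S: "\<And>y h. X' y h \<in> S" and Xx: "X x = \<phi> x" and contX: "isCont X x"
    using closest_point_chart by blast
  define h where "h = \<psi>' (\<phi> x) a"
  define l where "l t = x + t *\<^sub>R h" for t
  have dl: "(l has_derivative (\<lambda>t. t *\<^sub>R h)) (at t)" for t
    unfolding l_def[abs_def] by (auto intro!: derivative_eq_intros)
  have l0: "l 0 = x" by (simp add: l_def)
  have cl: "isCont l 0" using dl has_derivative_continuous by blast
  then have liml: "filterlim l (nhds x) (nhds 0)"
    using tendsto_at_iff_tendsto_nhds[of l 0] by (simp add: isCont_def l0)
  have "filterlim X (nhds (\<phi> x)) (nhds x)"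
    using contX tendsto_at_iff_tendsto_nhds[of X x] by (simp add: isCont_def Xx)
  then have limX: "filterlim (\<lambda>t. X (l t)) (nhds (\<phi> x)) (nhds 0)"
    using liml by (rule filterlim_compose)
  have ev: "\<forall>\<^sub>F t in nhds 0. J (closest_point M (l t)) = L (X (l t)) \<and> (L has_derivative L' (X (l t))) (at (X (l t)))
     \<and> (X has_derivative X' (l t)) (at (l t))"
    using eventually_compose_filterlim[OF X liml] eventually_compose_filterlim[OF L1 limX]
      eventually_compose_filterlim[OF J limX]
    by eventually_elim auto
  \<comment> \<open>This is the first derivative along the line. To differentiate at each nearby
    \<open>t\<close>, the representation by \<open>L\<close> is needed in a whole neighbourhood of
    \<open>t\<close>, which \<open>eventually_eventually\<close> provides.\<close>
  define k where "k t = L' (X (l t)) (X' (l t) h)" for t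
  have "\<forall>\<^sub>F t in nhds 0. deriv (\<lambda>t. J (closest_point M (l t))) t = k t"
    using iffD2[OF eventually_eventually ev] ev
  proof eventually_elim
    case (elim t)
    have "((\<lambda>t. X (l t)) has_derivative (\<lambda>r. X' (l t) (r *\<^sub>R h))) (at t)"
      by (rule has_derivative_compose[OF dl]) (use elim(2) in simp)
    then have "((\<lambda>t. L (X (l t))) has_derivative (\<lambda>r. L' (X (l t)) (X' (l t) (r *\<^sub>R h)))) (at t)"
      by (rule has_derivative_compose) (use elim(2) in simp)
    moreover have "linear (X' (l t))" using elim(2) has_derivative_bounded_linear bounded_linear.linear by blast
    ultimately have "((\<lambda>t. L (X (l t))) has_real_derivative k t) (at t)"
      by (simp add: has_field_derivative_def k_def linear_scale blinfun.scaleR_right mult_commute_abs)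
    moreover have "\<forall>\<^sub>F t in nhds t. J (closest_point M (l t)) = L (X (l t))"
      using elim(1) by eventually_elim simp
    ultimately have "((\<lambda>t. J (closest_point M (l t))) has_real_derivative k t) (at t)"
      by (simp add: DERIV_cong_ev)
    then show ?case by (rule DERIV_imp_deriv)
  qed
  then have "deriv (deriv (\<lambda>t. J (closest_point M (l t)))) 0 = deriv k 0"
    by (rule deriv_cong_ev) simp
  also have "\<dots> = B a a"
  proof (rule DERIV_imp_deriv)
    have dX0: "(X has_derivative X' x) (at x)" using eventually_nhds_x_imp_x[OF X] by blast
    have "((\<lambda>t. X (l t)) has_derivative (\<lambda>r. X' x (r *\<^sub>R h))) (at 0)"
      using has_derivative_compose[OF dl[of 0], of X "X' x"] dX0 by (simp add: l0)
    then have "((\<lambda>t. L' (X (l t))) has_derivative (\<lambda>r. B (X' x (r *\<^sub>R h)))) (at 0)"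
      using has_derivative_compose[of "\<lambda>t. X (l t)" _ 0 UNIV L' "blinfun_apply B"] L2 by (simp add: l0 Xx)
    moreover have "linear (X' x)" using dX0 has_derivative_bounded_linear bounded_linear.linear by blast
    ultimately have Q: "((\<lambda>t. L' (X (l t))) has_vector_derivative B (X' x h)) (at 0)"
      by (simp add: has_vector_derivative_def linear_scale blinfun.scaleR_right)
    have "isCont (\<lambda>t. X' (l t) h) 0" by (rule isCont_o2[OF cl]) (simp add: l0 contX')
    from has_real_derivative_apply_vanishing[OF Q this]
    have "(k has_real_derivative B (X' x h) (X' (l 0) h)) (at 0)"
      unfolding k_def[abs_def] by (simp add: l0 Xx van X'S)
    then show "(k has_real_derivative B a a) (at 0)" using X'a[OF a] by (simp add: l0 h_def)
  qed
  finally show ?thesis by (simp add: l_def h_def)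
qed

end

section \<open>Riemannian Hessian and partial smoothness\<close>

text \<open>Polarization at a single vector: expanding the form at \<open>g + D g\<close> leaves
  twice the squared norm of \<open>D g\<close>. This is the uniqueness behind the definite
  description \<open>riem_hess\<close>.\<close>

lemma symmetric_form_zero:
  fixes D :: "'a::euclidean_space \<Rightarrow> 'a"
  assumes T: "subspace T" and lin: "linear D"
    and mem: "\<And>h. h \<in> T \<Longrightarrow> D h \<in> T" and orth: "\<And>h. h \<in> orthogonal_comp T \<Longrightarrow> D h = 0"
    and sym: "\<And>g h. g \<in> T \<Longrightarrow> h \<in> T \<Longrightarrow> D g \<bullet> h = g \<bullet> D h"
    and quad: "\<And>h. h \<in> T \<Longrightarrow> D h \<bullet> h = 0"
  shows "D = (\<lambda>_. 0)"
proof
  fix y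
  have z: "D g = 0" if g: "g \<in> T" for g
  proof -
    have Dg: "D g \<in> T" using mem g by blast
    have "D (g + D g) \<bullet> (g + D g) = 0" using quad subspace_add[OF T g Dg] by blast
    then have "2 * (D g \<bullet> D g) = 0"
      using sym[OF g Dg] quad[OF g] quad[OF Dg]
      by (simp add: linear_add[OF lin] inner_add_left inner_add_right inner_commute)
    then show ?thesis by simp
  qed
  have "y - orth_proj T y \<in> orthogonal_comp T"
    using orth_proj_orthogonal[OF T] by (auto simp: orthogonal_comp_def orthogonal_def inner_commute)
  then have "D (orth_proj T y + (y - orth_proj T y)) = 0"
    using z orth orth_proj_mem[OF T] by (subst linear_add[OF lin]) simp
  then show "D y = 0" by simp
qed

lemma riem_hess_eqI:
  assumes T: "subspace (tangent_space M x)" and lin: "linear A"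
    and mem: "\<And>h. h \<in> tangent_space M x \<Longrightarrow> A h \<in> tangent_space M x"
    and orth: "\<And>h. h \<in> orthogonal_comp (tangent_space M x) \<Longrightarrow> A h = 0"
    and sym: "\<And>g h. g \<in> tangent_space M x \<Longrightarrow> h \<in> tangent_space M x \<Longrightarrow> A g \<bullet> h = g \<bullet> A h"
    and quad: "\<And>h. h \<in> tangent_space M x \<Longrightarrow>
      A h \<bullet> h = deriv (deriv (\<lambda>t. J (closest_point M (x + t *\<^sub>R h)))) 0"
  shows "riem_hess M J x = A"
  unfolding riem_hess_def
proof (rule the_equality)
  show "linear A \<and> (\<forall>h\<in>tangent_space M x. A h \<in> tangent_space M x) \<and>
     (\<forall>h\<in>orthogonal_comp (tangent_space M x). A h = 0) \<and>
     (\<forall>g\<in>tangent_space M x. \<forall>h\<in>tangent_space M x. A g \<bullet> h = g \<bullet> A h) \<and>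
     (\<forall>h\<in>tangent_space M x. A h \<bullet> h = deriv (deriv (\<lambda>t. J (closest_point M (x + t *\<^sub>R h)))) 0)"
    using lin mem orth sym quad by blast
next
  fix A'
  assume A': "linear A' \<and> (\<forall>h\<in>tangent_space M x. A' h \<in> tangent_space M x) \<and>
     (\<forall>h\<in>orthogonal_comp (tangent_space M x). A' h = 0) \<and>
     (\<forall>g\<in>tangent_space M x. \<forall>h\<in>tangent_space M x. A' g \<bullet> h = g \<bullet> A' h) \<and>
     (\<forall>h\<in>tangent_space M x. A' h \<bullet> h = deriv (deriv (\<lambda>t. J (closest_point M (x + t *\<^sub>R h)))) 0)"
  have "(\<lambda>h. A' h - A h) = (\<lambda>_. 0)"
  proof (rule symmetric_form_zero[OF T])
    show "linear (\<lambda>h. A' h - A h)" using A' lin by (intro linear_compose_sub) auto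
    show "A' h - A h \<in> tangent_space M x" if "h \<in> tangent_space M x" for h
      using A' mem that T by (intro subspace_diff) auto
    show "A' h - A h = 0" if "h \<in> orthogonal_comp (tangent_space M x)" for h
      using A' orth that by auto
    show "(A' g - A g) \<bullet> h = g \<bullet> (A' h - A h)"
      if "g \<in> tangent_space M x" "h \<in> tangent_space M x" for g h
      using A' sym that by (simp add: inner_diff_left inner_diff_right)
    show "(A' h - A h) \<bullet> h = 0" if h: "h \<in> tangent_space M x" for h
    proof -
      have "A' h \<bullet> h = A h \<bullet> h" unfolding quad[OF h] using A' h by blast
      then show ?thesis by (simp add: inner_diff_left)
    qed
  qed
  then show "A' = A" by (auto simp: fun_eq_iff)
qed

text \<open>A halfspace with \<open>X0\<close> on its boundary is a cone with apex \<open>X0\<close>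
  and is preserved by dilation; one with \<open>X0\<close> in its interior contains the dilated
  points near \<open>X0\<close>. Finitely many halfspaces allow one common neighbourhood.\<close>

lemma polyhedron_local_dilation:
  fixes P :: "'a::euclidean_space set"
  assumes P: "polyhedron P" and X0: "X0 \<in> P"
  shows "\<forall>\<^sub>F X in nhds X0. X \<in> P \<longrightarrow> X0 + 2 *\<^sub>R (X - X0) \<in> P"
proof -
  obtain H where H: "finite H" "P = \<Inter>H" "\<And>h. h \<in> H \<Longrightarrow> \<exists>a b. a \<noteq> 0 \<and> h = {x. a \<bullet> x \<le> b}"
    using P unfolding polyhedron_def by blast
  have "\<forall>h\<in>H. \<forall>\<^sub>F X in nhds X0. X \<in> h \<longrightarrow> X0 + 2 *\<^sub>R (X - X0) \<in> h"
  proof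
    fix h assume h: "h \<in> H"
    then obtain a b where ab: "h = {x. a \<bullet> x \<le> b}" using H(3) by blast
    have "a \<bullet> X0 \<le> b" using X0 H(2) h ab by blast
    then consider "a \<bullet> X0 = b" | "a \<bullet> X0 < b" by linarith
    then show "\<forall>\<^sub>F X in nhds X0. X \<in> h \<longrightarrow> X0 + 2 *\<^sub>R (X - X0) \<in> h"
    proof cases
      case 1
      then show ?thesis by (auto simp: ab inner_add_right inner_diff_right intro!: always_eventually)
    next
      case 2
      have "((\<lambda>X. a \<bullet> (X0 + 2 *\<^sub>R (X - X0))) \<longlongrightarrow> a \<bullet> (X0 + 2 *\<^sub>R (X0 - X0))) (nhds X0)"
        by (intro tendsto_inner tendsto_add tendsto_scaleR tendsto_diff tendsto_const filterlim_ident)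
      then have "\<forall>\<^sub>F X in nhds X0. a \<bullet> (X0 + 2 *\<^sub>R (X - X0)) < b"
        using 2 by (intro order_tendstoD(2)) simp_all
      then show ?thesis by eventually_elim (simp add: ab)
    qed
  qed
  then have "\<forall>\<^sub>F X in nhds X0. \<forall>h\<in>H. X \<in> h \<longrightarrow> X0 + 2 *\<^sub>R (X - X0) \<in> h"
    using H(1) by (intro eventually_ball_finite) auto
  then show ?thesis by eventually_elim (auto simp: H(2))
qed

text \<open>Dilating the epigraph point over \<open>y k\<close> by 2 about the one over
  \<open>x\<close> bounds \<open>R\<close> at \<open>x + 2 *\<^sub>R (y k - x)\<close> by linear
  extrapolation, and the subgradient \<open>v k\<close> gives a lower bound at the same point.
  Together they force \<open>R (y k) - R x = v k \<bullet> (y k - x)\<close>, so \<open>v k\<close>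
  is also a subgradient at \<open>x\<close>.\<close>

lemma locally_polyhedral_identification:
  fixes R :: "'a::euclidean_space \<Rightarrow> ereal"
  assumes proper: "proper_fun R" and poly: "locally_polyhedral R x"
    and ri: "v0 \<in> rel_interior (subdiff R x)"
    and y: "(y \<longlongrightarrow> x) F" and v: "(v \<longlongrightarrow> v0) F"
    and sub: "\<forall>\<^sub>F k in F. v k \<in> subdiff R (y k)"
  shows "\<forall>\<^sub>F k in F. y k - x \<in> tangent_model R x \<and> (\<forall>t\<in>tangent_model R x. (v k - v0) \<bullet> t = 0)
    \<and> real_of_ereal (R (y k)) - real_of_ereal (R x) = v k \<bullet> (y k - x)"
proof -
  have v0: "v0 \<in> subdiff R x" using ri rel_interior_subset by blast
  obtain p where p: "polyhedral_fun p" "\<forall>\<^sub>F y in nhds x. R y = p y"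
    using poly by (auto simp: locally_polyhedral_def)
  define P where "P = {(y, t::real). p y \<le> ereal t}"
  have P: "polyhedron P" using p(1) by (simp add: polyhedral_fun_def P_def)
  define r where "r y = real_of_ereal (R y)" for y
  have fx: "\<bar>R x\<bar> \<noteq> \<infinity>" using subdiff_finite[OF proper v0] .
  have Rx: "R x = ereal (r x)" using fx by (simp add: r_def ereal_real)
  have X0: "(x, r x) \<in> P" using eventually_nhds_x_imp_x[OF p(2)] Rx by (simp add: P_def)
  have bnd: "\<forall>\<^sub>F k in F. r x + v0 \<bullet> (y k - x) \<le> r (y k) \<and> r (y k) \<le> r x + v k \<bullet> (y k - x)"
    using sub
  proof eventually_elim
    case (elim k)
    have fy: "\<bar>R (y k)\<bar> \<noteq> \<infinity>" using subdiff_finite[OF proper elim] .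
    show ?case
      using subdiff_ineq_real[OF proper v0 fy] subdiff_ineq_real[OF proper elim fx]
      by (simp add: r_def inner_diff_right)
  qed
  have lim: "((\<lambda>k. r x + v k \<bullet> (y k - x)) \<longlongrightarrow> r x + v0 \<bullet> (x - x)) F"
    "((\<lambda>k. r x + v0 \<bullet> (y k - x)) \<longlongrightarrow> r x + v0 \<bullet> (x - x)) F"
    by (intro tendsto_add tendsto_inner tendsto_diff tendsto_const v y)+
  have "((\<lambda>k. r (y k)) \<longlongrightarrow> r x) F"
  proof (rule tendsto_sandwich)
    show "\<forall>\<^sub>F k in F. r x + v0 \<bullet> (y k - x) \<le> r (y k)" using bnd by eventually_elim simp
    show "\<forall>\<^sub>F k in F. r (y k) \<le> r x + v k \<bullet> (y k - x)" using bnd by eventually_elim simp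
  qed (use lim in simp_all)
  then have "((\<lambda>k. (y k, r (y k))) \<longlongrightarrow> (x, r x)) F" by (intro tendsto_Pair y)
  note dil = eventually_compose_filterlim[OF polyhedron_local_dilation[OF P X0] this]
  have "((\<lambda>k. x + 2 *\<^sub>R (y k - x)) \<longlongrightarrow> x + 2 *\<^sub>R (x - x)) F"
    by (intro tendsto_add tendsto_scaleR tendsto_diff tendsto_const y)
  then have "((\<lambda>k. x + 2 *\<^sub>R (y k - x)) \<longlongrightarrow> x) F" by simp
  note p2 = eventually_compose_filterlim[OF p(2) this]
  \<comment> \<open>A relative interior is open only inside the affine hull. Membership in
    \<open>T\<close> holds eventually, and the affine hull is reached once \<open>v k\<close> is
    known to be a subgradient at \<open>x\<close>.\<close>
  obtain T where T: "open T" "rel_interior (subdiff R x) = affine hull (subdiff R x) \<inter> T"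
    using openin_rel_interior[of "subdiff R x"] unfolding openin_open by blast
  have "\<forall>\<^sub>F k in F. v k \<in> T" using topological_tendstoD[OF v T(1)] ri T(2) by blast
  with sub bnd dil p2 eventually_compose_filterlim[OF p(2) y] show ?thesis
  proof eventually_elim
    case (elim k)
    have Ry: "R (y k) = ereal (r (y k))"
      using subdiff_finite[OF proper elim(1)] by (simp add: r_def ereal_real)
    have "(y k, r (y k)) \<in> P" using elim(5) Ry by (simp add: P_def)
    then have "p (x + 2 *\<^sub>R (y k - x)) \<le> ereal (r x + 2 * (r (y k) - r x))"
      using elim(3) by (simp add: P_def)
    then have le: "R (x + 2 *\<^sub>R (y k - x)) \<le> ereal (r x + 2 * (r (y k) - r x))"
      using elim(4) by simp
    have "R (y k) + ereal (v k \<bullet> ((x + 2 *\<^sub>R (y k - x)) - y k)) \<le> R (x + 2 *\<^sub>R (y k - x))"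
      using elim(1) by (auto simp: subdiff_def)
    from order_trans[OF this le] have "ereal (r (y k) + v k \<bullet> ((x + 2 *\<^sub>R (y k - x)) - y k)) \<le> ereal (r x + 2 * (r (y k) - r x))"
      using Ry by simp
    moreover have "(x + 2 *\<^sub>R (y k - x)) - y k = y k - x" by (simp add: scaleR_2)
    ultimately have eq: "r (y k) - r x = v k \<bullet> (y k - x)" using elim(2) by simp
    have vx: "v k \<in> subdiff R x"
      unfolding subdiff_def
    proof (intro CollectI allI)
      fix w
      have "R (y k) + ereal (v k \<bullet> (w - y k)) \<le> R w" using elim(1) by (auto simp: subdiff_def)
      moreover have "r (y k) + v k \<bullet> (w - y k) = r x + v k \<bullet> (w - x)"
        using eq by (simp add: inner_diff_right)
      ultimately show "R x + ereal (v k \<bullet> (w - x)) \<le> R w" using Ry Rx by simp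
    qed
    then have vri: "v k \<in> rel_interior (subdiff R x)" using T(2) elim(6) hull_inc[OF vx] by simp
    have "y k - x \<in> orthogonal_comp (par (subdiff R x))"
    proof (rule orthogonal_par_if_max_rel_interior[OF vri])
      fix w assume "w \<in> subdiff R x"
      then have "r x + w \<bullet> (y k - x) \<le> r (y k)"
        using subdiff_ineq_real[OF proper, of w x "y k"] subdiff_finite[OF proper elim(1)] by (simp add: r_def)
      then show "w \<bullet> (y k - x) \<le> v k \<bullet> (y k - x)" using eq by simp
    qed
    moreover have "(v k - v0) \<bullet> t = 0" if "t \<in> tangent_model R x" for t
      using that diff_mem_par[OF vx v0] by (auto simp: tangent_model_def orthogonal_comp_def orthogonal_def)
    ultimately show ?case using eq by (simp add: tangent_model_def r_def)
  qed
qed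

text \<open>\<open>L\<close> is the function \<open>\<gamma> R - \<langle>\<cdot>, \<gamma> v0\<rangle>\<close> read in the chart; the last assumption makes
  \<open>\<phi> x\<close> a critical point of it along \<open>S\<close>.\<close>

locale partly_smooth_chart = slice_chart M U W S \<phi> \<psi> \<phi>' \<psi>' \<phi>'' \<psi>'' x
  for M U W S :: "'a::euclidean_space set" and \<phi> \<psi> \<phi>' \<psi>' \<phi>'' \<psi>'' x +
  fixes R :: "'a \<Rightarrow> ereal" and L :: "'a \<Rightarrow> real" and L' :: "'a \<Rightarrow> 'a \<Rightarrow>\<^sub>L real" and B :: "'a \<Rightarrow>\<^sub>L 'a \<Rightarrow>\<^sub>L real"
    and \<gamma> :: real and v0 :: 'a
  assumes proper: "proper_fun R" and gam: "\<gamma> > 0"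
    and L1: "\<forall>\<^sub>F s in nhds (\<phi> x). (L has_derivative blinfun_apply (L' s)) (at s)"
    and L2: "(L' has_derivative blinfun_apply B) (at (\<phi> x))"
    and L3: "\<forall>\<^sub>F s in nhds (\<phi> x). s \<in> S \<longrightarrow> \<bar>R (\<psi> s)\<bar> \<noteq> \<infinity> \<and>
      \<gamma> * real_of_ereal (R (\<psi> s)) - \<psi> s \<bullet> (\<gamma> *\<^sub>R v0) = L s"
    and tangent: "tangent_space M x = tangent_model R x"
    and set_cont: "set_continuous_rel (subdiff R) x M"
    and ri: "v0 \<in> rel_interior (subdiff R x)"
begin

lemma v0_subdiff: "v0 \<in> subdiff R x" using ri rel_interior_subset by blast

text \<open>This becomes \<open>Rbar\<close> when \<open>v0\<close> is the subgradient from the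
  nondegeneracy condition, since then \<open>\<gamma> *\<^sub>R v0 = xs - zs - \<gamma> *\<^sub>R
  grad G xs\<close>.\<close>

definition "J y = \<gamma> * real_of_ereal (R y) - y \<bullet> (\<gamma> *\<^sub>R v0)"

text \<open>By the subgradient inequality
  \<open>L - (\<gamma> *\<^sub>R (v - v0)) \<bullet> \<psi>\<close> restricted to a line in
  \<open>S\<close> has a local minimum at \<open>s\<close>, so its derivative vanishes. In
  particular all subgradients at a point of \<open>M\<close> near \<open>x\<close> agree on tangent
  directions.\<close>

lemma chart_derivative:
  "\<forall>\<^sub>F s in nhds (\<phi> x). s \<in> S \<longrightarrow> (\<forall>v\<in>subdiff R (\<psi> s). \<forall>h\<in>S. L' s h = (\<gamma> *\<^sub>R (v - v0)) \<bullet> \<psi>' s h)"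
  using iffD2[OF eventually_eventually L3] L1 eventually_nhds_in_open[OF W base_mem(1)]
proof eventually_elim
  case (elim s)
  show ?case
  proof (intro impI ballI)
    fix v h assume sS: "s \<in> S" and v: "v \<in> subdiff R (\<psi> s)" and h: "h \<in> S"
    define l where "l t = s + t *\<^sub>R h" for t
    have lS: "l t \<in> S" for t using S sS h by (simp add: l_def subspace_add subspace_scale)
    have dl: "(l has_derivative (\<lambda>t. t *\<^sub>R h)) (at 0)"
      unfolding l_def[abs_def] by (auto intro!: derivative_eq_intros)
    have l0: "l 0 = s" by (simp add: l_def)
    have "isCont l 0" using dl has_derivative_continuous by blast
    then have liml: "filterlim l (nhds s) (nhds 0)"
      using tendsto_at_iff_tendsto_nhds[of l 0] by (simp add: isCont_def l0)
    define k where "k t = L (l t) - (\<gamma> *\<^sub>R (v - v0)) \<bullet> \<psi> (l t)" for t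
    have "((\<lambda>t. L (l t)) has_derivative (\<lambda>t. L' s (t *\<^sub>R h))) (at 0)"
      by (rule has_derivative_compose[OF dl]) (use elim(2) in \<open>simp add: l0\<close>)
    moreover have "((\<lambda>t. \<psi> (l t)) has_derivative (\<lambda>t. \<psi>' s (t *\<^sub>R h))) (at 0)"
      by (rule has_derivative_compose[OF dl]) (use psi1[OF elim(3)] in \<open>simp add: l0\<close>)
    ultimately have "(k has_derivative (\<lambda>t. L' s (t *\<^sub>R h) - (\<gamma> *\<^sub>R (v - v0)) \<bullet> \<psi>' s (t *\<^sub>R h))) (at 0)"
      unfolding k_def[abs_def] by (intro has_derivative_diff has_derivative_inner_right)
    moreover have "(\<lambda>t. L' s (t *\<^sub>R h) - (\<gamma> *\<^sub>R (v - v0)) \<bullet> \<psi>' s (t *\<^sub>R h))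
        = (*) (L' s h - (\<gamma> *\<^sub>R (v - v0)) \<bullet> \<psi>' s h)"
      by (simp add: fun_eq_iff blinfun.scaleR_right algebra_simps)
    ultimately have dk: "(k has_real_derivative L' s h - (\<gamma> *\<^sub>R (v - v0)) \<bullet> \<psi>' s h) (at 0)"
      by (simp add: has_field_derivative_def)
    have J0: "\<bar>R (\<psi> s)\<bar> \<noteq> \<infinity>" "\<gamma> * real_of_ereal (R (\<psi> s)) - \<psi> s \<bullet> (\<gamma> *\<^sub>R v0) = L s"
      using eventually_nhds_x_imp_x[OF elim(1)] sS by auto
    have "\<forall>\<^sub>F t in nhds 0. k 0 \<le> k t"
      using eventually_compose_filterlim[OF elim(1) liml]
    proof eventually_elim
      case (elim t)
      then have e: "\<bar>R (\<psi> (l t))\<bar> \<noteq> \<infinity>" "\<gamma> * real_of_ereal (R (\<psi> (l t))) - \<psi> (l t) \<bullet> (\<gamma> *\<^sub>R v0) = L (l t)"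
        using lS by auto
      have "\<gamma> * (real_of_ereal (R (\<psi> s)) + v \<bullet> (\<psi> (l t) - \<psi> s)) \<le> \<gamma> * real_of_ereal (R (\<psi> (l t)))"
        using subdiff_ineq_real[OF proper v e(1)] gam by simp
      then show ?case using e(2) J0(2)
        by (simp add: k_def l0 algebra_simps inner_commute)
    qed
    then obtain d where d: "d > 0" "\<forall>t. \<bar>0 - t\<bar> < d \<longrightarrow> k 0 \<le> k t"
      unfolding eventually_nhds_metric by (auto simp: dist_real_def)
    have "L' s h - (\<gamma> *\<^sub>R (v - v0)) \<bullet> \<psi>' s h = 0" by (rule DERIV_local_min[OF dk d])
    then show "L' s h = (\<gamma> *\<^sub>R (v - v0)) \<bullet> \<psi>' s h" by simp
  qed
qed

lemma critical: "a \<in> S \<Longrightarrow> L' (\<phi> x) a = 0"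
  using eventually_nhds_x_imp_x[OF chart_derivative] base_mem v0_subdiff inv[OF xU] by fastforce

lemma B_symmetric: "B a b = B b a"
  by (rule second_derivative_symmetric[OF L1 L2])

text \<open>As \<open>v0\<close> is a subgradient, \<open>L\<close> is minimal at
  \<open>\<phi> x\<close> among nearby points of \<open>S\<close>. A negative \<open>B a a\<close>
  would make the derivative along \<open>a\<close> negative just after the base point, and the mean
  value theorem would produce a smaller value.\<close>

lemma B_nonneg:
  assumes a: "a \<in> S"
  shows "B a a \<ge> 0"
proof (rule ccontr)
  assume "\<not> B a a \<ge> 0"
  then have neg: "B a a < 0" by simp
  define l where "l t = \<phi> x + t *\<^sub>R a" for t
  have lS: "l t \<in> S" for t using S base_mem a by (simp add: l_def subspace_add subspace_scale)
  have dl: "(l has_derivative (\<lambda>t. t *\<^sub>R a)) (at t)" for t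
    unfolding l_def[abs_def] by (auto intro!: derivative_eq_intros)
  have l0: "l 0 = \<phi> x" by (simp add: l_def)
  have "isCont l 0" using dl has_derivative_continuous by blast
  then have liml: "filterlim l (nhds (\<phi> x)) (nhds 0)"
    using tendsto_at_iff_tendsto_nhds[of l 0] by (simp add: isCont_def l0)
  have "((\<lambda>t. L' (l t)) has_derivative (\<lambda>t. B (t *\<^sub>R a))) (at 0)"
    by (rule has_derivative_compose[OF dl]) (use L2 in \<open>simp add: l0\<close>)
  from bounded_linear.has_derivative[OF blinfun.bounded_linear_left this, of a]
  have "((\<lambda>t. L' (l t) a) has_derivative (*) (B a a)) (at 0)"
    by (simp add: blinfun.bilinear_simps mult_commute_abs)
  then have "((\<lambda>t. L' (l t) a) has_real_derivative B a a) (at 0)"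
    by (simp add: has_field_derivative_def)
  from DERIV_neg_dec_right[OF this neg] obtain d1 where d1: "d1 > 0"
    "\<And>h. h > 0 \<Longrightarrow> h < d1 \<Longrightarrow> L' (l h) a < 0"
    using critical[OF a] by (auto simp: l0)
  obtain d2 where d2: "d2 > 0" "\<And>t. \<bar>t\<bar> < d2 \<Longrightarrow> (L has_derivative L' (l t)) (at (l t))"
    "\<And>t. \<bar>t\<bar> < d2 \<Longrightarrow> \<bar>R (\<psi> (l t))\<bar> \<noteq> \<infinity> \<and> \<gamma> * real_of_ereal (R (\<psi> (l t))) - \<psi> (l t) \<bullet> (\<gamma> *\<^sub>R v0) = L (l t)"
    using eventually_conj[OF eventually_compose_filterlim[OF L1 liml] eventually_compose_filterlim[OF L3 liml]] lS
    unfolding eventually_nhds_metric by (auto simp: dist_real_def)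
  define t where "t = min d1 d2 / 2"
  have t: "0 < t" "t < d1" "t < d2" using d1(1) d2(1) by (auto simp: t_def)
  have "((\<lambda>t. L (l t)) has_real_derivative L' (l r) a) (at r)" if "0 \<le> r" "r \<le> t" for r
  proof -
    have "((\<lambda>t. L (l t)) has_derivative (\<lambda>u. L' (l r) (u *\<^sub>R a))) (at r)"
      by (rule has_derivative_compose[OF dl]) (use d2(2)[of r] that t in simp)
    then show ?thesis by (simp add: has_field_derivative_def blinfun.scaleR_right mult_commute_abs)
  qed
  then obtain z where z: "0 < z" "z < t" "L (l t) - L (l 0) = (t - 0) * L' (l z) a"
    using MVT2[OF t(1), of "\<lambda>t. L (l t)" "\<lambda>r. L' (l r) a"] by blast
  have "t * L' (l z) a < 0" using d1(2)[of z] z t by (simp add: mult_pos_neg)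
  then have "L (l t) < L (l 0)" using z(3) by simp
  moreover have "\<gamma> * (real_of_ereal (R x) + v0 \<bullet> (\<psi> (l t) - x)) \<le> \<gamma> * real_of_ereal (R (\<psi> (l t)))"
    using subdiff_ineq_real[OF proper v0_subdiff] d2(3)[of t] t gam by simp
  then have "L (l 0) \<le> L (l t)"
    using d2(3)[of t] d2(3)[of 0] t d2(1) inv[OF xU] by (simp add: l0 algebra_simps inner_commute)
  ultimately show False by simp
qed

section \<open>The Hessian as an operator on the ambient space\<close>

definition "PT = orth_proj (tangent_space M x)"
text \<open>The operator representing the form \<open>B\<close> transported by
  \<open>\<phi>' x\<close>. Projecting both arguments extends it by 0 off the tangent space, the
  normalization built into \<open>riem_hess\<close>.\<close>

definition "hess h = (\<Sum>b\<in>Basis. B (\<phi>' x (PT h)) (\<phi>' x (PT b)) *\<^sub>R b)"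

lemma subspace_tangent: "subspace (tangent_space M x)"
  unfolding tangent by (rule subspace_tangent_model)

lemma linear_PT: "linear PT" unfolding PT_def by (rule linear_orth_proj[OF subspace_tangent])
lemma PT_mem: "PT h \<in> tangent_space M x" unfolding PT_def by (rule orth_proj_mem[OF subspace_tangent])
lemma PT_id: "h \<in> tangent_space M x \<Longrightarrow> PT h = h" unfolding PT_def by (rule orth_proj_id[OF subspace_tangent])
lemma PT_sym: "PT h \<bullet> k = h \<bullet> PT k" unfolding PT_def by (rule orth_proj_sym[OF subspace_tangent])

lemma hess_inner: "hess h \<bullet> k = B (\<phi>' x (PT h)) (\<phi>' x (PT k))"
proof -
  have "B (\<phi>' x (PT h)) (\<phi>' x (PT k)) = B (\<phi>' x (PT h)) (\<phi>' x (PT (\<Sum>b\<in>Basis. (k \<bullet> b) *\<^sub>R b)))"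
    by (simp add: euclidean_representation)
  also have "\<dots> = (\<Sum>b\<in>Basis. (k \<bullet> b) * B (\<phi>' x (PT h)) (\<phi>' x (PT b)))"
    by (simp add: linear_sum[OF linear_PT] linear_scale[OF linear_PT] blinfun.sum_right blinfun.scaleR_right)
  also have "\<dots> = hess h \<bullet> k"
    unfolding hess_def inner_sum_left inner_scaleR_left by (simp add: inner_commute[of k] mult.commute)
  finally show ?thesis by simp
qed

lemma linear_hess: "linear hess"
proof (rule linearI)
  fix g h and r :: real
  show "hess (g + h) = hess g + hess h"
    by (rule vector_eq_rdot[THEN iffD1, OF allI])
      (simp add: hess_inner inner_add_left linear_add[OF linear_PT] blinfun.bilinear_simps)
  show "hess (r *\<^sub>R h) = r *\<^sub>R hess h"
    by (rule vector_eq_rdot[THEN iffD1, OF allI])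
      (simp add: hess_inner linear_scale[OF linear_PT] blinfun.bilinear_simps)
qed

lemma hess_PT: "hess (PT h) = hess h" by (simp add: hess_def PT_id PT_mem)

lemma hess_mem: "hess h \<in> tangent_space M x"
proof -
  have "PT (hess h) = hess h"
    by (rule vector_eq_rdot[THEN iffD1, OF allI]) (simp add: PT_sym hess_inner PT_id PT_mem)
  then show ?thesis using PT_mem by metis
qed

lemma hess_sym: "hess g \<bullet> h = g \<bullet> hess h"
  using B_symmetric by (simp add: hess_inner inner_commute[of g])

lemma hess_nonneg: "0 \<le> hess h \<bullet> h"
  by (simp add: hess_inner B_nonneg phi'_tangent PT_mem)

lemma riem_hess_eq: "riem_hess M J x = hess"
proof (rule riem_hess_eqI[OF subspace_tangent linear_hess hess_mem])
  show "hess h = 0" if "h \<in> orthogonal_comp (tangent_space M x)" for h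
  proof -
    have "PT h = 0" unfolding PT_def
      by (rule orth_proj_eqI[OF subspace_tangent subspace_0[OF subspace_tangent]])
        (use that in \<open>auto simp: orthogonal_comp_def orthogonal_def inner_commute\<close>)
    then show ?thesis by (simp add: hess_def blinfun.zero_right blinfun.zero_left)
  qed
  show "hess g \<bullet> h = g \<bullet> hess h" for g h by (rule hess_sym)
  fix h assume "h \<in> tangent_space M x"
  then obtain a where a: "a \<in> S" "h = \<psi>' (\<phi> x) a" by (auto simp: tangent_space_eq)
  have J: "\<forall>\<^sub>F s in nhds (\<phi> x). s \<in> S \<longrightarrow> J (\<psi> s) = L s"
    using L3 by eventually_elim (simp add: J_def)
  have "deriv (deriv (\<lambda>t. J (closest_point M (x + t *\<^sub>R h)))) 0 = B a a"
    unfolding a(2) by (rule deriv_deriv_closest_point[OF L1 L2 _ J a(1)]) (rule critical)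
  moreover have "\<phi>' x (PT h) = a"
    using \<open>h \<in> tangent_space M x\<close> a phi'_psi'[OF base_mem(1)] inv[OF xU] by (simp add: PT_id)
  ultimately show "hess h \<bullet> h = deriv (deriv (\<lambda>t. J (closest_point M (x + t *\<^sub>R h)))) 0"
    by (simp add: hess_inner)
qed

text \<open>Normality passes to the limit because \<open>\<psi>'\<close> is continuous, and
  \<open>tangent\<close> identifies the normal space at \<open>x\<close> with the space parallel to
  the subdifferential.\<close>

lemma normal_vector_limit:
  assumes q: "q \<longlonglongrightarrow> x" and n: "n \<longlonglongrightarrow> nu"
    and orth: "\<And>k h. h \<in> S \<Longrightarrow> n k \<bullet> \<psi>' (\<phi> (q k)) h = 0"
  shows "nu \<in> par (subdiff R x)"
proof -
  have "isCont \<phi> x" using phi1[OF xU] has_derivative_continuous by blast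
  then have "(\<lambda>k. \<phi> (q k)) \<longlonglongrightarrow> \<phi> x" using q by (rule isCont_tendsto_compose)
  moreover have "isCont \<psi>' (\<phi> x)" using psi2[OF base_mem(1)] has_derivative_continuous by blast
  ultimately have lim: "(\<lambda>k. \<psi>' (\<phi> (q k))) \<longlonglongrightarrow> \<psi>' (\<phi> x)"
    by (rule isCont_tendsto_compose[rotated])
  have "tau \<bullet> nu = 0" if tau: "tau \<in> tangent_space M x" for tau
  proof -
    obtain h where h: "h \<in> S" "tau = \<psi>' (\<phi> x) h" using tau by (auto simp: tangent_space_eq)
    have "(\<lambda>k. n k \<bullet> \<psi>' (\<phi> (q k)) h) \<longlonglongrightarrow> nu \<bullet> \<psi>' (\<phi> x) h"
      by (rule tendsto_inner[OF n blinfun.tendsto[OF lim tendsto_const]])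
    then have "(\<lambda>k::nat. 0) \<longlonglongrightarrow> nu \<bullet> \<psi>' (\<phi> x) h" by (simp add: orth h(1))
    then show ?thesis using h(2) LIMSEQ_unique[OF _ tendsto_const] by (metis inner_commute)
  qed
  then have "nu \<in> orthogonal_comp (tangent_model R x)"
    by (auto simp: orthogonal_comp_def orthogonal_def tangent[symmetric])
  then show ?thesis
    using orthogonal_comp_self[OF subspace_par] v0_subdiff by (auto simp: tangent_model_def)
qed

text \<open>If the \<open>w k\<close> stayed off \<open>M\<close>, their normalized displacements from their projections \<open>q k\<close> would
  accumulate at a normal vector \<open>nu\<close>. Since \<open>v0\<close> is relatively interior, \<open>v0 + e nu\<close> is a subgradient at
  \<open>x\<close>, hence a limit of subgradients at the \<open>q k\<close>; monotonicity of the subdifferential is then violated.\<close>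

lemma identification:
  assumes w: "w \<longlonglongrightarrow> x" and v: "v \<longlonglongrightarrow> v0" and sub: "\<And>k. v k \<in> subdiff R (w k)"
  shows "\<forall>\<^sub>F k in sequentially. w k \<in> M"
proof (rule ccontr)
  assume c: "\<not> (\<forall>\<^sub>F k in sequentially. w k \<in> M)"
  \<comment> \<open>Nearest points are meaningful only near \<open>x\<close>. Combining this with
    membership in \<open>M\<close> lets one subsequence be chosen that is both good and off
    \<open>M\<close>.\<close>
  define good where "good y \<longleftrightarrow> closest_point M y \<in> M \<inter> U \<and> (\<forall>m\<in>M. dist y (closest_point M y) \<le> dist y m)" for y
  have gd: "\<forall>\<^sub>F k in sequentially. good (w k)"
    using eventually_compose_filterlim[OF closest_point_near w] by eventually_elim (auto simp: good_def)
  have "\<not> (\<forall>\<^sub>F k in sequentially. good (w k) \<longrightarrow> w k \<in> M)"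
  proof
    assume "\<forall>\<^sub>F k in sequentially. good (w k) \<longrightarrow> w k \<in> M"
    with gd have "\<forall>\<^sub>F k in sequentially. w k \<in> M" by eventually_elim simp
    with c show False by simp
  qed
  then obtain r :: "nat \<Rightarrow> nat" where r: "strict_mono r" "\<And>k. good (w (r k)) \<and> w (r k) \<notin> M"
    using not_eventually_sequentiallyD[of "\<lambda>k. good (w k) \<longrightarrow> w k \<in> M"] by blast
  define q where "q k = closest_point M (w (r k))" for k
  define n where "n k = (1 / norm (w (r k) - q k)) *\<^sub>R (w (r k) - q k)" for k
  have qM: "q k \<in> M" "q k \<in> U" "\<And>m. m \<in> M \<Longrightarrow> dist (w (r k)) (q k) \<le> dist (w (r k)) m" for k
    using r(2)[of k] by (auto simp: good_def q_def)
  have pos: "norm (w (r k) - q k) > 0" for k using qM(1)[of k] r(2)[of k] by auto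
  have wr: "(\<lambda>k. w (r k)) \<longlonglongrightarrow> x" using LIMSEQ_subseq_LIMSEQ[OF w r(1)] by (simp add: o_def)
  have q: "q \<longlonglongrightarrow> x" unfolding q_def by (rule filterlim_compose[OF closest_point_tendsto wr])
  have "n k \<in> sphere 0 1" for k using pos[of k] by (simp add: n_def)
  then obtain nu r' where nu: "nu \<in> sphere 0 1" "strict_mono r'" "(n \<circ> r') \<longlonglongrightarrow> nu"
    using compact_sphere[of "0::'a" 1] unfolding compact_eq_seq_compact_metric seq_compact_def by metis
  have "nu \<in> par (subdiff R x)"
  proof (rule normal_vector_limit)
    show "(q \<circ> r') \<longlonglongrightarrow> x" by (rule LIMSEQ_subseq_LIMSEQ[OF q nu(2)])
    show "(n \<circ> r') k \<bullet> \<psi>' (\<phi> ((q \<circ> r') k)) h = 0" if "h \<in> S" for k h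
      using closest_normal[OF qM(1,2,3) that] by (simp add: n_def)
  qed (rule nu(3))
  then obtain e where e: "e > 0" "v0 + e *\<^sub>R nu \<in> subdiff R x"
    using rel_interior_push[OF ri] by blast
  moreover have "(\<forall>k. (q \<circ> r') k \<in> M) \<and> (q \<circ> r') \<longlonglongrightarrow> x"
    using qM(1) LIMSEQ_subseq_LIMSEQ[OF q nu(2)] by simp
  ultimately obtain om where om: "om \<longlonglongrightarrow> v0 + e *\<^sub>R nu" "\<forall>\<^sub>F k in sequentially. om k \<in> subdiff R ((q \<circ> r') k)"
    using set_cont unfolding set_continuous_rel_def by blast
  define rr where "rr = r \<circ> r'"
  have rr: "strict_mono rr" unfolding rr_def by (rule strict_mono_o[OF r(1) nu(2)])
  \<comment> \<open>As \<open>nu\<close> is a unit vector the limit is \<open>- e\<close>, while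
    monotonicity between \<open>w (rr k)\<close> and \<open>q (r' k)\<close>, after division by
    their distance, makes the terms eventually nonnegative.\<close>
  have "(\<lambda>k. (v (rr k) - om k) \<bullet> (n \<circ> r') k) \<longlonglongrightarrow> (v0 - (v0 + e *\<^sub>R nu)) \<bullet> nu"
    using LIMSEQ_subseq_LIMSEQ[OF v rr] om(1) nu(3) by (intro tendsto_intros) (simp add: o_def)
  moreover have "\<forall>\<^sub>F k in sequentially. 0 \<le> (v (rr k) - om k) \<bullet> (n \<circ> r') k"
    using om(2)
  proof eventually_elim
    case (elim k)
    have "0 \<le> (v (rr k) - om k) \<bullet> (w (rr k) - q (r' k))"
      using subdiff_monotone[OF proper sub] elim by (simp add: o_def)
    then show ?case by (simp add: n_def rr_def)
  qed
  ultimately have "0 \<le> (v0 - (v0 + e *\<^sub>R nu)) \<bullet> nu" by (intro tendsto_lowerbound) auto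
  moreover have "nu \<bullet> nu = 1" using nu(1) by (simp flip: power2_norm_eq_inner)
  ultimately show False using e(1) by simp
qed

text \<open>The tangent spaces along the sequence move, but no transport between them is needed: in
  the chart all test directions lie in the fixed subspace \<open>S\<close>, and \<open>L'\<close> is
  expanded there about a point where it vanishes on \<open>S\<close>. Replacing
  \<open>\<psi>' s\<close> by its value at the base point costs a small multiple of |rho|, which is
  why rho appears in the bound.\<close>

lemma tangential_expansion:
  fixes w v :: "'b \<Rightarrow> 'a"
  assumes w: "(w \<longlongrightarrow> x) F" and wM: "\<forall>\<^sub>F k in F. w k \<in> M"
    and sub: "\<forall>\<^sub>F k in F. v k \<in> subdiff R (w k)" and e: "e > 0"
  shows "\<forall>\<^sub>F k in F. norm (w k - x - PT (w k - x)) \<le> e * norm (w k - x) \<and>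
    norm (PT (\<gamma> *\<^sub>R (v k - v0)) - hess (w k - x)) \<le> e * (norm (w k - x) + norm (\<gamma> *\<^sub>R (v k - v0)))"
proof -
  define s0 where "s0 = \<phi> x"
  define C where "C = \<phi>' x"
  define c where "c = norm C"
  \<comment> \<open>\<open>K\<close> dominates the constants of both estimates, so one tolerance
    \<open>d\<close> serves for both. The cap \<open>d \<le> 1\<close> is what bounds the chart
    displacement by \<open>(c + 1)\<close> times |w k - x|.\<close>
  define K where "K = c * (norm B * (1 + c * (c + 1)) + c + 2) + c + 2"
  have c0: "c \<ge> 0" by (simp add: c_def)
  have K1: "K > 0" "K \<ge> c + 1" "K \<ge> c * (norm B * (1 + c * (c + 1)) + c + 2)"
    using c0 by (auto simp: K_def intro!: add_nonneg_pos add_nonneg_nonneg mult_nonneg_nonneg)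
  define d where "d = min 1 (e / K)"
  have d: "d > 0" "d \<le> 1" "d * K \<le> e" using e K1(1) by (auto simp: d_def min_def field_simps)
  have wU: "\<forall>\<^sub>F k in F. w k \<in> U" using topological_tendstoD[OF w U xU] .
  have cphi: "isCont \<phi> x" using phi1[OF xU] has_derivative_continuous by blast
  have lim: "((\<lambda>k. \<phi> (w k)) \<longlongrightarrow> s0) F"
    unfolding s0_def by (rule isCont_tendsto_compose[OF cphi w])
  have fine: "\<forall>\<^sub>F k in F. norm (f (y k) - f a - f' (y k - a)) \<le> d * norm (y k - a)"
    if df: "(f has_derivative f') (at a)" and y: "(y \<longlongrightarrow> a) F"
    for f :: "'c::real_normed_vector \<Rightarrow> 'd::real_normed_vector" and f' a y
  proof -
    obtain r where r: "r > 0" "\<And>y. norm (y - a) < r \<Longrightarrow> norm (f y - f a - f' (y - a)) \<le> d * norm (y - a)"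
      using conjunct2[OF iffD1[OF has_derivative_at_alt df]] d(1) by blast
    have "\<forall>\<^sub>F k in F. dist (y k) a < r" using y r(1) by (rule tendstoD)
    then show ?thesis by eventually_elim (simp add: r(2) dist_norm)
  qed
  have cpsi': "isCont \<psi>' s0" using psi2[OF base_mem(1)] has_derivative_continuous by (auto simp: s0_def)
  have "\<forall>\<^sub>F k in F. dist (\<psi>' (\<phi> (w k))) (\<psi>' s0) < d"
    by (rule tendstoD[OF isCont_tendsto_compose[OF cpsi' lim] d(1)])
  with wM sub wU fine[OF phi1[OF xU] w] fine[OF psi1[OF base_mem(1)] lim[unfolded s0_def]]
    fine[OF L2 lim[unfolded s0_def]] eventually_compose_filterlim[OF chart_derivative lim[unfolded s0_def]]
  show ?thesis
  proof eventually_elim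
    case (elim k)
    define s where "s = \<phi> (w k)"
    define ee where "ee = w k - x"
    define ka where "ka = s - s0"
    define rho where "rho = \<gamma> *\<^sub>R (v k - v0)"
    have sS: "s \<in> S" using elim(1,3) mem_M_iff by (simp add: s_def)
    have kaS: "ka \<in> S" using sS base_mem S by (simp add: ka_def s0_def subspace_diff)
    have 1: "norm (ka - C ee) \<le> d * norm ee" using elim(4) by (simp add: s_def ee_def ka_def s0_def C_def)
    have 2: "norm (ee - \<psi>' s0 ka) \<le> d * norm ka"
      using elim(5) inv[OF xU] inv[OF elim(3)] by (simp add: s_def ee_def ka_def s0_def)
    have 3: "norm (L' s - L' s0 - B ka) \<le> d * norm ka" using elim(6) by (simp add: s_def ka_def s0_def)
    have 4: "L' s h = rho \<bullet> \<psi>' s h" if "h \<in> S" for h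
      using elim(7) sS elim(2) inv[OF elim(3)] that by (simp add: s_def rho_def)
    have 5: "norm (\<psi>' s - \<psi>' s0) \<le> d" using elim(8) by (simp add: s_def dist_norm)
    have Cee: "norm (C u) \<le> c * norm u" for u unfolding c_def by (rule norm_blinfun)
    have "norm ka \<le> norm (C ee) + norm (ka - C ee)" by (rule norm_triangle_sub)
    also have "\<dots> \<le> c * norm ee + 1 * norm ee"
      by (intro add_mono Cee order_trans[OF 1] mult_right_mono d(2)) simp
    finally have ka: "norm ka \<le> (c + 1) * norm ee" by (simp add: distrib_right)
    have "\<psi>' s0 ka \<in> tangent_space M x" using kaS by (simp add: tangent_space_eq s0_def)
    then have "norm (ee - PT ee) \<le> norm (ee - \<psi>' s0 ka)"
      unfolding PT_def by (rule norm_diff_orth_proj_le[OF subspace_tangent])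
    also have "\<dots> \<le> d * ((c + 1) * norm ee)"
      by (intro order_trans[OF 2] mult_left_mono ka) (use d in simp)
    finally have P: "norm (ee - PT ee) \<le> d * ((c + 1) * norm ee)" .
    have "d * (c + 1) \<le> d * K" using K1(2) d(1) by (intro mult_left_mono) auto
    then have "d * (c + 1) * norm ee \<le> e * norm ee" using d(3) by (intro mult_right_mono) auto
    with P have first: "norm (ee - PT ee) \<le> e * norm ee" by (simp add: mult.assoc)
    \<comment> \<open>The error is tested against itself. Its chart coordinate \<open>h\<close> lies
      in \<open>S\<close>, so the derivative formula for \<open>L'\<close> applies to it.\<close>
    define tau where "tau = PT rho - hess ee"
    have tauT: "tau \<in> tangent_space M x"
      unfolding tau_def by (intro subspace_diff[OF subspace_tangent] PT_mem hess_mem)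
    define h where "h = C tau"
    have hS: "h \<in> S" unfolding h_def C_def by (rule phi'_tangent[OF tauT])
    have hD: "\<psi>' s0 h = tau" unfolding h_def C_def s0_def by (rule psi'_phi'[OF xU])
    have nh: "norm h \<le> c * norm tau" unfolding h_def by (rule Cee)
    define m where "m = ka - C (PT ee)"
    have "m = (ka - C ee) + C (ee - PT ee)" by (simp add: m_def blinfun.diff_right)
    then have "norm m \<le> norm (ka - C ee) + norm (C (ee - PT ee))" by (simp add: norm_triangle_ineq)
    also have "\<dots> \<le> d * norm ee + c * (d * ((c + 1) * norm ee))"
      by (intro add_mono 1 order_trans[OF Cee] mult_left_mono P c0)
    finally have m: "norm m \<le> d * (1 + c * (c + 1)) * norm ee" by (simp add: algebra_simps)
    have crit: "L' s0 h = 0" unfolding s0_def by (rule critical[OF hS])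
    have "tau \<bullet> tau = rho \<bullet> tau - B (C (PT ee)) h"
    proof -
      have "tau \<bullet> tau = PT rho \<bullet> tau - hess ee \<bullet> tau" by (simp add: tau_def inner_diff_left)
      also have "PT rho \<bullet> tau = rho \<bullet> tau" by (simp add: PT_sym PT_id tauT)
      also have "hess ee \<bullet> tau = B (C (PT ee)) h" by (simp add: hess_inner PT_id tauT h_def C_def)
      finally show ?thesis .
    qed
    \<comment> \<open>The three terms are the linearization error of \<open>L'\<close>, the gap
      between the chart displacement and its tangential prediction, and the change of
      \<open>\<psi>'\<close> along the sequence.\<close>
    also have "\<dots> = (L' s - L' s0 - B ka) h + B m h - rho \<bullet> (\<psi>' s - \<psi>' s0) h"
      using 4[OF hS] crit by (simp add: m_def blinfun.bilinear_simps hD inner_diff_right)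
    also have "\<dots> \<le> norm (L' s - L' s0 - B ka) * norm h + norm B * norm m * norm h + norm rho * (norm (\<psi>' s - \<psi>' s0) * norm h)"
    proof -
      have "(L' s - L' s0 - B ka) h \<le> norm (L' s - L' s0 - B ka) * norm h"
        using norm_blinfun[of "L' s - L' s0 - B ka" h] by simp
      moreover have "B m h \<le> norm B * norm m * norm h"
        using norm_blinfun[of "B m" h] mult_right_mono[OF norm_blinfun[of B m] norm_ge_zero[of h]] by simp
      moreover have "- (rho \<bullet> (\<psi>' s - \<psi>' s0) h) \<le> norm rho * norm ((\<psi>' s - \<psi>' s0) h)"
        using Cauchy_Schwarz_ineq2[of rho "(\<psi>' s - \<psi>' s0) h"] by linarith
      moreover have "norm rho * norm ((\<psi>' s - \<psi>' s0) h) \<le> norm rho * (norm (\<psi>' s - \<psi>' s0) * norm h)"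
        by (intro mult_left_mono norm_blinfun) simp
      ultimately show ?thesis by linarith
    qed
    also have "\<dots> = (norm (L' s - L' s0 - B ka) + norm B * norm m + norm rho * norm (\<psi>' s - \<psi>' s0)) * norm h"
      by (simp add: algebra_simps)
    also have "\<dots> \<le> (d * ((c + 1) * norm ee) + norm B * (d * (1 + c * (c + 1)) * norm ee) + norm rho * d) * (c * norm tau)"
      by (intro mult_mono nh add_mono order_trans[OF 3] mult_left_mono ka m 5)
        (use d c0 in \<open>auto intro!: add_nonneg_nonneg mult_nonneg_nonneg\<close>)
    finally have "tau \<bullet> tau \<le> (d * ((c + 1) * norm ee) + norm B * (d * (1 + c * (c + 1)) * norm ee) + norm rho * d) * (c * norm tau)" .
    then have "norm tau * norm tau \<le> (d * ((c + 1) * norm ee) + norm B * (d * (1 + c * (c + 1)) * norm ee) + norm rho * d) * c * norm tau"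
      by (simp add: mult.assoc flip: power2_norm_eq_inner power2_eq_square)
    then have "norm tau \<le> (d * ((c + 1) * norm ee) + norm B * (d * (1 + c * (c + 1)) * norm ee) + norm rho * d) * c"
    proof (cases "norm tau = 0")
      case True
      then show ?thesis using d c0 by (simp add: add_nonneg_nonneg)
    qed simp
    also have "\<dots> = d * (c * (norm B * (1 + c * (c + 1)) + c + 1) * norm ee + c * norm rho)"
      by (simp add: algebra_simps)
    also have "\<dots> \<le> d * (K * norm ee + K * norm rho)"
    proof (intro mult_left_mono add_mono mult_right_mono)
      have "c * (norm B * (1 + c * (c + 1)) + c + 1) \<le> c * (norm B * (1 + c * (c + 1)) + c + 2)"
        using c0 by (intro mult_left_mono) auto
      then show "c * (norm B * (1 + c * (c + 1)) + c + 1) \<le> K" using K1(3) by linarith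
      show "c \<le> K" using K1(2) by linarith
    qed (use d in auto)
    also have "\<dots> = (d * K) * (norm ee + norm rho)" by (simp add: algebra_simps)
    also have "\<dots> \<le> e * (norm ee + norm rho)" using d(3) by (intro mult_right_mono) auto
    finally show ?case using first by (simp add: tau_def ee_def rho_def)
  qed
qed

text \<open>Inner semicontinuity supplies, along any sequence of \<open>M\<close> tending to
  \<open>x\<close>, subgradients converging to \<open>v0\<close>. The polyhedral identification then
  gives \<open>R y - R x = v0 \<bullet> (y - x)\<close>, so \<open>J\<close> is constant on
  \<open>M\<close> near \<open>x\<close>, and so is \<open>J\<close> after projection onto
  \<open>M\<close>.\<close>

lemma polyhedral_hess_zero:
  assumes poly: "locally_polyhedral R x"
  shows "hess h = 0"
proof -
  have const: "\<forall>\<^sub>F y in nhds x. y \<in> M \<longrightarrow> J y = J x"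
  proof (rule ccontr)
    assume "\<not> ?thesis"
    then have "\<exists>y. dist y x < 1 / real (Suc n) \<and> y \<in> M \<and> J y \<noteq> J x" for n
      unfolding eventually_nhds_metric by (metis of_nat_0_less_iff zero_less_Suc zero_less_divide_1_iff)
    then obtain y where y: "\<And>n. dist (y n) x < 1 / real (Suc n) \<and> y n \<in> M \<and> J (y n) \<noteq> J x" by metis
    have "(\<lambda>n. dist (y n) x) \<longlonglongrightarrow> 0"
      by (rule tendsto_sandwich[OF _ _ tendsto_const lim_inverse_n'[THEN LIMSEQ_Suc]])
        (use y in \<open>auto intro!: always_eventually less_imp_le\<close>)
    then have lim: "y \<longlonglongrightarrow> x" by (rule tendsto_dist_iff[THEN iffD2])
    obtain v where v: "v \<longlonglongrightarrow> v0" "\<forall>\<^sub>F k in sequentially. v k \<in> subdiff R (y k)"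
      using set_cont v0_subdiff y lim unfolding set_continuous_rel_def by blast
    have "\<forall>\<^sub>F k in sequentially. J (y k) = J x"
      using locally_polyhedral_identification[OF proper poly ri lim v]
    proof eventually_elim
      case (elim k)
      then have "(v k - v0) \<bullet> (y k - x) = 0" by blast
      then have "real_of_ereal (R (y k)) - real_of_ereal (R x) = v0 \<bullet> (y k - x)"
        using elim by (simp add: inner_diff_left)
      then have "real_of_ereal (R (y k)) = real_of_ereal (R x) + v0 \<bullet> (y k - x)" by simp
      then show ?case unfolding J_def by (simp only:) (simp add: algebra_simps inner_commute)
    qed
    then show False using y by (simp add: eventually_sequentially)
  qed
  have ev: "\<forall>\<^sub>F y in nhds x. J (closest_point M y) = J x"
    using eventually_compose_filterlim[OF const closest_point_tendsto] closest_point_near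
    by eventually_elim blast
  have dd: "deriv (deriv (\<lambda>t. J (closest_point M (x + t *\<^sub>R h)))) 0 = 0" for h
  proof -
    have "((\<lambda>t. x + t *\<^sub>R h) \<longlongrightarrow> x + 0 *\<^sub>R h) (nhds 0)"
      by (intro tendsto_add tendsto_scaleR tendsto_const filterlim_ident)
    then have "\<forall>\<^sub>F t in nhds 0. J (closest_point M (x + t *\<^sub>R h)) = J x"
      using eventually_compose_filterlim[OF ev] by simp
    then have "\<forall>\<^sub>F t in nhds 0. \<forall>\<^sub>F r in nhds t. J (closest_point M (x + r *\<^sub>R h)) = J x"
      by (rule iffD2[OF eventually_eventually])
    then have "\<forall>\<^sub>F t in nhds 0. deriv (\<lambda>t. J (closest_point M (x + t *\<^sub>R h))) t = 0"
    proof eventually_elim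
      case (elim t)
      then have "deriv (\<lambda>t. J (closest_point M (x + t *\<^sub>R h))) t = deriv (\<lambda>t. J x) t"
        by (rule deriv_cong_ev) simp
      then show ?case by simp
    qed
    then have "deriv (deriv (\<lambda>t. J (closest_point M (x + t *\<^sub>R h)))) 0 = deriv (\<lambda>t. 0) (0::real)"
      by (rule deriv_cong_ev) simp
    then show ?thesis by simp
  qed
  have "riem_hess M J x = (\<lambda>_. 0)"
    by (rule riem_hess_eqI[OF subspace_tangent])
      (simp_all add: dd subspace_0[OF subspace_tangent] module_hom_zero)
  then show ?thesis using riem_hess_eq by metis
qed

end

lemma partly_smooth_chart_exists:
  fixes R :: "'a::euclidean_space \<Rightarrow> ereal"
  assumes proper: "proper_fun R" and gam: "\<gamma> > 0" and ps: "partly_smooth R x M"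
    and ri: "v0 \<in> rel_interior (subdiff R x)"
  obtains U W S \<phi> \<psi> \<phi>' \<psi>' \<phi>'' \<psi>'' L L' B
  where "partly_smooth_chart M U W S \<phi> \<psi> \<phi>' \<psi>' \<phi>'' \<psi>'' x R L L' B \<gamma> v0"
proof -
  have xM: "x \<in> M" and man: "C2_submanifold_around M x" and res: "C2_restricted_around M R x"
    and tan: "tangent_space M x = tangent_model R x" and sc: "set_continuous_rel (subdiff R) x M"
    using ps unfolding partly_smooth_def by blast+
  obtain U W S and \<phi> \<psi> :: "'a \<Rightarrow> 'a" where "open U \<and> x \<in> U \<and> open W \<and> subspace S \<and> C2_on U \<phi> \<and> C2_on W \<psi> \<and>
    \<phi> ` U = W \<and> (\<forall>y\<in>U. \<psi> (\<phi> y) = y) \<and> \<phi> ` (M \<inter> U) = S \<inter> W"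
    using man unfolding C2_submanifold_around_def by (elim exE)
  then have ch: "open U" "x \<in> U" "open W" "subspace S" "C2_on U \<phi>" "C2_on W \<psi>"
    "\<phi> ` U = W" "\<And>y. y \<in> U \<Longrightarrow> \<psi> (\<phi> y) = y" "\<phi> ` (M \<inter> U) = S \<inter> W"
    by blast+
  obtain \<phi>' \<phi>'' where phi: "\<And>y. y \<in> U \<Longrightarrow> (\<phi> has_derivative blinfun_apply (\<phi>' y)) (at y)"
    "\<And>y. y \<in> U \<Longrightarrow> (\<phi>' has_derivative blinfun_apply (\<phi>'' y)) (at y)" "continuous_on U \<phi>''"
    using ch(5) unfolding C2_on_def by blast
  obtain \<psi>' \<psi>'' where psi: "\<And>y. y \<in> W \<Longrightarrow> (\<psi> has_derivative blinfun_apply (\<psi>' y)) (at y)"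
    "\<And>y. y \<in> W \<Longrightarrow> (\<psi>' has_derivative blinfun_apply (\<psi>'' y)) (at y)" "continuous_on W \<psi>''"
    using ch(6) unfolding C2_on_def by blast
  have sl: "slice_chart M U W S \<phi> \<psi> \<phi>' \<psi>' \<phi>'' \<psi>'' x"
    by (rule slice_chart.intro[OF ch(1-4) xM phi psi ch(7-9)])
  interpret slice_chart M U W S \<phi> \<psi> \<phi>' \<psi>' \<phi>'' \<psi>'' x by (rule sl)
  obtain Ug g where g: "open Ug" "x \<in> Ug" "C2_on Ug g" "\<And>y. y \<in> M \<Longrightarrow> y \<in> Ug \<Longrightarrow> R y = ereal (g y)"
    using res unfolding C2_restricted_around_def by blast
  define W' where "W' = W \<inter> \<psi> -` Ug"
  have W': "open W'" unfolding W'_def by (rule continuous_open_preimage[OF continuous_psi(1) W g(1)])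
  have s0: "\<phi> x \<in> W'" using base_mem(1) inv[OF xU] g(2) by (simp add: W'_def)
  \<comment> \<open>\<open>g\<close> is an ambient C^2 extension of \<open>R\<close> on
    \<open>M\<close>. Near \<open>\<phi> x\<close>, only the values of \<open>L\<close> on
    \<open>S\<close> are determined by \<open>R\<close>.\<close>
  define L where "L s = \<gamma> * g (\<psi> s) - \<psi> s \<bullet> (\<gamma> *\<^sub>R v0)" for s
  have "C2_on W' L"
    unfolding L_def[abs_def]
  proof (rule C2_on_compose[where f = \<psi> and W = Ug])
    show "C2_on W' \<psi>" by (rule C2_on_subset[OF ch(6)]) (auto simp: W'_def)
    show "C2_on Ug (\<lambda>y. \<gamma> * g y - y \<bullet> \<gamma> *\<^sub>R v0)" by (rule C2_on_minus_inner[OF g(3)])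
  qed (auto simp: W'_def)
  then obtain L' L'' where L: "\<And>y. y \<in> W' \<Longrightarrow> (L has_derivative blinfun_apply (L' y)) (at y)"
    "\<And>y. y \<in> W' \<Longrightarrow> (L' has_derivative blinfun_apply (L'' y)) (at y)"
    unfolding C2_on_def by blast
  have ev: "\<forall>\<^sub>F s in nhds (\<phi> x). s \<in> W'" using W' s0 by (rule eventually_nhds_in_open)
  have "partly_smooth_chart M U W S \<phi> \<psi> \<phi>' \<psi>' \<phi>'' \<psi>'' x R L L' (L'' (\<phi> x)) \<gamma> v0"
  proof (rule partly_smooth_chart.intro[OF sl partly_smooth_chart_axioms.intro])
    show "\<forall>\<^sub>F s in nhds (\<phi> x). (L has_derivative blinfun_apply (L' s)) (at s)"
      using ev by eventually_elim (rule L(1))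
    show "(L' has_derivative blinfun_apply (L'' (\<phi> x))) (at (\<phi> x))" by (rule L(2)[OF s0])
    show "\<forall>\<^sub>F s in nhds (\<phi> x). s \<in> S \<longrightarrow> \<bar>R (\<psi> s)\<bar> \<noteq> \<infinity> \<and>
      \<gamma> * real_of_ereal (R (\<psi> s)) - \<psi> s \<bullet> \<gamma> *\<^sub>R v0 = L s"
      using ev by eventually_elim (auto simp: W'_def L_def g(4) psi_mem_M)
  qed (rule proper gam tan sc ri)+
  then show thesis by (rule that)
qed

section \<open>Gradients\<close>

lemma grad_eqI:
  assumes "(f has_derivative (\<lambda>h. h \<bullet> D)) (at x)"
  shows "grad f x = D"
  unfolding grad_def
proof (rule the_equality)
  show "GDERIV f x :> D" using assms by (simp add: gderiv_def)
  fix D' assume "GDERIV f x :> D'"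
  then have "(\<lambda>h. h \<bullet> D') = (\<lambda>h. h \<bullet> D)"
    unfolding gderiv_def using assms by (rule has_derivative_unique)
  then show "D' = D" by (metis vector_eq_ldot)
qed

lemma has_derivative_grad:
  fixes f :: "'a::euclidean_space \<Rightarrow> real"
  assumes "f differentiable (at x)"
  shows "(f has_derivative (\<lambda>h. h \<bullet> grad f x)) (at x)"
proof -
  obtain f' where f': "(f has_derivative f') (at x)" using assms by (auto simp: differentiable_def)
  then have lin: "linear f'" using has_derivative_bounded_linear bounded_linear.linear by blast
  have "f' = (\<lambda>h. h \<bullet> (\<Sum>b\<in>Basis. f' b *\<^sub>R b))"
  proof
    fix h
    have "f' h = f' (\<Sum>b\<in>Basis. (h \<bullet> b) *\<^sub>R b)" by (simp add: euclidean_representation)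
    also have "\<dots> = (\<Sum>b\<in>Basis. (h \<bullet> b) *\<^sub>R f' b)" by (simp add: linear_sum[OF lin] linear_scale[OF lin])
    finally show "f' h = h \<bullet> (\<Sum>b\<in>Basis. f' b *\<^sub>R b)" by (simp add: inner_sum_right mult.commute)
  qed
  with f' have d: "(f has_derivative (\<lambda>h. h \<bullet> (\<Sum>b\<in>Basis. f' b *\<^sub>R b))) (at x)" by simp
  then show ?thesis by (simp add: grad_eqI)
qed

lemma grad_compose_orth_proj:
  fixes F :: "'a::euclidean_space \<Rightarrow> real"
  assumes V: "subspace V" and F: "F differentiable (at (orth_proj V x))"
  shows "grad (F \<circ> orth_proj V) x = orth_proj V (grad F (orth_proj V x))"
proof (rule grad_eqI)
  have "bounded_linear (orth_proj V)" using linear_orth_proj[OF V] by (simp add: linear_conv_bounded_linear)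
  then have "(orth_proj V has_derivative orth_proj V) (at x)" by (rule bounded_linear_imp_has_derivative)
  from has_derivative_compose[OF this has_derivative_grad[OF F]]
  show "(F \<circ> orth_proj V has_derivative (\<lambda>h. h \<bullet> orth_proj V (grad F (orth_proj V x)))) (at x)"
    by (simp add: o_def orth_proj_sym[OF V])
qed

lemma hess_mat_eqI:
  assumes "(grad f has_derivative f') (at x)"
  shows "hess_mat f x *v h = f' h"
proof -
  have "linear f'" using assms has_derivative_bounded_linear bounded_linear.linear by blast
  moreover have "frechet_derivative (grad f) (at x) = f'" using frechet_derivative_at[OF assms] by simp
  ultimately show ?thesis unfolding hess_mat_def using fun_cong[OF matrix_vector_mul(2)] by metis
qed

lemma C2_grad_has_derivative:
  fixes f :: "real^'n \<Rightarrow> real"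
  assumes "C2_on U f" "open U" "x \<in> U"
  shows "(grad f has_derivative (\<lambda>h. hess_mat f x *v h)) (at x)"
proof -
  obtain f' f'' where f: "\<And>y. y \<in> U \<Longrightarrow> (f has_derivative blinfun_apply (f' y)) (at y)"
    "\<And>y. y \<in> U \<Longrightarrow> (f' has_derivative blinfun_apply (f'' y)) (at y)"
    using assms(1) unfolding C2_on_def by blast
  have g: "grad f y = (\<Sum>b\<in>Basis. f' y b *\<^sub>R b)" if "y \<in> U" for y
  proof (rule grad_eqI)
    have "blinfun_apply (f' y) = (\<lambda>h. h \<bullet> (\<Sum>b\<in>Basis. f' y b *\<^sub>R b))"
    proof
      fix h
      have "f' y h = f' y (\<Sum>b\<in>Basis. (h \<bullet> b) *\<^sub>R b)" by (simp add: euclidean_representation)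
      also have "\<dots> = (\<Sum>b\<in>Basis. (h \<bullet> b) * f' y b)" by (simp add: blinfun.sum_right blinfun.scaleR_right)
      finally show "f' y h = h \<bullet> (\<Sum>b\<in>Basis. f' y b *\<^sub>R b)" by (simp add: inner_sum_right mult.commute)
    qed
    then show "(f has_derivative (\<lambda>h. h \<bullet> (\<Sum>b\<in>Basis. f' y b *\<^sub>R b))) (at y)"
      using f(1)[OF that] by metis
  qed
  have "((\<lambda>y. \<Sum>b\<in>Basis. f' y b *\<^sub>R b) has_derivative (\<lambda>h. \<Sum>b\<in>Basis. f'' x h b *\<^sub>R b)) (at x)"
    by (intro has_derivative_sum has_derivative_scaleR_left
        bounded_linear.has_derivative[OF blinfun.bounded_linear_left f(2)[OF assms(3)]])
  then have d: "(grad f has_derivative (\<lambda>h. \<Sum>b\<in>Basis. f'' x h b *\<^sub>R b)) (at x)"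
    by (rule has_derivative_transform_within_open[OF _ assms(2,3)]) (simp add: g)
  moreover have "(\<lambda>h. hess_mat f x *v h) = (\<lambda>h. \<Sum>b\<in>Basis. f'' x h b *\<^sub>R b)"
    by (rule ext, rule hess_mat_eqI[OF d])
  ultimately show ?thesis by simp
qed

lemma quadratic_grad_diff:
  fixes f :: "real^'n \<Rightarrow> real"
  assumes "quadratic_fun f"
  shows "grad f y - grad f x = hess_mat f x *v (y - x)"
proof -
  obtain A :: "real^'n^'n" and b c where f: "\<And>x. f x = (x \<bullet> (A *v x)) / 2 + b \<bullet> x + c"
    using assms unfolding quadratic_fun_def by blast
  \<comment> \<open>The matrix \<open>A\<close> may be unsymmetric; the gradient sees only its
    symmetric part.\<close>
  define T where "T h = (1/2) *\<^sub>R (A *v h + transpose A *v h)" for h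
  have blA: "((*v) A has_derivative (*v) A) (at y)" for y
    by (rule bounded_linear_imp_has_derivative) simp
  have g: "grad f y = T y + b" for y
  proof (rule grad_eqI)
    have "((\<lambda>x. 1/2 * (x \<bullet> (A *v x)) + b \<bullet> x + c) has_derivative
        (\<lambda>h. 1/2 * (y \<bullet> (A *v h) + h \<bullet> (A *v y)) + b \<bullet> h + 0)) (at y)"
      by (rule has_derivative_add[OF has_derivative_add[OF has_derivative_mult_right[OF has_derivative_inner[OF has_derivative_ident blA]]
          has_derivative_inner_right[OF has_derivative_ident]] has_derivative_const])
    moreover have "y \<bullet> (A *v h) = h \<bullet> (transpose A *v y)" for h
      by (metis dot_lmul_matrix inner_commute vector_transpose_matrix transpose_transpose transpose_matrix_vector)
    then have "(\<lambda>h. 1/2 * (y \<bullet> (A *v h) + h \<bullet> (A *v y)) + b \<bullet> h + 0) = (\<lambda>h. h \<bullet> (T y + b))"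
      by (auto simp: T_def inner_add_right inner_commute[of b] algebra_simps)
    ultimately show "(f has_derivative (\<lambda>h. h \<bullet> (T y + b))) (at y)"
      by (simp add: f[abs_def])
  qed
  have linT: "linear T"
    unfolding T_def by (rule linearI) (simp_all add: algebra_simps matrix_vector_right_distrib)
  have "(T has_derivative T) (at x)"
    using linT by (intro bounded_linear_imp_has_derivative) (simp add: linear_conv_bounded_linear)
  then have "((\<lambda>y. T y + b) has_derivative (\<lambda>h. T h + 0)) (at x)"
    by (intro has_derivative_add has_derivative_const)
  then have "(grad f has_derivative T) (at x)" by (simp add: g[abs_def])
  then have "hess_mat f x *v (y - x) = T (y - x)" by (rule hess_mat_eqI)
  then show ?thesis by (simp add: g linear_diff[OF linT])
qed

section \<open>Linearization\<close>

text \<open>The remainder \<open>nr\<close> is bounded through \<open>ne\<close>, and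
  \<open>ne\<close> through \<open>nr\<close>; a small factor in front of this loop lets the
  left-hand side absorb it.\<close>

lemma absorbed_remainder:
  fixes nr ne nrho nerr nd \<delta> :: "'b \<Rightarrow> real"
  assumes nonneg: "\<And>k. 0 \<le> nr k" "\<And>k. 0 \<le> ne k" "\<And>k. 0 \<le> nerr k" "\<And>k. 0 \<le> nd k" "\<And>k. 0 \<le> \<delta> k"
    and const: "0 \<le> CN" "0 \<le> C1" "0 \<le> Kw"
    and r: "\<And>\<epsilon>. \<epsilon> > 0 \<Longrightarrow> \<forall>\<^sub>F k in F. nr k \<le> \<epsilon> * ne k + nerr k + \<epsilon> * (ne k + nrho k)"
    and rho: "\<And>k. nrho k \<le> CN * nd k + ne k + nerr k"
    and e: "\<And>k. ne k \<le> C1 * nd k + Kw * nr k"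
    and err: "\<And>\<epsilon>. \<epsilon> > 0 \<Longrightarrow> \<forall>\<^sub>F k in F. nerr k \<le> K1 * \<delta> k + \<epsilon> * nd k"
    and \<epsilon>: "\<epsilon> > 0"
  shows "\<forall>\<^sub>F k in F. nr k \<le> \<epsilon> * nd k + 4 * K1 * \<delta> k"
proof -
  \<comment> \<open>Substitution yields nr \<le> 3 \<eta> Kw nr + \<eta> (3 C1 + CN) nd + 2 nerr.
    The bound by 1/(6 Kw + 1) makes the first coefficient at most 1/2, so doubling produces 4 nerr.
    Half of \<epsilon> then goes to the term in nd, the other half to nerr, taken with tolerance
    \<epsilon>/8.\<close>
  define \<eta> where "\<eta> = min 1 (min (1 / (6 * Kw + 1)) (\<epsilon> / (4 * (3 * C1 + CN + 1))))"
  have \<eta>: "\<eta> > 0" "\<eta> \<le> 1" using \<epsilon> const by (auto simp: \<eta>_def)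
  have "\<eta> \<le> 1 / (6 * Kw + 1)" by (simp add: \<eta>_def)
  then have \<eta>1: "\<eta> * (6 * Kw) \<le> 1"
    using const(3) \<eta> by (simp add: field_simps)
  have "\<eta> \<le> \<epsilon> / (4 * (3 * C1 + CN + 1))" by (simp add: \<eta>_def)
  then have \<eta>2: "\<eta> * (4 * (3 * C1 + CN + 1)) \<le> \<epsilon>"
    using const by (simp add: pos_le_divide_eq)
  have "\<epsilon> / 8 > 0" using \<epsilon> by simp
  from r[OF \<eta>(1)] err[OF this] show ?thesis
  proof eventually_elim
    case (elim k)
    have "\<eta> * nrho k \<le> \<eta> * (CN * nd k + ne k + nerr k)" using rho \<eta> by (intro mult_left_mono) auto
    moreover have "\<eta> * nerr k \<le> 1 * nerr k" using \<eta> nonneg(3) by (intro mult_right_mono) auto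
    moreover have "\<eta> * ne k \<le> \<eta> * (C1 * nd k + Kw * nr k)" using e \<eta> by (intro mult_left_mono) auto
    moreover have "(\<eta> * (6 * Kw)) * nr k \<le> 1 * nr k" using \<eta>1 nonneg(1) by (intro mult_right_mono) auto
    moreover have "(\<eta> * (4 * (3 * C1 + CN + 1))) * nd k \<le> \<epsilon> * nd k" using \<eta>2 nonneg(4) by (intro mult_right_mono) auto
    moreover have "0 \<le> \<eta> * nd k" using \<eta> nonneg(4) by simp
    ultimately show ?case using elim nonneg(4)[of k] \<epsilon> by (simp add: algebra_simps)
  qed
qed

text \<open>The part of \<open>E k\<close> of length at most \<open>K \<delta> k\<close> in its own direction is split off.\<close>

lemma split_remainder:
  fixes E d :: "nat \<Rightarrow> 'a::real_normed_vector" and \<delta> :: "nat \<Rightarrow> real"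
  assumes K: "K \<ge> 0" and \<delta>: "\<And>k. \<delta> k \<ge> 0"
    and E: "\<And>\<epsilon>. \<epsilon> > 0 \<Longrightarrow> \<forall>\<^sub>F k in sequentially. norm (E k) \<le> \<epsilon> * norm (d k) + K * \<delta> k"
  obtains psi chi where "\<And>k. E k = psi k + chi k" "(\<lambda>k. norm (psi k)) \<in> o(\<lambda>k. norm (d k))"
    "(\<lambda>k. norm (chi k)) \<in> O(\<delta>)" "\<And>k. E k = 0 \<Longrightarrow> psi k = 0 \<and> chi k = 0"
proof -
  \<comment> \<open>Where \<open>E k = 0\<close> the quotient is 0 by convention, and both pieces
    vanish because they are multiples of \<open>E k\<close>.\<close>
  define m where "m k = min 1 (K * \<delta> k / norm (E k))" for k
  define chi where "chi k = m k *\<^sub>R E k" for k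
  define psi where "psi k = (1 - m k) *\<^sub>R E k" for k
  have m: "0 \<le> m k" "m k \<le> 1" for k using K \<delta> by (auto simp: m_def)
  have chi: "norm (chi k) \<le> K * \<delta> k" for k
  proof (cases "E k = 0")
    case True
    then show ?thesis using K \<delta> by (simp add: chi_def)
  next
    case False
    have "m k * norm (E k) \<le> K * \<delta> k / norm (E k) * norm (E k)"
      by (intro mult_right_mono) (auto simp: m_def)
    then show ?thesis using False m by (simp add: chi_def)
  qed
  have psi: "norm (psi k) \<le> max 0 (norm (E k) - K * \<delta> k)" for k
  proof (cases "m k = 1")
    case False
    then have mk: "m k = K * \<delta> k / norm (E k)" by (simp add: m_def min_def split: if_splits)
    show ?thesis
    proof (cases "E k = 0")
      case False
      then have "(1 - m k) * norm (E k) = norm (E k) - K * \<delta> k" by (simp add: mk algebra_simps)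
      then show ?thesis using m by (simp add: psi_def)
    qed (simp add: psi_def)
  qed (simp add: psi_def)
  have "(\<lambda>k. norm (psi k)) \<in> o(\<lambda>k. norm (d k))"
  proof (rule landau_o.smallI)
    fix c :: real assume c: "c > 0"
    show "\<forall>\<^sub>F k in sequentially. norm (norm (psi k)) \<le> c * norm (norm (d k))"
      using E[OF c]
    proof eventually_elim
      case (elim k)
      have "0 \<le> c * norm (d k)" using c by simp
      then show ?case using psi[of k] elim by simp
    qed
  qed
  moreover have "(\<lambda>k. norm (chi k)) \<in> O(\<delta>)"
    by (rule landau_o.bigI[of "K + 1"]) (use K chi \<delta> in \<open>auto intro!: always_eventually order_trans[OF chi] mult_right_mono\<close>)
  moreover have "E k = psi k + chi k" for k by (simp add: psi_def chi_def algebra_simps)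
  moreover have "psi k = 0 \<and> chi k = 0" if "E k = 0" for k using that by (simp add: psi_def chi_def)
  ultimately show thesis using that by blast
qed

text \<open>Positive semidefiniteness makes Id + H injective, hence invertible. As \<open>A\<close>
  maps into \<open>T\<close>, the solution for a right-hand side in \<open>T\<close> stays in
  \<open>T\<close>, so the outer projector does not change it. The remainder \<open>r\<close> need
  not lie in \<open>T\<close> and passes through \<open>W\<close> alone.\<close>

lemma resolvent_solution:
  fixes A :: "real^'n \<Rightarrow> real^'n"
  assumes T: "subspace T" and lin: "linear A" and mem: "\<And>h. A h \<in> T"
    and proj: "\<And>h. A (orth_proj T h) = A h" and nonneg: "\<And>h. 0 \<le> A h \<bullet> h"
    and h: "h + A h = orth_proj T y + r"
  defines "W \<equiv> matrix_inv (mat 1 + proj_mat T ** matrix A ** proj_mat T)"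
  shows "h = (proj_mat T ** W ** proj_mat T) *v y + W *v r"
proof -
  define N where "N = mat 1 + proj_mat T ** matrix A ** proj_mat T"
  have N: "N *v g = g + A g" for g
    using fun_cong[OF matrix_vector_mul(2)[OF lin]]
    by (simp add: N_def matrix_vector_mult_add_rdistrib matrix_orth_proj[OF T] proj orth_proj_id[OF T mem]
        flip: matrix_vector_mul_assoc)
  have "g = 0" if "N *v g = 0" for g
  proof -
    have "g \<bullet> g + A g \<bullet> g = 0" using that by (simp add: N flip: inner_add_left)
    then have "g \<bullet> g = 0" using nonneg[of g] inner_ge_zero[of g] by linarith
    then show ?thesis by simp
  qed
  then have "inj ((*v) N)" by (simp add: linear_injective_0)
  then have "invertible N" by (simp add: invertible_left_inverse matrix_left_invertible_injective)
  then have "\<exists>B. N ** B = mat 1 \<and> B ** N = mat 1" by (simp add: invertible_def)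
  then have "N ** matrix_inv N = mat 1 \<and> matrix_inv N ** N = mat 1" unfolding matrix_inv_def by (rule someI_ex)
  then have inv: "N ** W = mat 1" "W ** N = mat 1" by (simp_all add: W_def N_def)
  define q where "q = W *v orth_proj T y"
  have "q + A q = N *v q" by (simp add: N)
  also have "\<dots> = orth_proj T y" by (simp add: q_def matrix_vector_mul_assoc inv)
  finally have "q = orth_proj T y - A q" by (simp add: algebra_simps)
  then have "q \<in> T" using subspace_diff[OF T orth_proj_mem[OF T] mem] by metis
  then have q: "(proj_mat T ** W ** proj_mat T) *v y = q"
    by (simp add: matrix_orth_proj[OF T] orth_proj_id[OF T] q_def flip: matrix_vector_mul_assoc)
  have "h = W *v (N *v h)" by (simp add: matrix_vector_mul_assoc inv)
  also have "\<dots> = q + W *v r" by (simp add: N h q_def matrix_vector_right_distrib)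
  finally show ?thesis by (simp add: q)
qed

theorem theorem4p4:
  fixes R :: "real^'n \<Rightarrow> ereal"
    and F G :: "real^'n \<Rightarrow> real"
    and V M :: "(real^'n) set"
    and \<beta> \<beta>V \<gamma>low \<gamma>up \<gamma> l :: real
    and gam lam :: "nat \<Rightarrow> real"
    and u z x :: "nat \<Rightarrow> real^'n"
    and xs zs :: "real^'n"
  assumes R: "proper_fun R" "convex_fun R" "lsc_fun R"
    and F_convex: "convex_on UNIV F"
    and F_C1: "\<forall>y. F differentiable (at y)" "continuous_on UNIV (grad F)"
    and beta: "0 < \<beta>"
    and F_lipschitz: "(1/\<beta>)-lipschitz_on UNIV (grad F)"
    and V: "subspace V"
    and G_def: "G = F \<circ> orth_proj V"
    and betaV: "\<beta> \<le> \<beta>V"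
    and G_lipschitz: "(1/\<beta>V)-lipschitz_on UNIV (grad G)"
    and Argmin_nonempty: "Argmin (\<lambda>y. ereal (G y) + R y + indicator_fun V y) \<noteq> {}"
    and gam_bounds: "0 < \<gamma>low" "\<forall>k. \<gamma>low \<le> gam k \<and> gam k \<le> \<gamma>up" "\<gamma>up < 2 * \<beta>V"
    and gam_lim: "gam \<longlonglongrightarrow> \<gamma>" "\<gamma> \<in> {\<gamma>low..\<gamma>up}"
    and lam_range: "\<forall>k. lam k \<in> {0<..<(4*\<beta>V - gam k) / (2*\<beta>V)}"
    and lam_diverges:
      "filterlim (\<lambda>n. \<Sum>k<n. lam k * ((4*\<beta>V - gam k) / (2*\<beta>V) - lam k)) at_top sequentially"
    and gam_summable: "summable (\<lambda>k. lam k * \<bar>gam k - \<gamma>\<bar>)"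
    and x_init: "x 0 = orth_proj V (z 0)"
    and u_step: "\<forall>k. u (Suc k) =
      prox (\<lambda>y. ereal (gam k) * R y) (2 *\<^sub>R x k - z k - gam k *\<^sub>R grad G (x k))"
    and z_step: "\<forall>k. z (Suc k) = z k + lam k *\<^sub>R (u (Suc k) - x k)"
    and x_step: "\<forall>k. x (Suc k) = orth_proj V (z (Suc k))"
    and z_lim: "z \<longlonglongrightarrow> zs" "zs \<in> fix_set (FDR_op R G V \<gamma>)"
    and x_lim: "u \<longlonglongrightarrow> xs" "x \<longlonglongrightarrow> xs" "xs = orth_proj V zs"
      "xs \<in> Argmin (\<lambda>y. ereal (G y) + R y + indicator_fun V y)"
    and R_partly_smooth: "partly_smooth R xs M"
    and nondegenerate: "(1/\<gamma>) *\<^sub>R (xs - zs) - grad G xs \<in> rel_interior (subdiff R xs)"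
    and lam_lim: "lam \<longlonglongrightarrow> l" "l \<in> {0<..<(4*\<beta>V - \<gamma>) / (2*\<beta>V)}"
    and F_C2: "\<exists>U. open U \<and> xs \<in> U \<and> C2_on U F"
  shows "\<exists>(psi :: nat \<Rightarrow> real^'n) (chi :: nat \<Rightarrow> real^'n).
    (\<forall>\<^sub>F k in sequentially.
       z (Suc k) - zs = M_gamma_lambda R F V M \<gamma> l xs zs *v (z k - zs) + psi k + chi k) \<and>
    (\<lambda>k. norm (psi k)) \<in> o(\<lambda>k. norm (z k - zs)) \<and>
    (\<lambda>k. norm (chi k)) \<in> O(\<lambda>k. lam k * \<bar>gam k - \<gamma>\<bar>) \<and>
    (locally_polyhedral R xs \<and> quadratic_fun F \<and>
     (\<forall>k. gam k = \<gamma> \<and> lam k = l) \<and>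
     \<gamma> \<in> {0<..<2*\<beta>V} \<and> l \<in> {0<..<(4*\<beta>V - \<gamma>) / (2*\<beta>V)} \<longrightarrow>
       (\<forall>\<^sub>F k in sequentially. psi k = 0 \<and> chi k = 0))"
proof -
  have g0: "\<gamma> > 0" using gam_bounds(1) gam_lim(2) by simp
  have gk: "gam k > 0" "\<gamma>low \<le> gam k" for k using gam_bounds(1,2) by (auto intro: less_le_trans)
  define P where "P = orth_proj V"
  have linP: "linear P" unfolding P_def by (rule linear_orth_proj[OF V])
  have PP: "P (P y) = P y" for y unfolding P_def by (rule orth_proj_id[OF V orth_proj_mem[OF V]])
  have nP: "norm (P y) \<le> norm y" for y unfolding P_def by (rule norm_orth_proj_le[OF V])
  have gradG: "grad G y = P (grad F (P y))" for y
    unfolding G_def P_def by (rule grad_compose_orth_proj[OF V]) (use F_C1 in blast)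
  define v0 where "v0 = (1/\<gamma>) *\<^sub>R (xs - zs) - grad G xs"
  have gv0: "\<gamma> *\<^sub>R v0 = (xs - zs) - \<gamma> *\<^sub>R grad G xs" using g0 by (simp add: v0_def scaleR_diff_right)
  have ri: "v0 \<in> rel_interior (subdiff R xs)" using nondegenerate by (simp add: v0_def)
  obtain U W0 S \<phi> \<psi> \<phi>' \<psi>' \<phi>'' \<psi>'' L L' B
    where ch: "partly_smooth_chart M U W0 S \<phi> \<psi> \<phi>' \<psi>' \<phi>'' \<psi>'' xs R L L' B \<gamma> v0"
    by (rule partly_smooth_chart_exists[OF R(1) g0 R_partly_smooth ri])
  interpret C: partly_smooth_chart M U W0 S \<phi> \<psi> \<phi>' \<psi>' \<phi>'' \<psi>'' xs R L L' B \<gamma> v0 by (rule ch)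
  define A where "A = C.hess"
  define T where "T = tangent_model R xs"
  define Q where "Q = orth_proj T"
  have T: "subspace T" unfolding T_def by (rule subspace_tangent_model)
  have QPT: "Q = C.PT" by (simp add: Q_def T_def C.PT_def[abs_def] C.tangent)
  have linQ: "linear Q" unfolding Q_def by (rule linear_orth_proj[OF T])
  have nQ: "norm (Q y) \<le> norm y" for y unfolding Q_def by (rule norm_orth_proj_le[OF T])
  have linA: "linear A" unfolding A_def by (rule C.linear_hess)
  have A: "A h \<in> T" "A (Q h) = A h" "0 \<le> A h \<bullet> h" for h
    using C.hess_mem C.hess_PT C.hess_nonneg by (simp_all add: A_def QPT T_def C.tangent)
  have "Rbar R G \<gamma> xs zs = C.J"
    by (rule ext) (simp add: Rbar_def C.J_def gv0)
  then have hess: "riem_hess M (Rbar R G \<gamma> xs zs) xs = A" by (simp add: C.riem_hess_eq A_def)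
  define MR where "MR = M_Rbar R G M \<gamma> xs zs"
  define W where "W = W_Rbar R G M \<gamma> xs zs"
  have solve: "h = MR *v y + W *v r" if "h + A h = Q y + r" for h y r
    unfolding MR_def W_def M_Rbar_def W_Rbar_def H_Rbar_def hess T_def[symmetric]
    by (rule resolvent_solution[OF T linA A(1) A(2)[unfolded Q_def] A(3) that[unfolded Q_def]])
  define D where "D = hess_mat F xs"
  define N where "N d = 2 *\<^sub>R P d - d - \<gamma> *\<^sub>R P (D *v P d)" for d
  have linN: "linear N"
    unfolding N_def by (rule linearI)
      (simp_all add: linear_add[OF linP] linear_scale[OF linP] matrix_vector_right_distrib algebra_simps)
  have Mgl: "M_gamma_lambda R F V M \<gamma> l xs zs *v d = d + l *\<^sub>R (MR *v N d - P d)" for d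
  proof -
    have PV: "proj_mat V *v y = P y" for y unfolding P_def by (rule matrix_orth_proj[OF V])
    have "M_gamma R F V M \<gamma> xs zs *v d
        = d + 2 *\<^sub>R (MR *v P d) - MR *v d - P d - \<gamma> *\<^sub>R (MR *v P (D *v P d))"
      by (simp add: M_gamma_def Let_def G_def[symmetric] MR_def[symmetric] H_G_def D_def[symmetric] PV
          matrix_vector_mult_add_rdistrib matrix_vector_mult_diff_rdistrib
          flip: scaleR_matrix_vector_assoc matrix_vector_mul_assoc)
    also have "\<dots> = d + (MR *v N d - P d)"
      by (simp add: N_def matrix_vector_mult_diff_distrib matrix_vector_mult_scaleR)
    finally have Mg: "M_gamma R F V M \<gamma> xs zs *v d = d + (MR *v N d - P d)" .
    have "M_gamma_lambda R F V M \<gamma> l xs zs *v d = (1 - l) *\<^sub>R d + l *\<^sub>R (M_gamma R F V M \<gamma> xs zs *v d)"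
      by (simp add: M_gamma_lambda_def matrix_vector_mult_add_rdistrib flip: scaleR_matrix_vector_assoc)
    then show ?thesis unfolding Mg by (simp add: algebra_simps)
  qed
  define d where "d k = z k - zs" for k
  define e where "e k = u (Suc k) - xs" for k
  define v where "v k = (1 / gam k) *\<^sub>R ((2 *\<^sub>R x k - z k - gam k *\<^sub>R grad G (x k)) - u (Suc k))" for k
  define a where "a k = 2 *\<^sub>R x k - z k - u (Suc k)" for k
  \<comment> \<open>In \<open>\<gamma> *\<^sub>R v k\<close> the step size \<open>gam k\<close>
    cancels from the gradient term and survives only as the factor \<open>\<gamma> / gam k\<close>
    of the bounded sequence \<open>a\<close>. The second summand is the first-order Taylor remainder
    of the gradient of \<open>F\<close>.\<close>
  define err where "err k = (\<gamma> / gam k - 1) *\<^sub>R a k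
    - \<gamma> *\<^sub>R P (grad F (x k) - grad F xs - D *v (x k - xs))" for k
  define rho where "rho k = \<gamma> *\<^sub>R (v k - v0)" for k
  define r where "r k = e k + A (e k) - Q (N (d k))" for k
  have xP: "x k = P (z k)" for k using x_init x_step by (cases k) (simp_all add: P_def)
  have xsP: "xs = P zs" using x_lim(3) by (simp add: P_def)
  have xd: "x k - xs = P (d k)" for k by (simp add: xP xsP d_def linear_diff[OF linP])
  have sub: "v k \<in> subdiff R (u (Suc k))" for k
    using prox_subdiff[OF R gk(1) C.v0_subdiff, of k "2 *\<^sub>R x k - z k - gam k *\<^sub>R grad G (x k)"] u_step
    by (simp add: v_def)
  have ulim: "(\<lambda>k. u (Suc k)) \<longlonglongrightarrow> xs" using x_lim(1) by (rule LIMSEQ_Suc)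
  have "isCont (grad G) xs"
    using lipschitz_on_continuous_on[OF G_lipschitz] by (simp add: continuous_on_eq_continuous_at)
  then have Glim: "(\<lambda>k. grad G (x k)) \<longlonglongrightarrow> grad G xs" using x_lim(2) by (rule isCont_tendsto_compose)
  have vlim: "v \<longlonglongrightarrow> v0"
  proof -
    have "v \<longlonglongrightarrow> (1/\<gamma>) *\<^sub>R ((2 *\<^sub>R xs - zs - \<gamma> *\<^sub>R grad G xs) - xs)"
      unfolding v_def by (intro tendsto_intros gam_lim(1) x_lim(2) z_lim(1) Glim ulim) (use g0 in simp)
    also have "(2 *\<^sub>R xs - zs - \<gamma> *\<^sub>R grad G xs) - xs = \<gamma> *\<^sub>R v0" by (simp add: gv0 scaleR_2)
    finally show ?thesis using g0 by simp
  qed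
  have rho: "rho k = N (d k) - e k + err k" for k
  proof -
    have "\<gamma> *\<^sub>R v k = (\<gamma> / gam k) *\<^sub>R (a k - gam k *\<^sub>R grad G (x k))"
      by (simp add: v_def a_def algebra_simps)
    then have v: "\<gamma> *\<^sub>R v k = (\<gamma> / gam k) *\<^sub>R a k - \<gamma> *\<^sub>R grad G (x k)"
      using gk(1)[of k] by (simp add: scaleR_diff_right)
    have G: "grad G (x k) = P (grad F (x k))" "grad G xs = P (grad F xs)"
      by (simp_all add: gradG xP xsP PP)
    have "2 *\<^sub>R P (d k) - d k - e k - a k = - (xs - zs)"
      unfolding xd[symmetric] by (simp add: d_def e_def a_def scaleR_2)
    then have diff: "xs - zs = a k + e k + d k - 2 *\<^sub>R P (d k)" by (simp add: algebra_simps)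
    have "rho k = \<gamma> *\<^sub>R v k - \<gamma> *\<^sub>R v0" by (simp add: rho_def scaleR_diff_right)
    also have "\<dots> = N (d k) - e k + err k"
      unfolding v gv0 diff G N_def err_def xd linear_diff[OF linP] by (simp add: algebra_simps)
    finally show ?thesis .
  qed
  \<comment> \<open>In this form each group has its own estimate: the normal part of the
    displacement, the projected error, and the deviation of the tangential subgradient from the
    Hessian term.\<close>
  have r: "r k = (e k - Q (e k)) + Q (err k) - (Q (rho k) - A (e k))" for k
    by (simp add: r_def rho linear_add[OF linQ] linear_diff[OF linQ])
  have esol: "e k = MR *v N (d k) + W *v r k" for k
    by (rule solve) (simp add: r_def)
  define E where "E k = z (Suc k) - zs - M_gamma_lambda R F V M \<gamma> l xs zs *v d k" for k
  \<comment> \<open>The matrix carries the limit \<open>l\<close> instead of \<open>lam k\<close>;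
    the mismatch multiplies a linear function of \<open>d k\<close> and is therefore o(d).\<close>
  have E: "E k = (lam k - l) *\<^sub>R (MR *v N (d k) - P (d k)) + lam k *\<^sub>R (W *v r k)" for k
  proof -
    have "e k - P (d k) = u (Suc k) - x k" unfolding xd[symmetric] e_def by simp
    then have "z (Suc k) - zs = d k + lam k *\<^sub>R (e k - P (d k))" using z_step by (simp add: d_def)
    also have "\<dots> = d k + lam k *\<^sub>R (MR *v N (d k) - P (d k)) + lam k *\<^sub>R (W *v r k)"
      by (subst esol) (simp add: algebra_simps)
    finally show ?thesis by (simp add: E_def Mgl algebra_simps)
  qed
  have bounded: "\<exists>K\<ge>0. \<forall>h. norm (f h) \<le> K * norm h" if "linear f" for f :: "real^'n \<Rightarrow> real^'n"
    using bounded_linear.nonneg_bounded[of f] that by (auto simp: linear_conv_bounded_linear mult.commute)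
  obtain CN where CN: "CN \<ge> 0" "\<And>h. norm (N h) \<le> CN * norm h" using bounded[OF linN] by blast
  have linMN: "linear (\<lambda>h. MR *v N h)"
    using linear_compose[OF linN matrix_vector_mul_linear[of MR]] by (simp add: o_def)
  obtain C1 where C1: "C1 \<ge> 0" "\<And>h. norm (MR *v N h) \<le> C1 * norm h" using bounded[OF linMN] by blast
  obtain C2 where C2: "C2 \<ge> 0" "\<And>h. norm (MR *v N h - P h) \<le> C2 * norm h"
    using bounded[OF linear_compose_sub[OF linMN linP]] by blast
  obtain Kw where Kw: "Kw \<ge> 0" "\<And>h. norm (W *v h) \<le> Kw * norm h"
    using bounded[OF matrix_vector_mul_linear[of W]] by blast
  have "a \<longlonglongrightarrow> 2 *\<^sub>R xs - zs - xs"
    unfolding a_def by (intro tendsto_intros x_lim(2) z_lim(1) ulim)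
  then have "Bseq a" by (rule convergent_imp_Bseq[OF convergentI])
  then obtain Ka where Ka: "Ka > 0" "\<And>k. norm (a k) \<le> Ka" by (auto elim: BseqE)
  \<comment> \<open>It comes from |\<gamma> / gam k - 1| = |gam k - \<gamma>| / gam k and the lower
    bound on the step sizes.\<close>
  define K1 where "K1 = Ka / \<gamma>low"
  have K1: "K1 \<ge> 0" using Ka gam_bounds(1) by (simp add: K1_def)
  obtain UF where UF: "open UF" "xs \<in> UF" "C2_on UF F" using F_C2 by blast
  have dF: "(grad F has_derivative (*v) D) (at xs)"
    unfolding D_def by (rule C2_grad_has_derivative[OF UF(3,1,2)])
  have err: "\<forall>\<^sub>F k in sequentially. norm (err k) \<le> K1 * \<bar>gam k - \<gamma>\<bar> + \<epsilon> * norm (d k)" if \<epsilon>: "\<epsilon> > 0" for \<epsilon>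
  proof -
    have "\<epsilon> / \<gamma> > 0" using \<epsilon> g0 by simp
    then obtain t where t: "t > 0" "\<And>y. norm (y - xs) < t \<Longrightarrow>
        norm (grad F y - grad F xs - D *v (y - xs)) \<le> \<epsilon> / \<gamma> * norm (y - xs)"
      using conjunct2[OF iffD1[OF has_derivative_at_alt dF]] by blast
    have "\<forall>\<^sub>F k in sequentially. dist (x k) xs < t" using x_lim(2) t(1) by (rule tendstoD)
    then show ?thesis
    proof eventually_elim
      case (elim k)
      have "norm (P (grad F (x k) - grad F xs - D *v (x k - xs))) \<le> \<epsilon> / \<gamma> * norm (x k - xs)"
        using elim by (intro order_trans[OF nP] t(2)) (simp add: dist_norm)
      also have "\<dots> \<le> \<epsilon> / \<gamma> * norm (d k)"
        using \<epsilon> g0 nP by (intro mult_left_mono) (simp_all add: xd)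
      finally have 1: "\<gamma> * norm (P (grad F (x k) - grad F xs - D *v (x k - xs))) \<le> \<epsilon> * norm (d k)"
        using g0 by (simp add: field_simps)
      have "\<bar>\<gamma> / gam k - 1\<bar> = \<bar>gam k - \<gamma>\<bar> / gam k"
      proof -
        have "\<gamma> / gam k - 1 = (\<gamma> - gam k) / gam k" using gk(1)[of k] by (simp add: diff_divide_distrib)
        then show ?thesis using gk(1)[of k] by (simp add: abs_minus_commute)
      qed
      also have "\<dots> \<le> \<bar>gam k - \<gamma>\<bar> / \<gamma>low"
        using gk[of k] gam_bounds(1) by (intro divide_left_mono) auto
      finally have "\<bar>\<gamma> / gam k - 1\<bar> * norm (a k) \<le> \<bar>gam k - \<gamma>\<bar> / \<gamma>low * Ka"
        using Ka gam_bounds(1) by (intro mult_mono) auto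
      then have 2: "norm ((\<gamma> / gam k - 1) *\<^sub>R a k) \<le> K1 * \<bar>gam k - \<gamma>\<bar>" by (simp add: K1_def mult.commute)
      have "norm (err k) \<le> norm ((\<gamma> / gam k - 1) *\<^sub>R a k)
          + norm (\<gamma> *\<^sub>R P (grad F (x k) - grad F xs - D *v (x k - xs)))"
        unfolding err_def by (rule norm_triangle_ineq4)
      with 1 2 show ?case using g0 by simp
    qed
  qed
  have wM: "\<forall>\<^sub>F k in sequentially. u (Suc k) \<in> M"
    by (rule C.identification[OF ulim vlim sub])
  \<comment> \<open>There is no factor \<open>lam k\<close> here yet; it enters when
    \<open>E\<close> multiplies the remainder by \<open>lam k\<close>.\<close>
  have rbound: "\<forall>\<^sub>F k in sequentially. norm (r k) \<le> \<epsilon> * norm (d k) + 4 * K1 * \<bar>gam k - \<gamma>\<bar>" if "\<epsilon> > 0" for \<epsilon>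
  proof (rule absorbed_remainder[where ne = "\<lambda>k. norm (e k)" and nerr = "\<lambda>k. norm (err k)"
        and nrho = "\<lambda>k. norm (rho k)" and CN = CN and ?C1.0 = C1 and Kw = Kw])
    fix \<eta> :: real assume \<eta>: "\<eta> > 0"
    show "\<forall>\<^sub>F k in sequentially. norm (r k) \<le> \<eta> * norm (e k) + norm (err k) + \<eta> * (norm (e k) + norm (rho k))"
      using C.tangential_expansion[OF ulim wM always_eventually[OF allI[OF sub]] \<eta>]
    proof eventually_elim
      case (elim k)
      have "norm (r k) \<le> norm ((e k - Q (e k)) + Q (err k)) + norm (Q (rho k) - A (e k))"
        unfolding r by (rule norm_triangle_ineq4)
      also have "norm ((e k - Q (e k)) + Q (err k)) \<le> norm (e k - Q (e k)) + norm (Q (err k))"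
        by (rule norm_triangle_ineq)
      finally show ?case using elim nQ[of "err k"] by (simp add: e_def rho_def QPT A_def)
    qed
    show "\<forall>\<^sub>F k in sequentially. norm (err k) \<le> K1 * \<bar>gam k - \<gamma>\<bar> + \<eta> * norm (d k)" by (rule err[OF \<eta>])
  next
    fix k
    have "norm (rho k) \<le> norm (N (d k) - e k) + norm (err k)" unfolding rho by (rule norm_triangle_ineq)
    also have "norm (N (d k) - e k) \<le> norm (N (d k)) + norm (e k)" by (rule norm_triangle_ineq4)
    finally show "norm (rho k) \<le> CN * norm (d k) + norm (e k) + norm (err k)" using CN(2)[of "d k"] by simp
    have "norm (e k) \<le> norm (MR *v N (d k)) + norm (W *v r k)" by (subst esol) (rule norm_triangle_ineq)
    then show "norm (e k) \<le> C1 * norm (d k) + Kw * norm (r k)" using C1(2)[of "d k"] Kw(2)[of "r k"] by simp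
  qed (use CN C1 Kw that in auto)
  have "Bseq lam" by (rule convergent_imp_Bseq[OF convergentI[OF lam_lim(1)]])
  then obtain Kl where Kl: "Kl > 0" "\<And>k. \<bar>lam k\<bar> \<le> Kl" by (auto elim: BseqE)
  have lpos: "lam k > 0" for k using lam_range by simp
  have Ebound: "\<forall>\<^sub>F k in sequentially. norm (E k) \<le> \<epsilon> * norm (d k) + (4 * K1 * Kw) * (lam k * \<bar>gam k - \<gamma>\<bar>)"
    if \<epsilon>: "\<epsilon> > 0" for \<epsilon>
  proof -
    \<comment> \<open>\<epsilon> is shared equally between the two summands of \<open>E\<close>. The
      added 1 here and in \<open>C2 + 1\<close> keeps the denominators positive when a constant is
      0.\<close>
    define q where "q = Kl * (Kw + 1)"
    have q: "q > 0" using Kl(1) Kw(1) by (simp add: q_def)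
    define \<eta> where "\<eta> = \<epsilon> / (2 * q)"
    have \<eta>: "\<eta> > 0" using \<epsilon> q by (simp add: \<eta>_def)
    have "\<epsilon> / (2 * (C2 + 1)) > 0" using \<epsilon> C2 by simp
    then have "\<forall>\<^sub>F k in sequentially. dist (lam k) l < \<epsilon> / (2 * (C2 + 1))" by (rule tendstoD[OF lam_lim(1)])
    with rbound[OF \<eta>] show ?thesis
    proof eventually_elim
      case (elim k)
      have "\<bar>lam k - l\<bar> * (C2 + 1) \<le> \<epsilon> / 2" using elim(2) C2(1) by (simp add: dist_real_def field_simps)
      moreover have "\<bar>lam k - l\<bar> * C2 \<le> \<bar>lam k - l\<bar> * (C2 + 1)" by (intro mult_left_mono) auto
      ultimately have l: "\<bar>lam k - l\<bar> * C2 \<le> \<epsilon> / 2" by linarith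
      have "norm ((lam k - l) *\<^sub>R (MR *v N (d k) - P (d k))) \<le> \<bar>lam k - l\<bar> * (C2 * norm (d k))"
        using C2(2) by (simp add: mult_left_mono)
      also have "\<dots> \<le> \<epsilon> / 2 * norm (d k)" using mult_right_mono[OF l norm_ge_zero[of "d k"]] by simp
      finally have 1: "norm ((lam k - l) *\<^sub>R (MR *v N (d k) - P (d k))) \<le> \<epsilon> / 2 * norm (d k)" .
      have "norm (lam k *\<^sub>R (W *v r k)) \<le> lam k * (Kw * (\<eta> * norm (d k) + 4 * K1 * \<bar>gam k - \<gamma>\<bar>))"
        using lpos[of k] order_trans[OF Kw(2) mult_left_mono[OF elim(1) Kw(1)]] by (simp add: mult_left_mono)
      also have "\<dots> = (lam k * Kw * \<eta>) * norm (d k) + (4 * K1 * Kw) * (lam k * \<bar>gam k - \<gamma>\<bar>)"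
        by (simp add: algebra_simps)
      finally have 2: "norm (lam k *\<^sub>R (W *v r k))
          \<le> (lam k * Kw * \<eta>) * norm (d k) + (4 * K1 * Kw) * (lam k * \<bar>gam k - \<gamma>\<bar>)" .
      have "lam k * Kw * \<eta> \<le> Kl * (Kw + 1) * \<eta>"
        using Kl(2)[of k] Kl(1) Kw(1) \<eta> by (intro mult_right_mono mult_mono) auto
      also have "\<dots> = \<epsilon> / 2" using q by (simp add: \<eta>_def flip: q_def)
      finally have 3: "(lam k * Kw * \<eta>) * norm (d k) \<le> \<epsilon> / 2 * norm (d k)" by (intro mult_right_mono) auto
      have "norm (E k) \<le> norm ((lam k - l) *\<^sub>R (MR *v N (d k) - P (d k))) + norm (lam k *\<^sub>R (W *v r k))"
        unfolding E by (rule norm_triangle_ineq)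
      with 1 2 3 show ?case by linarith
    qed
  qed
  have exact: "\<forall>\<^sub>F k in sequentially. E k = 0"
    if poly: "locally_polyhedral R xs" and quad: "quadratic_fun F" and const: "\<forall>k. gam k = \<gamma> \<and> lam k = l"
    using locally_polyhedral_identification[OF R(1) poly ri ulim vlim always_eventually[OF allI[OF sub]]]
  proof eventually_elim
    case (elim k)
    \<comment> \<open>The constant step size removes the first summand, the affine gradient of a
      quadratic \<open>F\<close> the second.\<close>
    have err0: "err k = 0"
      using const g0 quadratic_grad_diff[OF quad, of "x k" xs] by (simp add: err_def D_def linear_0[OF linP])
    have "e k \<in> T" using elim by (simp add: e_def T_def)
    then have Qe: "Q (e k) = e k" unfolding Q_def by (rule orth_proj_id[OF T])
    have "Q (rho k) = 0"
      unfolding Q_def by (rule orth_proj_eqI[OF T subspace_0[OF T]]) (use elim in \<open>simp add: rho_def T_def\<close>)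
    then have "r k = 0"
      unfolding r by (simp add: Qe err0 linear_0[OF linQ] A_def C.polyhedral_hess_zero[OF poly])
    then show ?case using const by (simp add: E)
  qed
  have KK: "0 \<le> 4 * K1 * Kw" using K1 Kw(1) by simp
  have dd: "0 \<le> lam k * \<bar>gam k - \<gamma>\<bar>" for k using lpos[of k] by simp
  obtain psi chi where pc: "\<And>k. E k = psi k + chi k" "(\<lambda>k. norm (psi k)) \<in> o(\<lambda>k. norm (d k))"
    "(\<lambda>k. norm (chi k)) \<in> O(\<lambda>k. lam k * \<bar>gam k - \<gamma>\<bar>)" "\<And>k. E k = 0 \<Longrightarrow> psi k = 0 \<and> chi k = 0"
    by (rule split_remainder[OF KK dd Ebound]) (assumption | rule that)+
  show ?thesis
  proof (rule exI[of _ psi], rule exI[of _ chi], intro conjI impI)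
    have "z (Suc k) - zs = M_gamma_lambda R F V M \<gamma> l xs zs *v (z k - zs) + E k" for k
      by (simp add: E_def d_def)
    then have "z (Suc k) - zs = M_gamma_lambda R F V M \<gamma> l xs zs *v (z k - zs) + psi k + chi k" for k
      unfolding pc(1) by (simp only: add.assoc)
    then show "\<forall>\<^sub>F k in sequentially. z (Suc k) - zs = M_gamma_lambda R F V M \<gamma> l xs zs *v (z k - zs) + psi k + chi k"
      by (intro always_eventually allI)
    show "(\<lambda>k. norm (psi k)) \<in> o(\<lambda>k. norm (z k - zs))" using pc(2) by (simp add: d_def)
    show "(\<lambda>k. norm (chi k)) \<in> O(\<lambda>k. lam k * \<bar>gam k - \<gamma>\<bar>)" by (rule pc(3))
    assume "locally_polyhedral R xs \<and> quadratic_fun F \<and> (\<forall>k. gam k = \<gamma> \<and> lam k = l) \<and>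
     \<gamma> \<in> {0<..<2*\<beta>V} \<and> l \<in> {0<..<(4*\<beta>V - \<gamma>) / (2*\<beta>V)}"
    then have "\<forall>\<^sub>F k in sequentially. E k = 0" using exact by blast
    then show "\<forall>\<^sub>F k in sequentially. psi k = 0 \<and> chi k = 0" by eventually_elim (rule pc(4))
  qed
qed

end
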